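(* Let $n \ge 5$. Then there exist split exact sequences $$1\to \operatorname{Aut}_{inv}(PVT_n)\to \langle \operatorname{Aut}_{gr}(PVT_n), \operatorname{Aut}_{inv}(PVT_n) \rangle \to \operatorname{Aut}_{gr}(PVT_n) \to 1$$ and $$1\to \operatorname{Inn}(PVT_n)\to \operatorname{Aut}(PVT_n)\to \langle \operatorname{Aut}_{gr}(PVT_n), \operatorname{Aut}_{inv}(PVT_n) \rangle \to 1.$$ In particular, $$\langle \operatorname{Aut}_{gr}(PVT_n), \operatorname{Aut}_{inv}(PVT_n) \rangle \cong \mathbb{Z}_2^{n(n-1)/2} \rtimes S_n$$ and $$\operatorname{Aut}(PVT_n) \cong PVT_n \rtimes (\mathbb{Z}_2^{n(n-1)/2} \rtimes S_n).$$
   Context: The virtual twin group $VT_n$ has generators $s_1,\dots,s_{n-1},\rho_1,\dots,\rho_{n-1}$ and defining relations: $s_i^2=\rho_i^2=1$; $s_is_j=s_js_i$, $\rho_i\rho_j=\rho_j\rho_i$, $\rho_is_j=s_j\rho_i$ for $|i-j|\ge 2$; $\rho_i\rho_{i+1}\rho_i=\rho_{i+1}\rho_i\rho_{i+1}$ and $\rho_i\rho_{i+1}s_i=s_{i+1}\rho_i\rho_{i+1}$ for $1\le i\le n-2$. The pure virtual twin group $PVT_n$ is the kernel of $VT_n\to S_n$, $s_i,\rho_i\mapsto(i,i+1)$. It is generated by $\mathcal S=\{\lambda_{i,j}: 1\le i<j\le n\}$, where $\lambda_{i,i+1}=s_i\rho_i$ and $\lambda_{i,j}=\rho_{j-1}\cdots\rho_{i+1}\lambda_{i,i+1}\rho_{i+1}\cdots\rho_{j-1}$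 for $j\neq i+1$; its presentation on these generators is the right-angled Artin presentation with relations $\lambda_{i,j}\lambda_{k,l}=\lambda_{k,l}\lambda_{i,j}$ for pairwise distinct $i,j,k,l$. The graph of $PVT_n$ has vertex set $\mathcal S$, with an edge between two distinct vertices iff they commute (iff their index pairs are disjoint). $\operatorname{Aut}_{gr}(PVT_n)$ is the subgroup of $\operatorname{Aut}(PVT_n)$ generated by the automorphisms induced by automorphisms of this graph; $\operatorname{Aut}_{inv}(PVT_n)$ is the subgroup generated by the inversions (an inversion sends one generator in $\mathcal S$ to its inverse and fixes all the others); $\operatorname{Inn}(PVT_n)$ is the group of inner automorphisms. In both exact sequences the injections are the inclusions of subgroups, and the splittings are the inclusions of the right-hand groups as subgroups of the middle groups. $\mathbb Z_2$ denotes the cyclic group of order 2. *)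

theory Defs
  imports
    "HOL-Algebra.Bij"
    "HOL-Algebra.Exact_Sequence"
    "HOL-Algebra.Product_Groups"
    "HOL-Algebra.Sym_Groups"
begin

section \<open>Groups given by generators and relations\<close>

text \<open>A word in the generators and their inverses: \<open>(x, True)\<close> stands for \<open>x\<close> and
  \<open>(x, False)\<close> for its inverse.\<close>

type_synonym 'g word = "('g \<times> bool) list"

definition words :: "'g set \<Rightarrow> 'g word set" where
  "words X = lists (X \<times> UNIV)"

text \<open>A relation \<open>l = r\<close> is the pair \<open>(l, r)\<close>.\<close>

inductive word_eq :: "'g set \<Rightarrow> ('g word \<times> 'g word) set \<Rightarrow> 'g word \<Rightarrow> 'g word \<Rightarrow> bool"
  for X :: "'g set" and R :: "('g word \<times> 'g word) set" where
  word_refl: "w \<in> words X \<Longrightarrow> word_eq X R w w"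
| word_sym: "word_eq X R u v \<Longrightarrow> word_eq X R v u"
| word_trans: "word_eq X R u v \<Longrightarrow> word_eq X R v w \<Longrightarrow> word_eq X R u w"
| word_cancel: "x \<in> X \<Longrightarrow> u \<in> words X \<Longrightarrow> v \<in> words X \<Longrightarrow>
    word_eq X R (u @ [(x, b), (x, \<not> b)] @ v) (u @ v)"
| word_rel: "(l, r) \<in> R \<Longrightarrow> l \<in> words X \<Longrightarrow> r \<in> words X \<Longrightarrow> u \<in> words X \<Longrightarrow> v \<in> words X \<Longrightarrow>
    word_eq X R (u @ l @ v) (u @ r @ v)"

definition word_class :: "'g set \<Rightarrow> ('g word \<times> 'g word) set \<Rightarrow> 'g word \<Rightarrow> 'g word set" where
  "word_class X R w = {v. word_eq X R w v}"

definition presented_group :: "'g set \<Rightarrow> ('g word \<times> 'g word) set \<Rightarrow> 'g word set monoid" where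
  "presented_group X R =
     \<lparr>carrier = word_class X R ` words X,
      monoid.mult = (\<lambda>A B. \<Union>a\<in>A. \<Union>b\<in>B. word_class X R (a @ b)),
      one = word_class X R []\<rparr>"

definition word_eval :: "('a, 'b) monoid_scheme \<Rightarrow> ('g \<Rightarrow> 'a) \<Rightarrow> 'g word \<Rightarrow> 'a" where
  "word_eval G f w =
     foldr (\<lambda>(x, b) a. (if b then f x else inv\<^bsub>G\<^esub> (f x)) \<otimes>\<^bsub>G\<^esub> a) w \<one>\<^bsub>G\<^esub>"

text \<open>The map out of a presented group that extends \<open>f\<close> on the generators; it does not depend on
  the chosen representative as soon as \<open>f\<close> respects the relations (\<open>induced_hom_class\<close> below).\<close>

definition induced_hom :: "('a, 'b) monoid_scheme \<Rightarrow> ('g \<Rightarrow> 'a) \<Rightarrow> 'g word set \<Rightarrow> 'a" where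
  "induced_hom G f A = word_eval G f (SOME w. w \<in> A)"

lemma words_simps [simp]:
  "[] \<in> words X"
  "(p # w) \<in> words X \<longleftrightarrow> fst p \<in> X \<and> w \<in> words X"
  "(u @ v) \<in> words X \<longleftrightarrow> u \<in> words X \<and> v \<in> words X"
  by (cases p; auto simp: words_def)+

lemma word_eq_words: "word_eq X R u v \<Longrightarrow> u \<in> words X \<and> v \<in> words X"
  by (induction rule: word_eq.induct) auto

lemma word_eq_context:
  "word_eq X R u v \<Longrightarrow> a \<in> words X \<Longrightarrow> b \<in> words X \<Longrightarrow> word_eq X R (a @ u @ b) (a @ v @ b)"
proof (induction rule: word_eq.induct)
  case (word_cancel x u v c)
  then show ?case using word_eq.word_cancel[of x X "a @ u" "v @ b" R c] by simp
next
  case (word_rel l r u v)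
  then show ?case using word_eq.word_rel[of l r R X "a @ u" "v @ b"] by simp
next
  case (word_refl w)
  then show ?case by (simp add: word_eq.word_refl)
next
  case (word_sym u v)
  then show ?case by (blast intro: word_eq.word_sym)
next
  case (word_trans u v w)
  then show ?case by (meson word_eq.word_trans)
qed

lemma word_eq_append:
  assumes "word_eq X R u u'" "word_eq X R v v'"
  shows "word_eq X R (u @ v) (u' @ v')"
proof -
  have "word_eq X R (u @ v) (u' @ v)"
    using word_eq_context[OF assms(1), of "[]" v] word_eq_words[OF assms(2)] by simp
  moreover have "word_eq X R (u' @ v) (u' @ v')"
    using word_eq_context[OF assms(2), of u' "[]"] word_eq_words[OF assms(1)] by simp
  ultimately show ?thesis by (rule word_trans)
qed

lemma word_class_eqI: "word_eq X R u v \<Longrightarrow> word_class X R u = word_class X R v"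
  unfolding word_class_def set_eq_iff mem_Collect_eq by (meson word_sym word_trans)

lemma word_class_eqD: "u \<in> words X \<Longrightarrow> word_class X R v = word_class X R u \<Longrightarrow> word_eq X R v u"
  using word_refl[of u X R] by (auto simp: word_class_def set_eq_iff)

lemma presented_group_mult:
  assumes "u \<in> words X" "v \<in> words X"
  shows "word_class X R u \<otimes>\<^bsub>presented_group X R\<^esub> word_class X R v = word_class X R (u @ v)"
proof -
  have "word_class X R (a @ b) = word_class X R (u @ v)"
    if "a \<in> word_class X R u" "b \<in> word_class X R v" for a b
    using that word_class_eqI[OF word_eq_append[of X R u a v b]] by (simp add: word_class_def)
  moreover have "u \<in> word_class X R u" "v \<in> word_class X R v"
    using assms by (simp_all add: word_class_def word_refl)
  ultimately have "(\<Union>a\<in>word_class X R u. \<Union>b\<in>word_class X R v. word_class X R (a @ b))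
      = word_class X R (u @ v)"
    by blast
  then show ?thesis by (simp add: presented_group_def)
qed

definition word_inv :: "'g word \<Rightarrow> 'g word" where
  "word_inv w = map (map_prod id Not) (rev w)"

lemma word_inv_words [simp]: "w \<in> words X \<Longrightarrow> word_inv w \<in> words X"
  by (auto simp: word_inv_def words_def in_lists_conv_set)

lemma word_inv_left: "w \<in> words X \<Longrightarrow> word_eq X R (word_inv w @ w) []"
proof (induction w)
  case Nil
  then show ?case by (simp add: word_inv_def word_refl)
next
  case (Cons p w)
  obtain x c where p: "p = (x, c)" by (cases p)
  have w: "w \<in> words X" "x \<in> X" using Cons.prems p by auto
  have "word_eq X R (word_inv w @ [(x, \<not> c), (x, c)] @ w) (word_inv w @ w)"
    using word_cancel[of x X "word_inv w" w R "\<not> c"] w by simp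
  then show ?case using Cons.IH[OF w(1)] p
    by (simp add: word_inv_def) (meson word_trans)
qed

lemma presented_group_group: "group (presented_group X R)"
proof (rule groupI)
  let ?G = "presented_group X R"
  have carr: "carrier ?G = word_class X R ` words X"
    and one: "\<one>\<^bsub>?G\<^esub> = word_class X R []"
    by (simp_all add: presented_group_def)
  show "\<one>\<^bsub>?G\<^esub> \<in> carrier ?G" by (auto simp: carr one)
  fix x assume "x \<in> carrier ?G"
  then obtain u where u: "u \<in> words X" "x = word_class X R u" by (auto simp: carr)
  show "\<one>\<^bsub>?G\<^esub> \<otimes>\<^bsub>?G\<^esub> x = x"
    using u by (simp add: one presented_group_mult)
  show "\<exists>y\<in>carrier ?G. y \<otimes>\<^bsub>?G\<^esub> x = \<one>\<^bsub>?G\<^esub>"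
    using u word_class_eqI[OF word_inv_left[OF u(1), of R]]
    by (intro bexI[of _ "word_class X R (word_inv u)"])
       (auto simp: carr one presented_group_mult)
  fix y assume "y \<in> carrier ?G"
  then obtain v where v: "v \<in> words X" "y = word_class X R v" by (auto simp: carr)
  show "x \<otimes>\<^bsub>?G\<^esub> y \<in> carrier ?G"
    using u v by (auto simp: carr presented_group_mult)
  fix z assume "z \<in> carrier ?G"
  then obtain w where w: "w \<in> words X" "z = word_class X R w" by (auto simp: carr)
  show "x \<otimes>\<^bsub>?G\<^esub> y \<otimes>\<^bsub>?G\<^esub> z = x \<otimes>\<^bsub>?G\<^esub> (y \<otimes>\<^bsub>?G\<^esub> z)"
    using u v w by (simp add: presented_group_mult)
qed

context group
begin

lemma word_eval_closed:
  "f \<in> X \<rightarrow> carrier G \<Longrightarrow> w \<in> words X \<Longrightarrow> word_eval G f w \<in> carrier G"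
  by (induction w) (auto simp: word_eval_def Pi_iff)

lemma word_eval_Cons:
  "word_eval G f ((x, b) # w) = (if b then f x else inv (f x)) \<otimes> word_eval G f w"
  by (simp add: word_eval_def)

lemma word_eval_append:
  assumes "f \<in> X \<rightarrow> carrier G" "u \<in> words X" "v \<in> words X"
  shows "word_eval G f (u @ v) = word_eval G f u \<otimes> word_eval G f v"
  using assms(2)
proof (induction u)
  case Nil
  then show ?case using word_eval_closed[OF assms(1,3)] by (simp add: word_eval_def)
next
  case (Cons p u)
  obtain x b where p: "p = (x, b)" by (cases p)
  then have "x \<in> X" "u \<in> words X" using Cons.prems by auto
  then show ?case
    using p Cons.IH word_eval_closed[OF assms(1)] assms
    by (auto simp: word_eval_Cons m_assoc Pi_iff)
qed

lemma word_eval_respects: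
  assumes f: "f \<in> X \<rightarrow> carrier G"
    and R: "\<And>l r. (l, r) \<in> R \<Longrightarrow> l \<in> words X \<Longrightarrow> r \<in> words X \<Longrightarrow> word_eval G f l = word_eval G f r"
  shows "word_eq X R u v \<Longrightarrow> word_eval G f u = word_eval G f v"
proof (induction rule: word_eq.induct)
  case (word_cancel x u v b)
  have fx: "f x \<in> carrier G" using word_cancel f by auto
  have "word_eval G f [(x, b), (x, \<not> b)] = \<one>"
    using fx by (simp add: word_eval_def)
  then show ?case
    using word_cancel word_eval_closed[OF f]
    by (simp add: word_eval_append[OF f] del: append_Cons append_Nil)
next
  case (word_rel l r u v)
  then show ?case using R by (simp add: word_eval_append[OF f])
qed auto

lemma induced_hom_class:
  assumes f: "f \<in> X \<rightarrow> carrier G"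
    and R: "\<And>l r. (l, r) \<in> R \<Longrightarrow> l \<in> words X \<Longrightarrow> r \<in> words X \<Longrightarrow> word_eval G f l = word_eval G f r"
    and w: "w \<in> words X"
  shows "induced_hom G f (word_class X R w) = word_eval G f w"
proof -
  have "(SOME v. v \<in> word_class X R w) \<in> word_class X R w"
    by (rule someI[of _ w]) (simp add: word_class_def w word_refl)
  then show ?thesis
    using word_eval_respects[OF f R] by (simp add: induced_hom_def word_class_def)
qed

lemma induced_hom_hom:
  assumes f: "f \<in> X \<rightarrow> carrier G"
    and R: "\<And>l r. (l, r) \<in> R \<Longrightarrow> l \<in> words X \<Longrightarrow> r \<in> words X \<Longrightarrow> word_eval G f l = word_eval G f r"
  shows "induced_hom G f \<in> hom (presented_group X R) G"
proof (rule homI)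
  fix x assume "x \<in> carrier (presented_group X R)"
  then obtain u where u: "u \<in> words X" "x = word_class X R u" by (auto simp: presented_group_def)
  show "induced_hom G f x \<in> carrier G"
    using u by (simp add: induced_hom_class[OF f R] word_eval_closed[OF f])
  fix y assume "y \<in> carrier (presented_group X R)"
  then obtain v where v: "v \<in> words X" "y = word_class X R v" by (auto simp: presented_group_def)
  show "induced_hom G f (x \<otimes>\<^bsub>presented_group X R\<^esub> y) = induced_hom G f x \<otimes> induced_hom G f y"
    using u v by (simp add: presented_group_mult induced_hom_class[OF f R] word_eval_append[OF f])
qed

end

section \<open>Virtual twin groups\<close>

datatype vt_gen = S nat | Rho nat

definition vt_gens :: "nat \<Rightarrow> vt_gen set" where
  "vt_gens n = S ` {1..<n} \<union> Rho ` {1..<n}"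

inductive_set vt_rels :: "nat \<Rightarrow> (vt_gen list \<times> vt_gen list) set" for n :: nat where
  "i \<in> {1..<n} \<Longrightarrow> ([S i, S i], []) \<in> vt_rels n"
| "i \<in> {1..<n} \<Longrightarrow> ([Rho i, Rho i], []) \<in> vt_rels n"
| "i \<in> {1..<n} \<Longrightarrow> j \<in> {1..<n} \<Longrightarrow> \<bar>int i - int j\<bar> \<ge> 2 \<Longrightarrow>
     ([S i, S j], [S j, S i]) \<in> vt_rels n"
| "i \<in> {1..<n} \<Longrightarrow> j \<in> {1..<n} \<Longrightarrow> \<bar>int i - int j\<bar> \<ge> 2 \<Longrightarrow>
     ([Rho i, Rho j], [Rho j, Rho i]) \<in> vt_rels n"
| "i \<in> {1..<n} \<Longrightarrow> j \<in> {1..<n} \<Longrightarrow> \<bar>int i - int j\<bar> \<ge> 2 \<Longrightarrow>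
     ([Rho i, S j], [S j, Rho i]) \<in> vt_rels n"
| "1 \<le> i \<Longrightarrow> i + 2 \<le> n \<Longrightarrow>
     ([Rho i, Rho (i + 1), Rho i], [Rho (i + 1), Rho i, Rho (i + 1)]) \<in> vt_rels n"
| "1 \<le> i \<Longrightarrow> i + 2 \<le> n \<Longrightarrow>
     ([Rho i, Rho (i + 1), S i], [S (i + 1), Rho i, Rho (i + 1)]) \<in> vt_rels n"

definition pos_word :: "'g list \<Rightarrow> 'g word" where
  "pos_word xs = map (\<lambda>x. (x, True)) xs"

abbreviation vt_word_rels :: "nat \<Rightarrow> (vt_gen word \<times> vt_gen word) set" where
  "vt_word_rels n \<equiv> map_prod pos_word pos_word ` vt_rels n"

definition VT :: "nat \<Rightarrow> vt_gen word set monoid" where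
  "VT n = presented_group (vt_gens n) (vt_word_rels n)"

definition vt_elem :: "nat \<Rightarrow> vt_gen list \<Rightarrow> vt_gen word set" where
  "vt_elem n xs = word_class (vt_gens n) (vt_word_rels n) (pos_word xs)"

fun gen_perm :: "vt_gen \<Rightarrow> nat \<Rightarrow> nat" where
  "gen_perm (S i) = transpose i (i + 1)"
| "gen_perm (Rho i) = transpose i (i + 1)"

definition vt_to_sym :: "nat \<Rightarrow> vt_gen word set \<Rightarrow> nat \<Rightarrow> nat" where
  "vt_to_sym n = induced_hom (sym_group n) gen_perm"

definition PVT :: "nat \<Rightarrow> vt_gen word set monoid" where
  "PVT n = (VT n) \<lparr>carrier := kernel (VT n) (sym_group n) (vt_to_sym n)\<rparr>"

text \<open>For \<open>j = i + 1\<close> the two conjugating words are empty.\<close>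

definition pvt_gen :: "nat \<Rightarrow> nat \<Rightarrow> nat \<Rightarrow> vt_gen word set" where
  "pvt_gen n i j =
     vt_elem n (map Rho (rev [i + 1..<j]) @ [S i, Rho i] @ map Rho [i + 1..<j])"

definition pvt_gens :: "nat \<Rightarrow> vt_gen word set set" where
  "pvt_gens n = {pvt_gen n i j | i j. 1 \<le> i \<and> i < j \<and> j \<le> n}"

lemma VT_group: "group (VT n)"
  by (simp add: VT_def presented_group_group)

lemma pos_word_words [simp]: "pos_word xs \<in> words X \<longleftrightarrow> set xs \<subseteq> X"
  by (auto simp: pos_word_def words_def)

lemma pos_word_append [simp]: "pos_word (xs @ ys) = pos_word xs @ pos_word ys"
  by (simp add: pos_word_def)

lemma vt_elem_carrier: "set xs \<subseteq> vt_gens n \<Longrightarrow> vt_elem n xs \<in> carrier (VT n)"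
  by (simp add: VT_def presented_group_def vt_elem_def)

lemma vt_elem_mult:
  assumes "set xs \<subseteq> vt_gens n" "set ys \<subseteq> vt_gens n"
  shows "vt_elem n xs \<otimes>\<^bsub>VT n\<^esub> vt_elem n ys = vt_elem n (xs @ ys)"
  using assms presented_group_mult[of "pos_word xs" "vt_gens n" "pos_word ys" "vt_word_rels n"]
  by (simp add: VT_def vt_elem_def)

lemma gen_perm_carrier: "gen_perm \<in> vt_gens n \<rightarrow> carrier (sym_group n)"
  by (auto simp: vt_gens_def sym_group_carrier intro!: permutes_swap_id)

lemma sym_eval_pos_word:
  "word_eval (sym_group n) gen_perm (pos_word xs) = foldr (\<circ>) (map gen_perm xs) id"
  by (induction xs) (simp_all add: word_eval_def pos_word_def sym_group_def)

lemma vt_rels_respected: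
  assumes "(l, r) \<in> vt_word_rels n"
  shows "word_eval (sym_group n) gen_perm l = word_eval (sym_group n) gen_perm r"
proof -
  obtain xs ys where "(xs, ys) \<in> vt_rels n" "l = pos_word xs" "r = pos_word ys"
    using assms by auto
  moreover have "foldr (\<circ>) (map gen_perm xs) id = foldr (\<circ>) (map gen_perm ys) id"
    using \<open>(xs, ys) \<in> vt_rels n\<close>
    by cases (auto simp: fun_eq_iff transpose_def)
  ultimately show ?thesis by (simp add: sym_eval_pos_word)
qed

lemma vt_to_sym_hom: "vt_to_sym n \<in> hom (VT n) (sym_group n)"
  unfolding vt_to_sym_def VT_def
  by (rule group.induced_hom_hom[OF sym_group_is_group gen_perm_carrier]) (rule vt_rels_respected)

lemma vt_to_sym_elem:
  "set xs \<subseteq> vt_gens n \<Longrightarrow> vt_to_sym n (vt_elem n xs) = foldr (\<circ>) (map gen_perm xs) id"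
  unfolding vt_to_sym_def vt_elem_def
  using group.induced_hom_class[OF sym_group_is_group gen_perm_carrier, of "vt_word_rels n" n "pos_word xs"]
  by (simp add: vt_rels_respected sym_eval_pos_word)

lemma PVT_group: "group (PVT n)"
  unfolding PVT_def
  by (intro subgroup.subgroup_is_group group_hom.subgroup_kernel VT_group)
     (simp add: group_hom_def group_hom_axioms_def VT_group sym_group_is_group vt_to_sym_hom)

lemma foldr_comp_append:
  "foldr (\<circ>) (xs @ ys) id = foldr (\<circ>) xs id \<circ> foldr (\<circ>) ys id"
  by (induction xs) (simp_all add: comp_assoc)

lemma foldr_comp_rev:
  "(\<And>f. f \<in> set fs \<Longrightarrow> f \<circ> f = id) \<Longrightarrow> foldr (\<circ>) (rev fs) id \<circ> foldr (\<circ>) fs id = id"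
proof (induction fs)
  case (Cons f fs)
  have "foldr (\<circ>) (rev (f # fs)) id \<circ> foldr (\<circ>) (f # fs) id =
      foldr (\<circ>) (rev fs) id \<circ> (f \<circ> f) \<circ> foldr (\<circ>) fs id"
    by (simp add: foldr_comp_append comp_assoc del: foldr_append)
  also have "f \<circ> f = id" by (rule Cons.prems) simp
  finally have "foldr (\<circ>) (rev (f # fs)) id \<circ> foldr (\<circ>) (f # fs) id =
      foldr (\<circ>) (rev fs) id \<circ> foldr (\<circ>) fs id"
    by (simp only: comp_id)
  also have "\<dots> = id" by (rule Cons.IH, rule Cons.prems) simp
  finally show ?case .
qed simp

lemma pvt_gens_subset: "pvt_gens n \<subseteq> carrier (PVT n)"
proof
  fix x assume "x \<in> pvt_gens n"
  then obtain i j where ij: "1 \<le> i" "i < j" "j \<le> n" "x = pvt_gen n i j"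
    by (auto simp: pvt_gens_def)
  let ?u = "[i + 1..<j]"
  let ?w = "map Rho (rev ?u) @ [S i, Rho i] @ map Rho ?u"
  have sub: "set ?w \<subseteq> vt_gens n"
    using ij by (auto simp: vt_gens_def)
  have "map gen_perm ?w = rev (map (gen_perm \<circ> Rho) ?u) @
      [transpose i (i + 1), transpose i (i + 1)] @ map (gen_perm \<circ> Rho) ?u"
    by (simp add: rev_map)
  moreover have "foldr (\<circ>) (rev (map (gen_perm \<circ> Rho) ?u)) id \<circ>
      foldr (\<circ>) (map (gen_perm \<circ> Rho) ?u) id = id"
    by (rule foldr_comp_rev) auto
  moreover have "foldr (\<circ>) [transpose i (i + 1), transpose i (i + 1)] id = id"
    by simp
  ultimately have "foldr (\<circ>) (map gen_perm ?w) id = id"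
    by (simp only: foldr_comp_append id_comp)
  then have "vt_to_sym n x = id"
    unfolding ij(4) pvt_gen_def vt_to_sym_elem[OF sub] .
  then show "x \<in> carrier (PVT n)"
    using vt_elem_carrier[OF sub] ij(4)
    by (simp add: PVT_def kernel_def pvt_gen_def sym_group_def)
qed

section \<open>Subgroups of the automorphism group\<close>

definition inner_auts :: "('a, 'b) monoid_scheme \<Rightarrow> ('a \<Rightarrow> 'a) set" where
  "inner_auts G = (\<lambda>g. \<lambda>h\<in>carrier G. g \<otimes>\<^bsub>G\<^esub> h \<otimes>\<^bsub>G\<^esub> inv\<^bsub>G\<^esub> g) ` carrier G"

definition commuting_adj :: "('a, 'b) monoid_scheme \<Rightarrow> 'a \<Rightarrow> 'a \<Rightarrow> bool" where
  "commuting_adj G x y \<longleftrightarrow> x \<noteq> y \<and> x \<otimes>\<^bsub>G\<^esub> y = y \<otimes>\<^bsub>G\<^esub> x"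

definition graph_auts :: "'a set \<Rightarrow> ('a \<Rightarrow> 'a \<Rightarrow> bool) \<Rightarrow> ('a \<Rightarrow> 'a) set" where
  "graph_auts V adj =
     {\<pi>. bij_betw \<pi> V V \<and> (\<forall>x\<in>V. \<forall>y\<in>V. adj (\<pi> x) (\<pi> y) \<longleftrightarrow> adj x y)}"

definition Aut_gr :: "nat \<Rightarrow> (vt_gen word set \<Rightarrow> vt_gen word set) set" where
  "Aut_gr n = generate (AutoGroup (PVT n))
     {\<phi> \<in> auto (PVT n). \<exists>\<pi> \<in> graph_auts (pvt_gens n) (commuting_adj (PVT n)).
        \<forall>x\<in>pvt_gens n. \<phi> x = \<pi> x}"

definition Aut_inv :: "nat \<Rightarrow> (vt_gen word set \<Rightarrow> vt_gen word set) set" where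
  "Aut_inv n = generate (AutoGroup (PVT n))
     {\<phi> \<in> auto (PVT n). \<exists>x\<in>pvt_gens n.
        \<phi> x = inv\<^bsub>PVT n\<^esub> x \<and> (\<forall>y\<in>pvt_gens n - {x}. \<phi> y = y)}"

definition Aut_gr_inv :: "nat \<Rightarrow> (vt_gen word set \<Rightarrow> vt_gen word set) set" where
  "Aut_gr_inv n = generate (AutoGroup (PVT n)) (Aut_gr n \<union> Aut_inv n)"

text \<open>A subgroup of \<open>Aut(PVT\<^sub>n)\<close> as a group in its own right.\<close>

abbreviation aut_subgroup ::
  "nat \<Rightarrow> (vt_gen word set \<Rightarrow> vt_gen word set) set \<Rightarrow> (vt_gen word set \<Rightarrow> vt_gen word set) monoid"
  where "aut_subgroup n H \<equiv> AutoGroup (PVT n) \<lparr>carrier := H\<rparr>"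

section \<open>Semidirect products\<close>

definition semidirect_product ::
  "('a, 'c) monoid_scheme \<Rightarrow> ('b, 'd) monoid_scheme \<Rightarrow> ('b \<Rightarrow> 'a \<Rightarrow> 'a) \<Rightarrow> ('a \<times> 'b) monoid" where
  "semidirect_product N H \<theta> =
     \<lparr>carrier = carrier N \<times> carrier H,
      monoid.mult = (\<lambda>(a, g) (b, h). (a \<otimes>\<^bsub>N\<^esub> \<theta> g b, g \<otimes>\<^bsub>H\<^esub> h)),
      one = (\<one>\<^bsub>N\<^esub>, \<one>\<^bsub>H\<^esub>)\<rparr>"

lemma semidirect_product_group:
  assumes N: "group N" and H: "group H" and \<theta>: "\<theta> \<in> hom H (AutoGroup N)"
  shows "group (semidirect_product N H \<theta>)"
proof -
  interpret N: group N by (rule N)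
  interpret H: group H by (rule H)
  interpret A: group "AutoGroup N" by (rule N.AutoGroup)
  have aut: "\<theta> g \<in> auto N" if "g \<in> carrier H" for g
    using hom_in_carrier[OF \<theta> that] by (simp add: AutoGroup_def)
  have cl: "\<theta> g a \<in> carrier N" if "g \<in> carrier H" "a \<in> carrier N" for g a
    using aut[OF that(1)] that(2) by (auto simp: auto_def hom_def)
  have mu: "\<theta> g (a \<otimes>\<^bsub>N\<^esub> b) = \<theta> g a \<otimes>\<^bsub>N\<^esub> \<theta> g b"
    if "g \<in> carrier H" "a \<in> carrier N" "b \<in> carrier N" for g a b
    using aut[OF that(1)] that(2,3) by (auto simp: auto_def hom_def)
  have co: "\<theta> (g \<otimes>\<^bsub>H\<^esub> h) a = \<theta> g (\<theta> h a)"
    if "g \<in> carrier H" "h \<in> carrier H" "a \<in> carrier N" for g h a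
    using hom_mult[OF \<theta> that(1,2)] aut[OF that(1)] aut[OF that(2)] that(3)
    by (auto simp: AutoGroup_def BijGroup_def auto_def compose_def)
  have on: "\<theta> \<one>\<^bsub>H\<^esub> a = a" if "a \<in> carrier N" for a
    using hom_one[OF \<theta> H A.is_group] that by (simp add: AutoGroup_def BijGroup_def)
  show ?thesis
  proof (rule groupI, goal_cases)
    case (5 x)
    then obtain a g where x: "x = (a, g)" "a \<in> carrier N" "g \<in> carrier H"
      by (auto simp: semidirect_product_def)
    have "\<theta> (inv\<^bsub>H\<^esub> g) (inv\<^bsub>N\<^esub> a) \<otimes>\<^bsub>N\<^esub> \<theta> (inv\<^bsub>H\<^esub> g) a = \<one>\<^bsub>N\<^esub>"
      using x mu[of "inv\<^bsub>H\<^esub> g" "inv\<^bsub>N\<^esub> a" a] mu[of "inv\<^bsub>H\<^esub> g" "\<one>\<^bsub>N\<^esub>" "\<one>\<^bsub>N\<^esub>"] cl[of "inv\<^bsub>H\<^esub> g" "\<one>\<^bsub>N\<^esub>"]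
      by (simp add: N.l_cancel_one)
    then show ?case
      using x by (intro bexI[of _ "(\<theta> (inv\<^bsub>H\<^esub> g) (inv\<^bsub>N\<^esub> a), inv\<^bsub>H\<^esub> g)"])
        (auto simp: semidirect_product_def cl)
  qed (auto simp: semidirect_product_def cl mu co on N.m_assoc H.m_assoc)
qed

definition Z2_power :: "nat \<Rightarrow> (nat \<Rightarrow> int) monoid" where
  "Z2_power m = product_group {..<m} (\<lambda>_. integer_mod_group 2)"

abbreviation Z2_pairs :: "nat \<Rightarrow> (nat \<Rightarrow> int) monoid" where
  "Z2_pairs n \<equiv> Z2_power (n * (n - 1) div 2)"

abbreviation Z2_pairs_sym ::
  "nat \<Rightarrow> ((nat \<Rightarrow> nat) \<Rightarrow> (nat \<Rightarrow> int) \<Rightarrow> nat \<Rightarrow> int) \<Rightarrow> ((nat \<Rightarrow> int) \<times> (nat \<Rightarrow> nat)) monoid" where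
  "Z2_pairs_sym n \<theta> \<equiv> semidirect_product (Z2_pairs n) (sym_group n) \<theta>"

end

theory Submission
  imports Defs "HOL-Computational_Algebra.Primes"
begin

text \<open>The pure virtual twin group is a right-angled Artin group \<open>G\<close> on the pairs in \<open>{1..n}\<close>, two
  generators commuting iff the pairs are disjoint: the virtual twin group maps onto a semidirect
  product of this Artin group with the symmetric group, and this map splits the obvious surjection
  from the Artin group onto the pure subgroup.

  Let \<open>\<phi>\<close> be an automorphism of \<open>G\<close>. Counting, modulo a large prime, the image of the centralizer of
  \<open>\<phi> (\<gamma> v)\<close> in the abelianization shows that \<open>\<phi>\<close> acts on the abelianization as a signed permutation,
  hence, after composing with a graph automorphism and inversions, trivially. Each generator \<open>a\<close>
  exhibits \<open>G\<close> as an HNN extension acting on a Bass-Serre tree. Since the link of a generator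
  determines it, comparing fixed points in these trees shows that \<open>\<phi>\<close> sends every generator to a
  conjugate of itself, and since the complement of each star is connected, that the generators other
  than \<open>a\<close> are sent into a single conjugate of the special subgroup they generate. The corresponding
  cosets intersect pairwise, hence, by a Helly property, have a common element, and \<open>\<phi>\<close> is
  conjugation by it. Finally, the automorphisms of the graph are induced by permutations of
  \<open>{1..n}\<close> because large pairwise intersecting families of pairs are stars.\<close>

section \<open>Right-angled Artin groups\<close>

text \<open>A general right-angled Artin group also has transvections and partial conjugations among
  its automorphisms; the conditions collected in \<open>rigid_raag\<close> exclude both. They hold
  for the graph of disjoint pairs from \<open>n = 5\<close> on. For \<open>n = 4\<close> this graph
  consists of three disjoint edges, the group is a free product of three copies of
  \<open>Z^2\<close>, and each factor has automorphisms that mix its two generators. Numerically the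
  bound comes from \<open>(n - 2 choose 2) = (n - 3 choose 2) + (n - 3)\<close>, whose last term
  must exceed 1. Subgroups generated by vertices are controlled by retractions that kill the other
  generators, and conjugacy by fixed points in trees. A vertex of such a tree is a coset of the
  subgroup that omits one generator, so statements are proved for one omitted generator at a time
  and then intersected. Triviality of the center makes the group itself, and not a quotient of it,
  the normal factor of its automorphism group.\<close>

definition comm_rels :: "'v set \<Rightarrow> ('v \<Rightarrow> 'v \<Rightarrow> bool) \<Rightarrow> ('v word \<times> 'v word) set" where
  "comm_rels V adj =
     {([(u, True), (v, True)], [(v, True), (u, True)]) | u v. u \<in> V \<and> v \<in> V \<and> adj u v}"

text \<open>\<open>G\<close> is tied to the presentation by an isomorphism instead of being the
  presented group itself, so that the locale applies both to \<open>artin n\<close> and to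
  \<open>PVT n\<close>, which lives inside \<open>VT n\<close>.\<close>

locale raag = group G for G (structure) +
  fixes V :: "'v set" and adj :: "'v \<Rightarrow> 'v \<Rightarrow> bool" and \<gamma> :: "'v \<Rightarrow> 'a"
  assumes finite_V: "finite V"
    and adj_sym: "adj u v \<Longrightarrow> adj v u"
    and adj_irrefl: "v \<in> V \<Longrightarrow> \<not> adj v v"
    and gen_closed: "v \<in> V \<Longrightarrow> \<gamma> v \<in> carrier G"
    and gen_commute: "u \<in> V \<Longrightarrow> v \<in> V \<Longrightarrow> adj u v \<Longrightarrow> \<gamma> u \<otimes> \<gamma> v = \<gamma> v \<otimes> \<gamma> u"
    and presentation: "induced_hom G \<gamma> \<in> iso (presented_group V (comm_rels V adj)) G"

lemma (in group) word_eval_in_generate: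
  "w \<in> words X \<Longrightarrow> f ` X \<subseteq> carrier G \<Longrightarrow> word_eval G f w \<in> generate G (f ` X)"
proof (induction w)
  case Nil
  then show ?case by (simp add: word_eval_def generate.one)
next
  case (Cons p w)
  obtain x b where p: "p = (x, b)" by (cases p)
  then have "f x \<in> f ` X" "w \<in> words X" using Cons.prems by auto
  then show ?case
    using p Cons.IH Cons.prems(2) by (simp add: word_eval_Cons generate.eng generate.inv generate.incl)
qed

lemma (in group) comm_rels_respected:
  assumes f: "f \<in> V \<rightarrow> carrier G"
    and c: "\<And>u v. u \<in> V \<Longrightarrow> v \<in> V \<Longrightarrow> adj u v \<Longrightarrow> f u \<otimes> f v = f v \<otimes> f u"
    and lr: "(l, r) \<in> comm_rels V adj"
  shows "word_eval G f l = word_eval G f r"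
proof -
  obtain u v where uv: "u \<in> V" "v \<in> V" "adj u v" "l = [(u, True), (v, True)]" "r = [(v, True), (u, True)]"
    using lr by (auto simp: comm_rels_def)
  then have "f u \<in> carrier G" "f v \<in> carrier G" using f by auto
  then show ?thesis using c[OF uv(1-3)] uv(4,5) by (simp add: word_eval_def)
qed

lemma (in group) hom_eq_on_generate:
  assumes K: "group K" and h: "h \<in> hom G K" "h' \<in> hom G K" and A: "A \<subseteq> carrier G"
    and eq: "\<And>s. s \<in> A \<Longrightarrow> h s = h' s" and x: "x \<in> generate G A"
  shows "h x = h' x"
proof -
  interpret h: group_hom G K h by (simp add: group_hom_def group_hom_axioms_def K h is_group)
  interpret h': group_hom G K h' by (simp add: group_hom_def group_hom_axioms_def K h is_group)
  show ?thesis using x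
  proof (induction rule: generate.induct)
    case (inv s)
    then have "s \<in> carrier G" using A by auto
    then show ?case using eq[OF inv] by simp
  next
    case (eng x y)
    then show ?case using generate_in_carrier[OF A] by simp
  qed (auto simp: eq)
qed

lemma (in group) hom_generate_subgroup:
  assumes h: "h \<in> hom G K" and K: "group K" and A: "A \<subseteq> carrier G" and L: "subgroup L K"
    and mem: "\<And>s. s \<in> A \<Longrightarrow> h s \<in> L" and x: "x \<in> generate G A"
  shows "h x \<in> L"
proof -
  interpret h: group_hom G K h by (simp add: group_hom_def group_hom_axioms_def K h is_group)
  show ?thesis using x
  proof (induction rule: generate.induct)
    case (inv s)
    then have "s \<in> carrier G" using A by auto
    then show ?case using mem[OF inv] L by (simp add: subgroup.m_inv_closed)
  next
    case (eng x y)
    then show ?case using generate_in_carrier[OF A] L by (simp add: subgroup.m_closed)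
  qed (auto simp: mem L subgroup.one_closed)
qed

context raag
begin

lemma gen_funcset: "\<gamma> \<in> V \<rightarrow> carrier G"
  using gen_closed by auto

lemma induced_hom_gen_class:
  "w \<in> words V \<Longrightarrow> induced_hom G \<gamma> (word_class V (comm_rels V adj) w) = word_eval G \<gamma> w"
  by (rule induced_hom_class[OF gen_funcset]) (auto intro: comm_rels_respected[OF gen_funcset gen_commute])

lemma generate_gens: "generate G (\<gamma> ` V) = carrier G"
proof
  show "generate G (\<gamma> ` V) \<subseteq> carrier G"
    by (rule generate_incl) (use gen_closed in auto)
  have "induced_hom G \<gamma> ` carrier (presented_group V (comm_rels V adj)) = carrier G"
    using presentation by (simp add: iso_def bij_betw_def)
  then have "carrier G = (\<lambda>w. induced_hom G \<gamma> (word_class V (comm_rels V adj) w)) ` words V"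
    by (simp add: presented_group_def image_image)
  also have "\<dots> = word_eval G \<gamma> ` words V"
    by (rule image_cong) (simp_all add: induced_hom_gen_class)
  finally show "carrier G \<subseteq> generate G (\<gamma> ` V)"
    using word_eval_in_generate[of _ V \<gamma>] gen_closed by auto
qed

text \<open>Universal property of the presentation, the source of the retractions, the exponent
  sums, the Heisenberg quotient, the tree action and the signed automorphisms below.\<close>

lemma hom_extension:
  assumes K: "group K" and f: "\<And>v. v \<in> V \<Longrightarrow> f v \<in> carrier K"
    and c: "\<And>u v. u \<in> V \<Longrightarrow> v \<in> V \<Longrightarrow> adj u v \<Longrightarrow> f u \<otimes>\<^bsub>K\<^esub> f v = f v \<otimes>\<^bsub>K\<^esub> f u"
  obtains h where "h \<in> hom G K" "\<And>v. v \<in> V \<Longrightarrow> h (\<gamma> v) = f v"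
proof -
  interpret K: group K by (rule K)
  let ?P = "presented_group V (comm_rels V adj)"
  let ?\<iota> = "inv_into (carrier ?P) (induced_hom G \<gamma>)"
  have fK: "f \<in> V \<rightarrow> carrier K" using f by auto
  note resp = K.comm_rels_respected[where adj=adj, OF fK c]
  have i: "?\<iota> \<in> iso G ?P"
    by (rule group.iso_set_sym[OF presented_group_group presentation])
  have "induced_hom K f \<in> hom ?P K"
    using K.induced_hom_hom[OF fK] resp by blast
  moreover have "?\<iota> \<in> hom G ?P" using i by (simp add: iso_def)
  ultimately have "induced_hom K f \<circ> ?\<iota> \<in> hom G K" by (rule Group.hom_compose[rotated])
  moreover have "(induced_hom K f \<circ> ?\<iota>) (\<gamma> v) = f v" if v: "v \<in> V" for v
  proof -
    have w: "[(v, True)] \<in> words V" using v by simp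
    have "word_eval G \<gamma> [(v, True)] = \<gamma> v" using gen_closed[OF v] by (simp add: word_eval_def)
    then have "?\<iota> (\<gamma> v) = word_class V (comm_rels V adj) [(v, True)]"
      using presentation induced_hom_gen_class[OF w] w
      by (intro inv_into_f_eq) (auto simp: iso_def bij_betw_def presented_group_def)
    then show ?thesis
      using K.induced_hom_class[OF fK _ w, of "comm_rels V adj"] resp f[OF v] by (simp add: word_eval_def)
  qed
  ultimately show thesis by (rule that)
qed

section \<open>Special subgroups, retractions and exponent sums\<close>

abbreviation special :: "'v set \<Rightarrow> 'a set" (\<open>\<langle>_\<rangle>\<close>) where
  "\<langle>A\<rangle> \<equiv> generate G (\<gamma> ` A)"

lemma gens_subset: "A \<subseteq> V \<Longrightarrow> \<gamma> ` A \<subseteq> carrier G"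
  using gen_closed by auto

lemma special_subgroup: "A \<subseteq> V \<Longrightarrow> subgroup \<langle>A\<rangle> G"
  by (rule generate_is_subgroup[OF gens_subset])

lemma special_carrier: "A \<subseteq> V \<Longrightarrow> x \<in> \<langle>A\<rangle> \<Longrightarrow> x \<in> carrier G"
  using generate_in_carrier[OF gens_subset] .

lemma special_mono: "A \<subseteq> B \<Longrightarrow> x \<in> \<langle>A\<rangle> \<Longrightarrow> x \<in> \<langle>B\<rangle>"
  using mono_generate[of "\<gamma> ` A" "\<gamma> ` B"] by auto

lemma gen_special: "v \<in> A \<Longrightarrow> \<gamma> v \<in> \<langle>A\<rangle>"
  by (simp add: generate.incl)

text \<open>Send the generators outside \<open>A\<close> to \<one>; the relations survive because
  \<one> commutes with everything. The third property lets the retraction act on intersections,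
  conjugates and cosets of special subgroups.\<close>

lemma retraction:
  assumes "A \<subseteq> V"
  obtains r where "r \<in> hom G G" "\<And>x. x \<in> \<langle>A\<rangle> \<Longrightarrow> r x = x"
    "\<And>B x. B \<subseteq> V \<Longrightarrow> x \<in> \<langle>B\<rangle> \<Longrightarrow> r x \<in> \<langle>A \<inter> B\<rangle>"
proof -
  obtain r where r: "r \<in> hom G G" "\<And>v. v \<in> V \<Longrightarrow> r (\<gamma> v) = (if v \<in> A then \<gamma> v else \<one>)"
    by (rule hom_extension[OF is_group, where f="\<lambda>v. if v \<in> A then \<gamma> v else \<one>"])
       (auto simp: gen_closed intro: gen_commute)
  have "r x = x" if "x \<in> \<langle>A\<rangle>" for x
  proof (rule hom_eq_on_generate[OF is_group r(1) _ gens_subset[OF assms] _ that])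
    show "(\<lambda>x. x) \<in> hom G G" by (simp add: hom_def)
  qed (use r(2) assms in auto)
  moreover have "r x \<in> \<langle>A \<inter> B\<rangle>" if "B \<subseteq> V" "x \<in> \<langle>B\<rangle>" for B x
  proof (rule hom_generate_subgroup[OF r(1) is_group gens_subset[OF that(1)] _ _ that(2)])
    show "subgroup \<langle>A \<inter> B\<rangle> G" using assms by (auto intro: special_subgroup)
    show "r s \<in> \<langle>A \<inter> B\<rangle>" if "s \<in> \<gamma> ` B" for s
      using that \<open>B \<subseteq> V\<close> r(2) by (auto simp: gen_special generate.one)
  qed
  ultimately show thesis using r(1) that by blast
qed

text \<open>The retraction onto \<open>\<langle>A\<rangle>\<close> fixes \<open>x\<close> and, as
  \<open>x\<close> lies in \<open>\<langle>B\<rangle>\<close>, sends it into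
  \<open>\<langle>A \<inter> B\<rangle>\<close>.\<close>

lemma special_Int:
  assumes "A \<subseteq> V" "B \<subseteq> V" "x \<in> \<langle>A\<rangle>" "x \<in> \<langle>B\<rangle>"
  shows "x \<in> \<langle>A \<inter> B\<rangle>"
proof -
  obtain r where "\<And>x. x \<in> \<langle>A\<rangle> \<Longrightarrow> r x = x" "\<And>B x. B \<subseteq> V \<Longrightarrow> x \<in> \<langle>B\<rangle> \<Longrightarrow> r x \<in> \<langle>A \<inter> B\<rangle>"
    using retraction[OF assms(1)] by metis
  then show ?thesis using assms by metis
qed

text \<open>The exponent sum of the generator \<open>s\<close>. A homomorphism is determined on
  \<open>carrier G\<close> by its values on the generators, so the choice is harmless there.\<close>

definition expo :: "'v \<Rightarrow> 'a \<Rightarrow> int" where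
  "expo s = (SOME h. h \<in> hom G integer_group \<and> (\<forall>v\<in>V. h (\<gamma> v) = (if v = s then 1 else 0)))"

lemma expo_spec:
  "expo s \<in> hom G integer_group \<and> (\<forall>v\<in>V. expo s (\<gamma> v) = (if v = s then 1 else 0))"
proof -
  obtain h where "h \<in> hom G integer_group" "\<And>v. v \<in> V \<Longrightarrow> h (\<gamma> v) = (if v = s then 1 else 0)"
    by (rule hom_extension[where K=integer_group and f="\<lambda>v. if v = s then 1 else 0"]) auto
  then have "\<exists>h. h \<in> hom G integer_group \<and> (\<forall>v\<in>V. h (\<gamma> v) = (if v = s then 1 else 0))"
    by blast
  then show ?thesis unfolding expo_def by (rule someI_ex)
qed

lemma expo_hom: "expo s \<in> hom G integer_group" and
  expo_gen: "v \<in> V \<Longrightarrow> expo s (\<gamma> v) = (if v = s then 1 else 0)"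
  using expo_spec by auto

sublocale expo: group_hom G integer_group "expo s" for s
  by (simp add: group_hom_def group_hom_axioms_def is_group expo_hom)

lemma expo_mult [simp]: "x \<in> carrier G \<Longrightarrow> y \<in> carrier G \<Longrightarrow> expo s (x \<otimes> y) = expo s x + expo s y"
  using expo.hom_mult by simp

lemma expo_inv [simp]: "x \<in> carrier G \<Longrightarrow> expo s (inv x) = - expo s x"
  using expo.hom_inv by simp

lemma expo_one [simp]: "expo s \<one> = 0"
  using expo.hom_one by simp

lemma expo_pow [simp]: "x \<in> carrier G \<Longrightarrow> expo s (x [^] (k::int)) = k * expo s x"
  using expo.hom_int_pow by simp

lemma expo_special:
  assumes "A \<subseteq> V" "s \<notin> A" "x \<in> \<langle>A\<rangle>"
  shows "expo s x = 0"
proof -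
  have "expo s x \<in> {0}"
    by (rule hom_generate_subgroup[OF expo_hom _ gens_subset[OF assms(1)] _ _ assms(3)])
       (use assms expo_gen in \<open>auto simp: subgroup_def\<close>)
  then show ?thesis by simp
qed

text \<open>The exponent sums are coordinates on the abelianization, so an integer-valued
  homomorphism is a linear form in them.\<close>

lemma hom_integer_expo:
  assumes h: "h \<in> hom G integer_group" and x: "x \<in> carrier G"
  shows "h x = (\<Sum>v\<in>V. expo v x * h (\<gamma> v))"
proof -
  let ?h' = "\<lambda>x. \<Sum>v\<in>V. expo v x * h (\<gamma> v)"
  have h': "?h' \<in> hom G integer_group"
    by (rule homI) (simp_all add: sum.distrib distrib_right)
  show ?thesis
  proof (rule hom_eq_on_generate[OF _ h h' gens_subset[OF order_refl]])
    fix s assume "s \<in> \<gamma> ` V"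
    then obtain u where u: "u \<in> V" "s = \<gamma> u" by auto
    have "(\<Sum>v\<in>V. expo v (\<gamma> u) * h (\<gamma> v)) = (\<Sum>v\<in>V. if u = v then h (\<gamma> v) else 0)"
      using u by (intro sum.cong) (auto simp: expo_gen)
    then show "h s = ?h' s" using u finite_V by simp
  qed (use x generate_gens in auto)
qed

end

section \<open>The Heisenberg group as a test for commutation\<close>

text \<open>Upper unitriangular integer 3 by 3 matrices: \<open>a\<close> and \<open>b\<close> stand
  next to the diagonal, \<open>c\<close> in the corner. Two elements commute iff
  \<open>a * b' = a' * b\<close>.\<close>

definition heis :: "(int \<times> int \<times> int) monoid" where
  "heis = \<lparr>carrier = UNIV,
     monoid.mult = (\<lambda>(a, b, c) (a', b', c'). (a + a', b + b', c + c' + a * b')),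
     one = (0, 0, 0)\<rparr>"

lemma heis_group: "group heis"
proof (rule groupI)
  fix x :: "int \<times> int \<times> int"
  obtain a b c where "x = (a, b, c)" by (cases x)
  then show "\<exists>y\<in>carrier heis. y \<otimes>\<^bsub>heis\<^esub> x = \<one>\<^bsub>heis\<^esub>"
    by (intro bexI[of _ "(- a, - b, a * b - c)"]) (auto simp: heis_def)
qed (auto simp: heis_def algebra_simps split: prod.splits)

context raag
begin

text \<open>The Heisenberg quotient detecting the commutator of two non-adjacent generators.\<close>

lemma commuting_expo:
  assumes x: "x \<in> carrier G" and y: "y \<in> carrier G" and xy: "x \<otimes> y = y \<otimes> x"
    and st: "s \<in> V" "t \<in> V" "\<not> adj s t" "s \<noteq> t"
  shows "expo s x * expo t y = expo t x * expo s y"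
proof -
  \<comment> \<open>All generators but \<open>s\<close> and \<open>t\<close> die, so the only
    commutation that could fail is that of \<open>s\<close> with \<open>t\<close>, which is not a
    relation.\<close>
  let ?f = "\<lambda>v. if v = s then (1, 0, 0) else if v = t then (0, 1, 0) else (0, 0, 0 :: int) :: int \<times> int \<times> int"
  obtain h where h: "h \<in> hom G heis" "\<And>v. v \<in> V \<Longrightarrow> h (\<gamma> v) = ?f v"
  proof (rule hom_extension[OF heis_group, where f="?f"])
    show "?f u \<otimes>\<^bsub>heis\<^esub> ?f v = ?f v \<otimes>\<^bsub>heis\<^esub> ?f u" if "adj u v" "u \<in> V" "v \<in> V" for u v
      using that st adj_sym[of u v] adj_irrefl by (auto simp: heis_def)
  qed (auto simp: heis_def)
  have f: "(fst \<circ> h) \<in> hom G integer_group" "(fst \<circ> snd \<circ> h) \<in> hom G integer_group"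
    using h(1) by (auto simp: hom_def heis_def split: prod.splits)
  have "(fst \<circ> h) z = expo s z" if "z \<in> carrier G" for z
    by (rule hom_eq_on_generate[OF _ f(1) expo_hom gens_subset[OF order_refl]])
       (use that h(2) expo_gen generate_gens in auto)
  moreover have "(fst \<circ> snd \<circ> h) z = expo t z" if "z \<in> carrier G" for z
    by (rule hom_eq_on_generate[OF _ f(2) expo_hom gens_subset[OF order_refl]])
       (use that h(2) expo_gen generate_gens st in auto)
  \<comment> \<open>Comparing the corner entries of the two products gives the claim.\<close>
  moreover have "h x \<otimes>\<^bsub>heis\<^esub> h y = h y \<otimes>\<^bsub>heis\<^esub> h x"
    using hom_mult[OF h(1)] x y xy by metis
  moreover obtain a b c a' b' c' where "h x = (a, b, c)" "h y = (a', b', c')"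
    by (meson prod_cases3)
  ultimately show ?thesis using x y by (auto simp: heis_def) (metis mult.commute fst_conv snd_conv)
qed

end

section \<open>Reduced words and the tree of a generator\<close>

definition flip :: "'c \<times> bool \<Rightarrow> 'c \<times> bool" where
  "flip p = (fst p, \<not> snd p)"

text \<open>Left multiplication by the letter \<open>p\<close> in a free group, carried out on
  reduced words, where only the front can cancel.\<close>

fun push :: "'c \<times> bool \<Rightarrow> ('c \<times> bool) list \<Rightarrow> ('c \<times> bool) list" where
  "push p [] = [p]"
| "push p (q # w) = (if q = flip p then w else p # q # w)"

fun reduced :: "('c \<times> bool) list \<Rightarrow> bool" where
  "reduced [] = True"
| "reduced [p] = True"
| "reduced (p # q # w) \<longleftrightarrow> q \<noteq> flip p \<and> reduced (q # w)"

definition cat :: "('c \<times> bool) list \<Rightarrow> ('c \<times> bool) list \<Rightarrow> ('c \<times> bool) list" where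
  "cat u w = foldr push u w"

definition cancels :: "('c \<times> bool) list \<Rightarrow> ('c \<times> bool) list \<Rightarrow> bool" where
  "cancels u w \<longleftrightarrow> u \<noteq> [] \<and> w \<noteq> [] \<and> hd w = flip (last u)"

lemma flip_flip [simp]: "flip (flip p) = p"
  by (simp add: flip_def)

lemma flip_neq [simp]: "flip p \<noteq> p" "p \<noteq> flip p"
  by (metis flip_def snd_conv)+

lemma flip_eq_iff [simp]: "flip p = flip q \<longleftrightarrow> p = q"
  by (metis flip_flip)

lemma reduced_Cons: "reduced (p # w) \<longleftrightarrow> (w = [] \<or> hd w \<noteq> flip p) \<and> reduced w"
  by (cases w) auto

lemma reduced_append:
  "reduced (u @ w) \<longleftrightarrow> reduced u \<and> reduced w \<and> \<not> cancels u w"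
  by (induction u) (auto simp: reduced_Cons cancels_def hd_append)

lemma reduced_push: "reduced w \<Longrightarrow> reduced (push p w)"
  by (cases w) (auto simp: reduced_Cons)

text \<open>If \<open>w\<close> starts with \<open>p\<close>, the inner push removes this letter and
  the outer one restores it, since in a reduced word the next letter is not
  \<open>flip p\<close>.\<close>

lemma push_push_flip: "reduced w \<Longrightarrow> push p (push (flip p) w) = w"
proof (cases w)
  case (Cons q v)
  moreover assume "reduced w"
  ultimately show ?thesis by (cases v) auto
qed simp

lemma set_push: "set (push p w) \<subseteq> insert p (set w)"
  by (cases w) auto

lemma cat_Nil [simp]: "cat [] w = w" and cat_Cons [simp]: "cat (p # u) w = push p (cat u w)"
  by (simp_all add: cat_def)

lemma cat_append: "cat (u @ v) w = cat u (cat v w)"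
  by (simp add: cat_def)

lemma reduced_cat: "reduced w \<Longrightarrow> reduced (cat u w)"
  by (induction u) (auto intro: reduced_push)

lemma set_cat: "set (cat u w) \<subseteq> set u \<union> set w"
proof (induction u)
  case (Cons p u)
  then show ?case using set_push[of p "cat u w"] by auto
qed simp

lemma length_cat_le: "length (cat u w) \<le> length u + length w"
proof (induction u)
  case (Cons p u)
  have "length (push p x) \<le> Suc (length x)" for x by (cases x) auto
  from this[of "cat u w"] show ?case using Cons by simp
qed simp

lemma push_Cons_reduced: "reduced (p # w) \<Longrightarrow> push p w = p # w"
  by (cases w) auto

lemma cat_reduced: "reduced (u @ w) \<Longrightarrow> cat u w = u @ w"
  by (induction u) (auto simp: push_Cons_reduced reduced_Cons)

lemma length_cat_cancels:
  assumes "cancels u w"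
  shows "length (cat u w) + 2 \<le> length u + length w"
proof -
  have "u = butlast u @ [last u]" "w = flip (last u) # tl w"
    using assms by (auto simp: cancels_def) (metis list.collapse)
  then obtain u' p w' where uw: "u = u' @ [p]" "w = flip p # w'" by metis
  then show ?thesis using length_cat_le[of u' w'] by (simp add: cat_append)
qed

text \<open>Cancellation at the junction is visible in the length alone. For commuting elements this
  transfers non-cancellation from one order of the product to the other.\<close>

lemma length_cat_eq_iff:
  assumes "reduced u" "reduced w"
  shows "length (cat u w) = length u + length w \<longleftrightarrow> \<not> cancels u w"
  using assms length_cat_cancels[of u w] cat_reduced[of u w] by (auto simp: reduced_append)

definition flip_rev :: "('c \<times> bool) list \<Rightarrow> ('c \<times> bool) list" where
  "flip_rev u = map flip (rev u)"

lemma cat_flip_rev: "reduced w \<Longrightarrow> cat (flip_rev u) (cat u w) = w"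
proof (induction u arbitrary: w)
  case (Cons p u)
  have "push (flip p) (push (flip (flip p)) (cat u w)) = cat u w"
    by (rule push_push_flip[OF reduced_cat[OF Cons.prems]])
  then show ?case using Cons by (simp add: flip_rev_def cat_append)
qed (simp add: flip_rev_def)

lemma reduced_flip_rev: "reduced u \<Longrightarrow> reduced (flip_rev u)"
proof (induction u)
  case (Cons p u)
  have "\<not> cancels (flip_rev u) [flip p]"
  proof (cases u)
    case (Cons q v)
    then show ?thesis using \<open>reduced (p # u)\<close>
      by (auto simp: cancels_def flip_rev_def)
  qed (simp add: cancels_def flip_rev_def)
  then show ?case using Cons by (simp add: flip_rev_def reduced_append reduced_Cons)
qed (simp add: flip_rev_def)

lemma cat_eq_Nil:
  assumes "reduced u" "reduced w" "cat u w = []"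
  shows "w = flip_rev u"
  using cat_flip_rev[OF assms(2), of u] cat_reduced[of "flip_rev u" "[]"] reduced_flip_rev[OF assms(1)] assms(3)
  by simp

lemma (in group) inv_mult_cancel [simp]:
  assumes "x \<in> carrier G" "y \<in> carrier G"
  shows "inv x \<otimes> (x \<otimes> y) = y" "x \<otimes> (inv x \<otimes> y) = y"
  using assms by (simp_all flip: m_assoc)

lemma (in group) centralizer_subgroup:
  assumes g: "g \<in> carrier G"
  shows "subgroup {x \<in> carrier G. x \<otimes> g = g \<otimes> x} G"
proof (rule subgroupI)
  fix x assume "x \<in> {x \<in> carrier G. x \<otimes> g = g \<otimes> x}"
  then have x: "x \<in> carrier G" "x \<otimes> g = g \<otimes> x" by auto
  then have "inv x \<otimes> (x \<otimes> g) \<otimes> inv x = inv x \<otimes> (g \<otimes> x) \<otimes> inv x" by simp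
  then show "inv x \<in> {x \<in> carrier G. x \<otimes> g = g \<otimes> x}"
    using x(1) g by (simp add: m_assoc)
next
  fix x y assume "x \<in> {x \<in> carrier G. x \<otimes> g = g \<otimes> x}" "y \<in> {x \<in> carrier G. x \<otimes> g = g \<otimes> x}"
  then show "x \<otimes> y \<in> {x \<in> carrier G. x \<otimes> g = g \<otimes> x}"
    using g by (simp add: m_assoc) (simp flip: m_assoc)
qed (use g in auto)

section \<open>The action of the group on the tree of a generator\<close>

locale raag_letter = raag G V adj \<gamma>
  for G (structure) and V :: "'v set" and adj and \<gamma> :: "'v \<Rightarrow> 'a" +
  fixes a :: 'v
  assumes a_V: "a \<in> V"
begin

abbreviation "H \<equiv> \<langle>V - {a}\<rangle>"
abbreviation "lk \<equiv> {v \<in> V. adj a v}"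
abbreviation "K \<equiv> \<langle>lk\<rangle>"

text \<open>\<open>G\<close> is the HNN extension of \<open>H\<close> with stable letter \<open>\<gamma> a\<close> commuting with \<open>K\<close>. A vertex of its
  Bass-Serre tree is encoded by a reduced word in the letters \<open>(y <# K, b)\<close>, which stand for
  the conjugates of \<open>\<gamma> a\<close> or of its inverse by \<open>y \<in> H\<close>.\<close>

definition letters :: "('a set \<times> bool) set" where
  "letters = (\<lambda>y. y <# K) ` H \<times> UNIV"

definition tree :: "('a set \<times> bool) list set" where
  "tree = {w. set w \<subseteq> letters \<and> reduced w}"

definition shift :: "'a \<Rightarrow> 'a set \<times> bool \<Rightarrow> 'a set \<times> bool" where
  "shift h = map_prod (\<lambda>X. h <# X) id"

lemma H_subgroup: "subgroup H G"
  by (rule special_subgroup) auto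

lemma K_subgroup: "subgroup K G"
  by (rule special_subgroup) auto

lemma H_carrier: "h \<in> H \<Longrightarrow> h \<in> carrier G"
  using subgroup.mem_carrier[OF H_subgroup] .

lemma K_carrier: "K \<subseteq> carrier G"
  using subgroup.subset[OF K_subgroup] .

lemma a_closed: "\<gamma> a \<in> carrier G"
  by (rule gen_closed[OF a_V])

lemma K_commute: "k \<in> K \<Longrightarrow> k \<otimes> \<gamma> a = \<gamma> a \<otimes> k"
  using generate_subgroup_incl[OF _ centralizer_subgroup[OF a_closed], of "\<gamma> ` lk"]
    gen_closed gen_commute[OF _ a_V] adj_sym by auto

lemma shift_mult: "X \<subseteq> carrier G \<Longrightarrow> g \<in> carrier G \<Longrightarrow> h \<in> carrier G \<Longrightarrow>
    shift g (shift h (X, b)) = shift (g \<otimes> h) (X, b)"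
  by (simp add: shift_def lcos_m_assoc)

lemma letters_carrier: "p \<in> letters \<Longrightarrow> fst p \<subseteq> carrier G"
  proof -
  assume "p \<in> letters"
  then obtain y where "y \<in> H" "fst p = y <# K" by (auto simp: letters_def)
  then show ?thesis using l_coset_subset_G[OF K_carrier H_carrier] by simp
qed

lemma shift_letters: "h \<in> H \<Longrightarrow> p \<in> letters \<Longrightarrow> shift h p \<in> letters"
  using H_carrier subgroup.m_closed[OF H_subgroup] K_carrier
  by (auto simp: letters_def shift_def lcos_m_assoc)

lemma shift_shift: "g \<in> carrier G \<Longrightarrow> h \<in> carrier G \<Longrightarrow> p \<in> letters \<Longrightarrow>
    shift g (shift h p) = shift (g \<otimes> h) p"
  using shift_mult[of "fst p" g h "snd p"] letters_carrier by simp

lemma shift_one: "p \<in> letters \<Longrightarrow> shift \<one> p = p"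
  using lcos_mult_one[of "fst p"] letters_carrier by (cases p) (auto simp: shift_def)

lemma flip_shift: "flip (shift h p) = shift h (flip p)"
  by (simp add: flip_def shift_def)

lemma shift_inj: "h \<in> H \<Longrightarrow> inj_on (shift h) letters"
  by (rule inj_on_inverseI[of _ "shift (inv h)"]) (simp add: shift_shift H_carrier shift_one)

lemma flip_letters: "p \<in> letters \<Longrightarrow> flip p \<in> letters"
  by (auto simp: letters_def flip_def)

lemma K_letter: "(K, b) \<in> letters"
  using lcos_mult_one[OF K_carrier] subgroup.one_closed[OF H_subgroup] by (force simp: letters_def)

lemma treeD: "w \<in> tree \<Longrightarrow> p \<in> set w \<Longrightarrow> p \<in> letters" "w \<in> tree \<Longrightarrow> reduced w"
  by (auto simp: tree_def)

lemma Nil_tree [simp]: "[] \<in> tree"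
  by (simp add: tree_def)

lemma Cons_tree: "p # w \<in> tree \<longleftrightarrow> p \<in> letters \<and> w \<in> tree \<and> (w = [] \<or> hd w \<noteq> flip p)"
  by (auto simp: tree_def reduced_Cons)

lemma push_tree: "p \<in> letters \<Longrightarrow> w \<in> tree \<Longrightarrow> push p w \<in> tree"
  using set_push[of p w] reduced_push[of w p] by (auto simp: tree_def)

lemma cat_tree: "u \<in> tree \<Longrightarrow> w \<in> tree \<Longrightarrow> cat u w \<in> tree"
  using set_cat[of u w] reduced_cat[of w u] by (auto simp: tree_def)

lemma push_shift:
  assumes h: "h \<in> H" and p: "p \<in> letters" and w: "w \<in> tree"
  shows "map (shift h) (push p w) = push (shift h p) (map (shift h) w)"
proof (cases w)
  case (Cons q v)
  then have "q \<in> letters" using w by (simp add: Cons_tree)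
  then have "shift h q = flip (shift h p) \<longleftrightarrow> q = flip p"
    using inj_on_eq_iff[OF shift_inj[OF h], of q "flip p"] p by (simp add: flip_shift flip_letters)
  then show ?thesis using Cons by simp
qed simp

lemma map_shift_tree: "h \<in> H \<Longrightarrow> w \<in> tree \<Longrightarrow> map (shift h) w \<in> tree"
proof (induction w)
  case (Cons p w)
  then have *: "p \<in> letters" "w \<in> tree" "push p w = p # w"
    using push_Cons_reduced[OF treeD(2)[OF Cons.prems(2)]] Cons.prems(2) by (auto simp: Cons_tree)
  then have "map (shift h) (p # w) = push (shift h p) (map (shift h) w)"
    using push_shift Cons.prems(1) by metis
  then show ?case using * Cons by (simp add: push_tree shift_letters)
qed simp

lemma map_shift_shift:
  "g \<in> carrier G \<Longrightarrow> h \<in> carrier G \<Longrightarrow> w \<in> tree \<Longrightarrow> map (shift g) (map (shift h) w) = map (shift (g \<otimes> h)) w"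
  by (auto simp: shift_shift treeD)

lemma map_shift_one: "w \<in> tree \<Longrightarrow> map (shift \<one>) w = w"
  by (auto simp: shift_one treeD intro: map_idI)

text \<open>The stable letter pushes the letter of the trivial coset, the other generators translate
  all cosets. The restriction to \<open>tree\<close> makes the maps extensional, as
  \<open>Bij\<close> demands.\<close>

definition act_gen :: "'v \<Rightarrow> ('a set \<times> bool) list \<Rightarrow> ('a set \<times> bool) list" where
  "act_gen v = (\<lambda>w\<in>tree. if v = a then push (K, True) w else map (shift (\<gamma> v)) w)"

lemma gen_H: "v \<in> V \<Longrightarrow> v \<noteq> a \<Longrightarrow> \<gamma> v \<in> H"
  by (auto intro: gen_special)

lemma K_push_push: "w \<in> tree \<Longrightarrow> push (K, b) (push (K, \<not> b) w) = w"
  using push_push_flip[of w "(K, b)"] treeD(2) by (simp add: flip_def)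

lemma act_gen_Bij: "v \<in> V \<Longrightarrow> act_gen v \<in> Bij tree"
proof (cases "v = a")
  case True
  have "bij_betw (push (K, True)) tree tree"
    by (rule bij_betw_byWitness[where f'="push (K, False)"])
       (use K_push_push[of _ True] K_push_push[of _ False] push_tree[OF K_letter] in auto)
  then show ?thesis using True by (simp add: Bij_def act_gen_def cong: bij_betw_cong)
next
  case False
  assume v: "v \<in> V"
  note h = gen_H[OF v False]
  have "bij_betw (map (shift (\<gamma> v))) tree tree"
    by (rule bij_betw_byWitness[where f'="map (shift (inv \<gamma> v))"])
       (use map_shift_shift[of "\<gamma> v" "inv \<gamma> v"] map_shift_shift[of "inv \<gamma> v" "\<gamma> v"] map_shift_one
         map_shift_tree h subgroup.m_inv_closed[OF H_subgroup h] gen_closed[OF v] in auto)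
  then show ?thesis using False by (simp add: Bij_def act_gen_def cong: bij_betw_cong)
qed

text \<open>A generator in the link of \<open>a\<close> lies in \<open>K\<close>, so it fixes both
  letters \<open>(K, b)\<close> and its translation commutes with pushing them. Two generators of
  \<open>H\<close> act by translations, which multiply as in \<open>G\<close>.\<close>

lemma act_gen_commute:
  assumes "u \<in> V" "v \<in> V" "adj u v"
  shows "act_gen u \<otimes>\<^bsub>BijGroup tree\<^esub> act_gen v = act_gen v \<otimes>\<^bsub>BijGroup tree\<^esub> act_gen u"
proof -
  have K_fix: "shift (\<gamma> x) (K, b) = (K, b)" if "x \<in> V" "adj a x" for x b
    using that coset_join3[OF _ K_subgroup, of "\<gamma> x"] gen_closed by (simp add: shift_def gen_special)
  have sw: "act_gen a (act_gen x w) = act_gen x (act_gen a w)" if x: "x \<in> V" "adj a x" and w: "w \<in> tree" for x w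
  proof -
    have xa: "x \<noteq> a" using x adj_irrefl[OF a_V] by auto
    note h = gen_H[OF x(1) xa]
    show ?thesis using xa w push_shift[OF h K_letter w, of True] K_fix[OF x]
      by (simp add: act_gen_def map_shift_tree[OF h] push_tree[OF K_letter])
  qed
  have "act_gen u (act_gen v w) = act_gen v (act_gen u w)" if w: "w \<in> tree" for w
  proof (cases "u = a \<or> v = a")
    case True
    then show ?thesis using sw[of u w] sw[of v w] assms adj_sym w by metis
  next
    case False
    then have h: "\<gamma> u \<in> H" "\<gamma> v \<in> H" using gen_H assms by auto
    then show ?thesis using False w map_shift_shift[OF _ _ w] gen_closed assms gen_commute[OF assms]
      by (simp add: act_gen_def map_shift_tree del: map_map)
  qed
  then show ?thesis using act_gen_Bij assms
    by (auto simp: BijGroup_def compose_def restrict_def fun_eq_iff)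
qed

definition act :: "'a \<Rightarrow> ('a set \<times> bool) list \<Rightarrow> ('a set \<times> bool) list" where
  "act = (SOME \<alpha>. \<alpha> \<in> hom G (BijGroup tree) \<and> (\<forall>v\<in>V. \<alpha> (\<gamma> v) = act_gen v))"

lemma act_spec: "act \<in> hom G (BijGroup tree) \<and> (\<forall>v\<in>V. act (\<gamma> v) = act_gen v)"
proof -
  have c: "\<And>v. v \<in> V \<Longrightarrow> act_gen v \<in> carrier (BijGroup tree)"
    using act_gen_Bij by (simp add: BijGroup_def)
  obtain h where "h \<in> hom G (BijGroup tree)" "\<And>v. v \<in> V \<Longrightarrow> h (\<gamma> v) = act_gen v"
    by (rule hom_extension[where f=act_gen, OF group_BijGroup c act_gen_commute]) (assumption | rule that)+
  then have "\<exists>\<alpha>. \<alpha> \<in> hom G (BijGroup tree) \<and> (\<forall>v\<in>V. \<alpha> (\<gamma> v) = act_gen v)" by blast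
  then show ?thesis unfolding act_def by (rule someI_ex)
qed

lemma act_Bij: "g \<in> carrier G \<Longrightarrow> act g \<in> Bij tree"
  using act_spec by (auto simp: hom_def BijGroup_def)

lemma act_tree: "g \<in> carrier G \<Longrightarrow> w \<in> tree \<Longrightarrow> act g w \<in> tree"
  using act_Bij[of g] by (auto simp: Bij_def bij_betw_def)

lemma act_mult: "g \<in> carrier G \<Longrightarrow> h \<in> carrier G \<Longrightarrow> w \<in> tree \<Longrightarrow> act (g \<otimes> h) w = act g (act h w)"
  using act_Bij[of g] act_Bij[of h] act_spec hom_mult[of act G "BijGroup tree" g h]
  by (auto simp: BijGroup_def compose_def)

lemma act_one: "w \<in> tree \<Longrightarrow> act \<one> w = w"
  using act_spec hom_one[OF _ is_group group_BijGroup, of act tree] by (simp add: BijGroup_def)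

lemma act_inv_act: "g \<in> carrier G \<Longrightarrow> w \<in> tree \<Longrightarrow> act (inv g) (act g w) = w"
  using act_mult[of "inv g" g w] act_one by simp

lemma act_act_inv: "g \<in> carrier G \<Longrightarrow> w \<in> tree \<Longrightarrow> act g (act (inv g) w) = w"
  using act_mult[of g "inv g" w] act_one by simp

lemma act_gen_eq: "v \<in> V \<Longrightarrow> w \<in> tree \<Longrightarrow> v \<noteq> a \<Longrightarrow> act (\<gamma> v) w = map (shift (\<gamma> v)) w"
    "w \<in> tree \<Longrightarrow> act (\<gamma> a) w = push (K, True) w"
  using act_spec a_V by (simp_all add: act_gen_def)

lemma act_H: "h \<in> H \<Longrightarrow> w \<in> tree \<Longrightarrow> act h w = map (shift h) w"
proof (induction arbitrary: w rule: generate.induct)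
  case one
  then show ?case by (simp add: act_one map_shift_one)
next
  case (incl h)
  then show ?case using act_gen_eq by auto
next
  case (inv h)
  then obtain v where v: "v \<in> V" "v \<noteq> a" "h = \<gamma> v" by auto
  have hH: "h \<in> H" "inv h \<in> H" using v gen_H subgroup.m_inv_closed[OF H_subgroup] by auto
  have "act h (map (shift (inv h)) w) = w"
    using act_gen_eq(1)[OF v(1) map_shift_tree[OF hH(2) inv.prems] v(2)] v(3)
      map_shift_shift[of h "inv h" w] map_shift_one inv.prems H_carrier[OF hH(1)] by simp
  then show ?case
    using act_inv_act[OF H_carrier[OF hH(1)] map_shift_tree[OF hH(2) inv.prems]] by simp
next
  case (eng g h)
  then show ?case using H_carrier map_shift_tree[OF eng(2)] map_shift_shift
    by (simp add: act_mult del: map_map)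
qed

definition letter_elem :: "'a set \<times> bool \<Rightarrow> 'a" where
  "letter_elem p = (let y = SOME y. y \<in> fst p in
     y \<otimes> (if snd p then \<gamma> a else inv \<gamma> a) \<otimes> inv y)"

definition word_elem :: "('a set \<times> bool) list \<Rightarrow> 'a" where
  "word_elem w = foldr (\<lambda>p x. letter_elem p \<otimes> x) w \<one>"

text \<open>Independence of the representative: two of them differ by an element of
  \<open>K\<close>, which commutes with \<open>\<gamma> a\<close>.\<close>

lemma letter_elem_coset:
  assumes y: "y \<in> H"
  shows "letter_elem (y <# K, b) = y \<otimes> (if b then \<gamma> a else inv \<gamma> a) \<otimes> inv y"
proof -
  let ?z = "SOME z. z \<in> y <# K" and ?t = "if b then \<gamma> a else inv \<gamma> a"
  have "y \<otimes> \<one> \<in> y <# K" using subgroup.one_closed[OF K_subgroup] by (auto simp: l_coset_def)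
  then have "?z \<in> y <# K" by (rule someI)
  then obtain k where k: "k \<in> K" "?z = y \<otimes> k" by (auto simp: l_coset_def)
  have kG: "k \<in> carrier G" "y \<in> carrier G" "?t \<in> carrier G"
    using k K_carrier y H_carrier a_closed by auto
  have kt: "k \<otimes> ?t = ?t \<otimes> k"
  proof (cases b)
    case False
    have "inv \<gamma> a \<otimes> (k \<otimes> \<gamma> a) \<otimes> inv \<gamma> a = inv \<gamma> a \<otimes> (\<gamma> a \<otimes> k) \<otimes> inv \<gamma> a"
      using K_commute[OF k(1)] by simp
    then show ?thesis using False kG(1) a_closed by (simp add: m_assoc)
  qed (use K_commute[OF k(1)] in simp)
  have "y \<otimes> k \<otimes> ?t \<otimes> inv (y \<otimes> k) = y \<otimes> (k \<otimes> ?t) \<otimes> inv k \<otimes> inv y"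
    using kG by (simp add: inv_mult_group m_assoc del: if_split)
  also have "\<dots> = y \<otimes> ?t \<otimes> inv y" unfolding kt using kG by (simp add: m_assoc)
  finally show ?thesis using k(2) by (simp add: letter_elem_def Let_def)
qed

lemma letterE:
  assumes "p \<in> letters"
  obtains y b where "y \<in> H" "p = (y <# K, b)"
  using assms by (auto simp: letters_def)

lemma letter_elem_closed: "p \<in> letters \<Longrightarrow> letter_elem p \<in> carrier G"
  by (elim letterE) (simp add: letter_elem_coset H_carrier a_closed)

lemma word_elem_closed: "w \<in> tree \<Longrightarrow> word_elem w \<in> carrier G"
  by (induction w) (auto simp: word_elem_def Cons_tree letter_elem_closed)

lemma word_elem_Cons: "word_elem (p # w) = letter_elem p \<otimes> word_elem w"
  by (simp add: word_elem_def)

lemma act_inv_a: 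
  assumes w: "w \<in> tree" shows "act (inv \<gamma> a) w = push (K, False) w"
  using act_gen_eq(2)[OF push_tree[OF K_letter w, of False]] K_push_push[OF w, of True]
    act_inv_act[OF a_closed push_tree[OF K_letter w, of False]] by simp

text \<open>The conjugate by \<open>y\<close> undoes the translation, pushes the base letter and
  translates back; this amounts to pushing the translated letter.\<close>

lemma act_letter:
  assumes p: "p \<in> letters" and w: "w \<in> tree"
  shows "act (letter_elem p) w = push p w"
proof -
  obtain y b where y: "y \<in> H" "p = (y <# K, b)" using letterE[OF p] .
  let ?t = "if b then \<gamma> a else inv \<gamma> a"
  have yi: "inv y \<in> H" using y subgroup.m_inv_closed[OF H_subgroup] by auto
  have yG: "y \<in> carrier G" using y H_carrier by auto
  have w': "map (shift (inv y)) w \<in> tree" by (rule map_shift_tree[OF yi w])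
  have t: "act ?t u = push (K, b) u" if "u \<in> tree" for u
    using that act_gen_eq(2) act_inv_a by simp
  have "act (letter_elem p) w = act y (act ?t (act (inv y) w))"
    using y yG w a_closed by (simp add: letter_elem_coset act_mult act_tree)
  also have "\<dots> = map (shift y) (push (K, b) (map (shift (inv y)) w))"
    using act_H[OF yi w] t[OF w'] act_H[OF y(1) push_tree[OF K_letter w']] by simp
  also have "\<dots> = push (shift y (K, b)) (map (shift y) (map (shift (inv y)) w))"
    by (rule push_shift[OF y(1) K_letter w'])
  also have "\<dots> = push p w"
  proof -
    have "shift y (K, b) = p" using y(2) by (simp add: shift_def)
    then show ?thesis using yG w by (simp add: map_shift_shift map_shift_one del: map_map)
  qed
  finally show ?thesis .
qed

text \<open>With \<open>w = []\<close> this shows that \<open>word_elem u\<close> takes the base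
  point to \<open>u\<close>, so every vertex is reached.\<close>

lemma act_word: "u \<in> tree \<Longrightarrow> w \<in> tree \<Longrightarrow> act (word_elem u) w = cat u w"
  by (induction u)
     (auto simp: word_elem_Cons act_mult Cons_tree letter_elem_closed word_elem_closed act_letter cat_tree
       word_elem_def[of "[]"] act_one)

lemma letter_elem_shift:
  assumes h: "h \<in> H" and p: "p \<in> letters"
  shows "letter_elem (shift h p) = h \<otimes> letter_elem p \<otimes> inv h"
proof -
  obtain y b where y: "y \<in> H" "p = (y <# K, b)" using letterE[OF p] .
  have "shift h p = (h \<otimes> y <# K, b)"
    using y h H_carrier K_carrier by (simp add: shift_def lcos_m_assoc)
  then show ?thesis
    using y h H_carrier a_closed subgroup.m_closed[OF H_subgroup h y(1)]
    by (simp add: letter_elem_coset inv_mult_group m_assoc)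
qed

lemma word_elem_shift:
  assumes h: "h \<in> H"
  shows "w \<in> tree \<Longrightarrow> word_elem (map (shift h) w) = h \<otimes> word_elem w \<otimes> inv h"
proof (induction w)
  case (Cons p w)
  then have p: "p \<in> letters" "w \<in> tree" by (auto simp: Cons_tree)
  have G: "h \<in> carrier G" "letter_elem p \<in> carrier G" "word_elem w \<in> carrier G"
    using h H_carrier p letter_elem_closed word_elem_closed by auto
  have "h \<otimes> letter_elem p \<otimes> inv h \<otimes> (h \<otimes> word_elem w \<otimes> inv h)
      = h \<otimes> letter_elem p \<otimes> (inv h \<otimes> h) \<otimes> word_elem w \<otimes> inv h"
    using G by (simp only: m_assoc inv_closed m_closed)
  also have "\<dots> = h \<otimes> (letter_elem p \<otimes> word_elem w) \<otimes> inv h"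
    using G by (simp add: m_assoc)
  finally show ?case using Cons p by (simp add: word_elem_Cons letter_elem_shift[OF h])
qed (use h H_carrier in \<open>simp add: word_elem_def\<close>)

lemma letter_elem_flip:
  assumes p: "p \<in> letters" shows "letter_elem p \<otimes> letter_elem (flip p) = \<one>"
proof -
  obtain y b where y: "y \<in> H" "p = (y <# K, b)" using letterE[OF p] .
  let ?t = "if b then \<gamma> a else inv \<gamma> a" and ?s = "if b then inv \<gamma> a else \<gamma> a"
  have ts: "?t \<in> carrier G" "?s \<in> carrier G" "?t \<otimes> ?s = \<one>" using a_closed by auto
  have yG: "y \<in> carrier G" using y H_carrier by auto
  have "y \<otimes> ?t \<otimes> inv y \<otimes> (y \<otimes> ?s \<otimes> inv y) = y \<otimes> (?t \<otimes> (inv y \<otimes> y) \<otimes> ?s) \<otimes> inv y"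
    using yG ts(1,2) by (simp only: m_assoc inv_closed m_closed)
  also have "\<dots> = \<one>" using yG ts by simp
  finally have "y \<otimes> ?t \<otimes> inv y \<otimes> (y \<otimes> ?s \<otimes> inv y) = \<one>" .
  moreover have "letter_elem p = y \<otimes> ?t \<otimes> inv y" "letter_elem (flip p) = y \<otimes> ?s \<otimes> inv y"
    using y(2) letter_elem_coset[OF y(1)] by (auto simp: flip_def)
  ultimately show ?thesis by (simp only:)
qed

lemma word_elem_push:
  assumes p: "p \<in> letters" and w: "w \<in> tree"
  shows "word_elem (push p w) = letter_elem p \<otimes> word_elem w"
proof (cases w)
  case (Cons q v)
  then have v: "q \<in> letters" "v \<in> tree" using w by (auto simp: Cons_tree)
  have "letter_elem p \<otimes> (letter_elem (flip p) \<otimes> word_elem v) = word_elem v"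
    using letter_elem_flip[OF p] letter_elem_closed p flip_letters[OF p] word_elem_closed[OF v(2)]
    by (simp flip: m_assoc)
  then show ?thesis using Cons by (simp add: word_elem_Cons)
qed (simp add: word_elem_def)

text \<open>Transitivity of the action on \<open>tree\<close>, with stabilizer \<open>H\<close> of the base point.\<close>

lemma word_elem_act:
  assumes g: "g \<in> carrier G" and w: "w \<in> tree"
  shows "\<exists>h\<in>H. g \<otimes> word_elem w = word_elem (act g w) \<otimes> h"
proof -
  \<comment> \<open>Quantifying over all \<open>w\<close> makes this set a subgroup, so that only
    the generators remain to be checked.\<close>
  let ?P = "{g \<in> carrier G. \<forall>w\<in>tree. \<exists>h\<in>H. g \<otimes> word_elem w = word_elem (act g w) \<otimes> h}"
  have "subgroup ?P G"
  proof (rule subgroupI)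
    have "\<one> \<in> ?P" using subgroup.one_closed[OF H_subgroup]
      by (auto simp: act_one word_elem_closed intro!: bexI[of _ \<one>])
    then show "?P \<noteq> {}" by blast
  next
    fix g assume "g \<in> ?P"
    then have g: "g \<in> carrier G" and P: "\<And>w. w \<in> tree \<Longrightarrow> \<exists>h\<in>H. g \<otimes> word_elem w = word_elem (act g w) \<otimes> h"
      by auto
    have "\<exists>h\<in>H. inv g \<otimes> word_elem w = word_elem (act (inv g) w) \<otimes> h" if w: "w \<in> tree" for w
    proof -
      let ?w = "act (inv g) w"
      have w': "?w \<in> tree" using act_tree g w by simp
      obtain h where h: "h \<in> H" "g \<otimes> word_elem ?w = word_elem w \<otimes> h"
        using P[OF w'] act_act_inv[OF g w] by auto
      have "word_elem w = g \<otimes> word_elem ?w \<otimes> inv h"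
        using h H_carrier g w w' word_elem_closed inv_solve_right by simp
      then have "inv g \<otimes> word_elem w = word_elem ?w \<otimes> inv h"
        using h(1) H_carrier g w' word_elem_closed by (simp add: m_assoc inv_solve_left')
      then show ?thesis using h(1) subgroup.m_inv_closed[OF H_subgroup] by auto
    qed
    then show "inv g \<in> ?P" using g by simp
  next
    fix g g' assume "g \<in> ?P" "g' \<in> ?P"
    then have g: "g \<in> carrier G" "g' \<in> carrier G"
      and P: "\<And>w. w \<in> tree \<Longrightarrow> \<exists>h\<in>H. g \<otimes> word_elem w = word_elem (act g w) \<otimes> h"
             "\<And>w. w \<in> tree \<Longrightarrow> \<exists>h\<in>H. g' \<otimes> word_elem w = word_elem (act g' w) \<otimes> h"
      by auto
    have "\<exists>h\<in>H. g \<otimes> g' \<otimes> word_elem w = word_elem (act (g \<otimes> g') w) \<otimes> h" if w: "w \<in> tree" for w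
    proof -
      obtain h' where h': "h' \<in> H" "g' \<otimes> word_elem w = word_elem (act g' w) \<otimes> h'" using P(2)[OF w] by auto
      obtain h where h: "h \<in> H" "g \<otimes> word_elem (act g' w) = word_elem (act g (act g' w)) \<otimes> h"
        using P(1)[OF act_tree[OF g(2) w]] by auto
      have "g \<otimes> g' \<otimes> word_elem w = g \<otimes> word_elem (act g' w) \<otimes> h'"
        using h' g w act_tree word_elem_closed H_carrier by (simp add: m_assoc)
      also have "\<dots> = word_elem (act (g \<otimes> g') w) \<otimes> (h \<otimes> h')"
        using h h'(1) g w act_tree word_elem_closed H_carrier by (simp add: m_assoc act_mult)
      finally show ?thesis using subgroup.m_closed[OF H_subgroup h(1) h'(1)] by blast
    qed
    then show "g \<otimes> g' \<in> ?P" using g by simp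
  qed auto
  moreover have "\<gamma> ` V \<subseteq> ?P"
  proof (intro subsetI CollectI conjI ballI; elim imageE)
    fix x w v assume w: "w \<in> tree" and v: "x = \<gamma> v" "v \<in> V"
    show "\<exists>h\<in>H. x \<otimes> word_elem w = word_elem (act x w) \<otimes> h"
    proof (cases "v = a")
      case True
      have "letter_elem (K, True) = \<gamma> a"
        using letter_elem_coset[OF subgroup.one_closed[OF H_subgroup], of True] lcos_mult_one[OF K_carrier] a_closed
        by simp
      then have "x \<otimes> word_elem w = word_elem (act x w) \<otimes> \<one>"
        using True v act_gen_eq(2)[OF w] word_elem_push[OF K_letter w, of True] word_elem_closed[OF w] a_closed
        by simp
      then show ?thesis using subgroup.one_closed[OF H_subgroup] by blast
    next
      case False
      note h = gen_H[OF v(2) False]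
      have "x \<otimes> word_elem w = word_elem (act x w) \<otimes> \<gamma> v"
        using v(1) act_H[OF h w] word_elem_shift[OF h w] H_carrier[OF h] word_elem_closed[OF w]
        by (simp add: m_assoc)
      then show ?thesis using h by blast
    qed
  qed (use gen_closed in auto)
  ultimately have "generate G (\<gamma> ` V) \<subseteq> ?P" by (rule generate_subgroup_incl[rotated])
  then have "carrier G \<subseteq> ?P" unfolding generate_gens .
  then show ?thesis using assms by blast
qed

lemma act_decomp:
  assumes g: "g \<in> carrier G"
  obtains h where "h \<in> H" "g = word_elem (act g []) \<otimes> h"
  using word_elem_act[OF g Nil_tree] g by (auto simp: word_elem_def[of "[]"])

lemma act_Nil_iff: "g \<in> carrier G \<Longrightarrow> act g [] = [] \<longleftrightarrow> g \<in> H"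
proof
  assume "g \<in> carrier G" "act g [] = []"
  then show "g \<in> H" using act_decomp[of g] H_carrier by (metis l_one word_elem_def foldr.simps(1) id_apply)
qed (simp add: act_H)

text \<open>Every element translates by some \<open>h\<close> of \<open>H\<close> and then
  multiplies by its own word; the comparison of words for commuting elements rests on this
  form.\<close>

lemma act_form:
  assumes g: "g \<in> carrier G"
  obtains h where "h \<in> H" "\<And>w. w \<in> tree \<Longrightarrow> act g w = cat (act g []) (map (shift h) w)"
proof -
  obtain h where h: "h \<in> H" "g = word_elem (act g []) \<otimes> h" using act_decomp[OF g] .
  have "act g w = cat (act g []) (map (shift h) w)" if w: "w \<in> tree" for w
  proof -
    have t: "act g [] \<in> tree" using act_tree[OF g] by simp
    have "act g w = act (word_elem (act g []) \<otimes> h) w" using h(2) by simp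
    also have "\<dots> = cat (act g []) (map (shift h) w)"
      using t w h(1) H_carrier word_elem_closed map_shift_tree
      by (simp add: act_mult act_H act_word)
    finally show ?thesis .
  qed
  then show thesis using h(1) that by blast
qed

text \<open>In the tree, \<open>g\<close> fixes the base vertex and its image under
  \<open>b\<close>. As \<open>H\<close> acts letter by letter, \<open>g\<close> fixes the first
  letter of the word of \<open>b\<close>, a coset \<open>y <# K\<close>: it stabilizes the first
  edge of the path between the two vertices.\<close>

lemma two_fixed_points:
  assumes g: "g \<in> H" and b: "b \<in> carrier G" "b \<notin> H" and c: "inv b \<otimes> g \<otimes> b \<in> H"
  shows "\<exists>y\<in>H. inv y \<otimes> g \<otimes> y \<in> K"
proof -
  let ?w = "act b []"
  have gG: "g \<in> carrier G" using g H_carrier by auto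
  have w: "?w \<in> tree" "?w \<noteq> []" using act_tree b act_Nil_iff by auto
  have "act g ?w = act (b \<otimes> (inv b \<otimes> g \<otimes> b)) []"
    using b gG by (simp add: act_mult[symmetric] m_assoc[symmetric])
  also have "\<dots> = ?w" using act_mult[OF b(1) H_carrier[OF c]] act_Nil_iff[OF H_carrier[OF c]] c by simp
  finally have "map (shift g) ?w = ?w" using act_H[OF g w(1)] by simp
  moreover obtain p v where pv: "?w = p # v" using w(2) by (cases ?w) auto
  ultimately have p: "shift g p = p" "p \<in> letters" using w(1) by (auto simp: Cons_tree)
  obtain y d where y: "y \<in> H" "p = (y <# K, d)" using letterE[OF p(2)] .
  have yG: "y \<in> carrier G" using y H_carrier by auto
  have "g \<otimes> y <# K = y <# K"
    using p(1) y yG gG K_carrier by (simp add: shift_def lcos_m_assoc)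
  moreover have "g \<otimes> y \<otimes> \<one> \<in> g \<otimes> y <# K"
    using subgroup.one_closed[OF K_subgroup] by (auto simp: l_coset_def)
  ultimately have "g \<otimes> y \<in> y <# K" using yG gG by simp
  then obtain k where k: "k \<in> K" "g \<otimes> y = y \<otimes> k" by (auto simp: l_coset_def)
  then have "inv y \<otimes> g \<otimes> y = k" using yG gG K_carrier by (auto simp: m_assoc)
  then show ?thesis using y(1) k(1) by auto
qed

end

lemma (in group) int_pow_commute:
  assumes "x \<in> carrier G" "y \<in> carrier G" "x \<otimes> y = y \<otimes> x"
  shows "x [^] (i::int) \<otimes> y [^] (j::int) = y [^] j \<otimes> x [^] i"
proof -
  have x: "x [^] i \<otimes> y = y \<otimes> x [^] i"
    using subgroup_int_pow_closed[OF centralizer_subgroup[OF assms(2)], of x i] assms by simp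
  have "y [^] j \<otimes> x [^] i = x [^] i \<otimes> y [^] j"
    using subgroup_int_pow_closed[OF centralizer_subgroup[of "x [^] i"], of y j] assms x by simp
  then show ?thesis by simp
qed

lemma (in group) conj_hom: "c \<in> carrier G \<Longrightarrow> (\<lambda>x. inv c \<otimes> x \<otimes> c) \<in> hom G G"
  by (rule homI) (simp_all add: m_assoc)

lemma (in group) conj_int_pow:
  assumes "c \<in> carrier G" "x \<in> carrier G"
  shows "(inv c \<otimes> x \<otimes> c) [^] (i::int) = inv c \<otimes> x [^] i \<otimes> c"
  using hom_int_pow[OF conj_hom[OF assms(1)] assms(2) is_group is_group, of i] by simp

section \<open>Commuting elements and elliptic elements\<close>

context raag_letter
begin

text \<open>Conjugacy into \<open>H\<close> means fixing a vertex of the tree.\<close>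

definition elliptic :: "'a \<Rightarrow> bool" where
  "elliptic g \<longleftrightarrow> (\<exists>y\<in>carrier G. inv y \<otimes> g \<otimes> y \<in> H)"

text \<open>Coprimality preserves the information about \<open>g\<close>: once the exponent of
  \<open>x\<close> turns out to be 0, that of \<open>g\<close> is 1 or -1 and not merely some
  nonzero integer.\<close>

definition elliptic_comb :: "'a \<Rightarrow> 'a \<Rightarrow> bool" where
  "elliptic_comb x g \<longleftrightarrow> (\<exists>i j :: int. coprime i j \<and> elliptic (x [^] i \<otimes> g [^] j))"

text \<open>The distance in the tree from the base vertex to its image under
  \<open>g\<close>.\<close>

abbreviation len :: "'a \<Rightarrow> nat" where
  "len g \<equiv> length (act g [])"

lemma elliptic_conj:
  assumes "c \<in> carrier G" "g \<in> carrier G" "elliptic (inv c \<otimes> g \<otimes> c)"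
  shows "elliptic g"
proof -
  obtain y where y: "y \<in> carrier G" "inv y \<otimes> (inv c \<otimes> g \<otimes> c) \<otimes> y \<in> H"
    using assms(3) by (auto simp: elliptic_def)
  then have "inv (c \<otimes> y) \<otimes> g \<otimes> (c \<otimes> y) \<in> H"
    using assms(1,2) by (simp add: inv_mult_group m_assoc)
  then show ?thesis using y(1) assms(1) elliptic_def by blast
qed

lemma H_elliptic: "g \<in> H \<Longrightarrow> elliptic g"
  using H_carrier by (auto simp: elliptic_def intro!: bexI[of _ \<one>])

lemma elliptic_inv: "g \<in> carrier G \<Longrightarrow> elliptic (inv g) \<Longrightarrow> elliptic g"
  unfolding elliptic_def
proof (elim bexE)
  fix y assume g: "g \<in> carrier G" and y: "y \<in> carrier G" "inv y \<otimes> inv g \<otimes> y \<in> H"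
  have "inv (inv y \<otimes> inv g \<otimes> y) \<in> H" using y(2) subgroup.m_inv_closed[OF H_subgroup] by simp
  then show "\<exists>y\<in>carrier G. inv y \<otimes> g \<otimes> y \<in> H"
    using g y(1) by (auto simp: inv_mult_group m_assoc)
qed

lemma elliptic_comb_sym:
  assumes "x \<in> carrier G" "g \<in> carrier G" "x \<otimes> g = g \<otimes> x" "elliptic_comb g x"
  shows "elliptic_comb x g"
  using assms(4) int_pow_commute[OF assms(1-3)] unfolding elliptic_comb_def
  by (metis coprime_commute)

lemma elliptic_comb_inv:
  assumes "x \<in> carrier G" "g \<in> carrier G" "elliptic_comb x (inv g)"
  shows "elliptic_comb x g"
proof -
  obtain i j :: int where ij: "coprime i j" "elliptic (x [^] i \<otimes> inv g [^] j)"
    using assms(3) by (auto simp: elliptic_comb_def)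
  then have "coprime i (- j)" "elliptic (x [^] i \<otimes> g [^] (- j))"
    using assms(2) by (simp_all add: int_pow_neg int_pow_inv)
  then show ?thesis unfolding elliptic_comb_def by blast
qed

text \<open>One Euclidean step: exponents \<open>i, j\<close> for \<open>inv g \<otimes> x\<close>
  and \<open>g\<close> become \<open>i, j - i\<close> for \<open>x\<close> and \<open>g\<close>, and
  coprimality survives.\<close>

lemma elliptic_comb_mult:
  assumes "x \<in> carrier G" "g \<in> carrier G" "x \<otimes> g = g \<otimes> x" "elliptic_comb (inv g \<otimes> x) g"
  shows "elliptic_comb x g"
proof -
  obtain i j :: int where ij: "coprime i j" "elliptic ((inv g \<otimes> x) [^] i \<otimes> g [^] j)"
    using assms(4) by (auto simp: elliptic_comb_def)
  have "inv g \<otimes> x = x \<otimes> inv g"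
    using int_pow_commute[OF assms(1-3), of 1 "-1"] assms by (simp add: int_pow_neg)
  then have "(inv g \<otimes> x) [^] i = x [^] i \<otimes> inv g [^] i"
    using int_pow_mult_distrib[of x "inv g" i] assms by simp
  then have "(inv g \<otimes> x) [^] i \<otimes> g [^] j = x [^] i \<otimes> g [^] (j - i)"
    using assms int_pow_mult[of g "- i" j] by (simp add: m_assoc int_pow_inv int_pow_neg)
  moreover have "coprime i (j - i)"
    using ij(1) gcd_diff1[of j i] by (simp add: coprime_iff_gcd_eq_1 gcd.commute)
  ultimately show ?thesis using ij(2) unfolding elliptic_comb_def by metis
qed

lemma elliptic_comb_conj:
  assumes c: "c \<in> carrier G" and x: "x \<in> carrier G" "g \<in> carrier G"
    and e: "elliptic_comb (inv c \<otimes> x \<otimes> c) (inv c \<otimes> g \<otimes> c)"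
  shows "elliptic_comb x g"
proof -
  obtain i j :: int where ij: "coprime i j"
    "elliptic ((inv c \<otimes> x \<otimes> c) [^] i \<otimes> (inv c \<otimes> g \<otimes> c) [^] j)"
    using e by (auto simp: elliptic_comb_def)
  have "(inv c \<otimes> x \<otimes> c) [^] i \<otimes> (inv c \<otimes> g \<otimes> c) [^] j = inv c \<otimes> (x [^] i \<otimes> g [^] j) \<otimes> c"
    unfolding conj_int_pow[OF c x(1)] conj_int_pow[OF c x(2)] using c x by (simp add: m_assoc)
  then have "elliptic (x [^] i \<otimes> g [^] j)" using ij(2) elliptic_conj[OF c] x by simp
  then show ?thesis using ij(1) elliptic_comb_def by blast
qed

text \<open>Without cancellation \<open>x \<otimes> g\<close> and \<open>g \<otimes> x\<close> both
  take the base point to a plain concatenation, so the shorter word \<open>act g []\<close> is a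
  prefix of \<open>act x []\<close>, and \<open>inv g\<close> strips it.\<close>

lemma len_reduce:
  assumes x: "x \<in> carrier G" and g: "g \<in> carrier G"
    and h: "\<And>w. w \<in> tree \<Longrightarrow> act x w = cat (act x []) (map (shift h) w)"
    and h': "h' \<in> H" "\<And>w. w \<in> tree \<Longrightarrow> act g w = cat (act g []) (map (shift h') w)"
    and xg: "x \<otimes> g = g \<otimes> x"
    and nc: "\<not> cancels (act x []) (map (shift h) (act g []))" "\<not> cancels (act g []) (map (shift h') (act x []))"
    and hH: "h \<in> H" and ne: "act g [] \<noteq> []" and le: "len g \<le> len x"
  shows "len (inv g \<otimes> x) < len x"
proof -
  let ?f = "act x []" and ?f' = "act g []"
  have t: "?f \<in> tree" "?f' \<in> tree" using act_tree x g by auto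
  have "cat ?f (map (shift h) ?f') = act (x \<otimes> g) []" using act_mult x g h[OF t(2)] by simp
  also have "\<dots> = cat ?f' (map (shift h') ?f)" using xg act_mult x g h'(2)[OF t(1)] by simp
  finally have "?f @ map (shift h) ?f' = ?f' @ map (shift h') ?f"
    using nc t map_shift_tree[OF hH t(2)] map_shift_tree[OF h'(1) t(1)] treeD(2)
    by (simp add: cat_reduced reduced_append)
  then have "take (len g) (?f @ map (shift h) ?f') = ?f'" by simp
  then have "take (len g) ?f = ?f'" using le by simp
  then obtain u where u: "?f = ?f' @ u" using append_take_drop_id by metis
  have ut: "u \<in> tree" using t(1) unfolding u by (auto simp: tree_def reduced_append)
  let ?w = "map (shift (inv h')) u"
  have h'i: "inv h' \<in> H" "h' \<in> carrier G" using h'(1) subgroup.m_inv_closed[OF H_subgroup] H_carrier by auto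
  have w: "?w \<in> tree" by (rule map_shift_tree[OF h'i(1) ut])
  have "act g ?w = cat ?f' u"
    using h'(2)[OF w] map_shift_shift[of h' "inv h'" u] h'i ut map_shift_one by (simp del: map_map)
  also have "\<dots> = ?f" using t(1) treeD(2) u cat_reduced by metis
  finally have "act (inv g) ?f = ?w" using act_inv_act[OF g w] by simp
  then have "act (inv g \<otimes> x) [] = ?w" using x g by (simp add: act_mult)
  then show ?thesis using u ne by simp
qed

text \<open>A Euclidean algorithm on the translation lengths of two commuting automorphisms of the tree.\<close>

lemma commuting_elliptic_comb:
  assumes "x \<in> carrier G" "g \<in> carrier G" "x \<otimes> g = g \<otimes> x"
  shows "elliptic_comb x g"
  using assms
proof (induction "len x + len g" arbitrary: x g rule: less_induct)
  case less
  note x = less.prems(1) and g = less.prems(2) and xg = less.prems(3)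
  \<comment> \<open>Stated for any \<open>g'\<close> as long as \<open>g\<close>, because it is
    applied to \<open>g\<close> and to \<open>inv g\<close>.\<close>
  have no_cancel: "elliptic_comb x g'"
    if g': "g' \<in> carrier G" "x \<otimes> g' = g' \<otimes> x" and l: "len g' = len g"
      and h: "h \<in> H" "\<And>w. w \<in> tree \<Longrightarrow> act x w = cat (act x []) (map (shift h) w)"
      and h': "h' \<in> H" "\<And>w. w \<in> tree \<Longrightarrow> act g' w = cat (act g' []) (map (shift h') w)"
      and nc: "\<not> cancels (act x []) (map (shift h) (act g' []))" "\<not> cancels (act g' []) (map (shift h') (act x []))"
      and ne: "act x [] \<noteq> []" "act g' [] \<noteq> []"
    for g' h h'
  proof (cases "len g' \<le> len x")
    case True
    have "elliptic_comb (inv g' \<otimes> x) g'"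
    proof (rule less.hyps)
      show "len (inv g' \<otimes> x) + len g' < len x + len g"
        using len_reduce[OF x g'(1) h(2) h' g'(2) nc h(1) ne(2) True] l by simp
      show "inv g' \<otimes> x \<otimes> g' = g' \<otimes> (inv g' \<otimes> x)" using x g' by (simp add: m_assoc)
    qed (use x g' in auto)
    then show ?thesis using elliptic_comb_mult x g' by blast
  next
    case False
    have "elliptic_comb (inv x \<otimes> g') x"
    proof (rule less.hyps)
      show "len (inv x \<otimes> g') + len x < len x + len g"
        using len_reduce[OF g'(1) x h'(2) h g'(2)[symmetric] nc(2,1) h'(1) ne(1)] False l by simp
      show "inv x \<otimes> g' \<otimes> x = x \<otimes> (inv x \<otimes> g')" using x g' g'(2)[symmetric] by (simp add: m_assoc)
    qed (use x g' in auto)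
    then show ?thesis using elliptic_comb_mult[OF g'(1) x] elliptic_comb_sym x g' by metis
  qed
  let ?f = "act x []" and ?f' = "act g []"
  obtain h where h: "h \<in> H" "\<And>w. w \<in> tree \<Longrightarrow> act x w = cat ?f (map (shift h) w)"
    using act_form[OF x] by blast
  obtain h' where h': "h' \<in> H" "\<And>w. w \<in> tree \<Longrightarrow> act g w = cat ?f' (map (shift h') w)"
    using act_form[OF g] by blast
  have t: "?f \<in> tree" "?f' \<in> tree" using act_tree x g by auto
  note red = treeD(2)[OF t(1)] treeD(2)[OF t(2)] treeD(2)[OF map_shift_tree[OF h(1) t(2)]]
    treeD(2)[OF map_shift_tree[OF h'(1) t(1)]]
  \<comment> \<open>An empty word means that the element lies in \<open>H\<close>, hence is elliptic
    by itself.\<close>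
  consider (x) "?f = []" | (g) "?f' = []" | (ne) "?f \<noteq> []" "?f' \<noteq> []" by blast
  then show ?case
  proof cases
    case x
    then have "elliptic (x [^] (1::int) \<otimes> g [^] (0::int))"
      using act_Nil_iff less.prems H_elliptic by simp
    moreover have "coprime (1::int) 0" by simp
    ultimately show ?thesis unfolding elliptic_comb_def by blast
  next
    case g
    then have "elliptic (x [^] (0::int) \<otimes> g [^] (1::int))"
      using act_Nil_iff less.prems H_elliptic by simp
    moreover have "coprime (0::int) 1" by simp
    ultimately show ?thesis unfolding elliptic_comb_def by blast
  next
    case ne
    have "cat ?f (map (shift h) ?f') = act (x \<otimes> g) []" using act_mult x g h(2)[OF t(2)] by simp
    also have "\<dots> = cat ?f' (map (shift h') ?f)" using xg act_mult x g h'(2)[OF t(1)] by simp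
    finally have eq: "length (cat ?f (map (shift h) ?f')) = length (cat ?f' (map (shift h') ?f))"
      by simp
    \<comment> \<open>Equal lengths force both junctions to cancel or neither.\<close>
    then have iff: "cancels ?f (map (shift h) ?f') \<longleftrightarrow> cancels ?f' (map (shift h') ?f)"
      using length_cat_eq_iff[OF red(1,3)] length_cat_eq_iff[OF red(2,4)] by (simp add: add.commute)
    show ?thesis
    proof (cases "cancels ?f (map (shift h) ?f')")
      case False
      then show ?thesis using no_cancel[OF g xg refl h h' False _ ne] iff by blast
    next
      case True
      then have c: "shift h (hd ?f') = flip (last ?f)" "shift h' (hd ?f) = flip (last ?f')"
        using iff ne by (auto simp: cancels_def hd_map)
      show ?thesis
      proof (cases "hd ?f = hd ?f'")
        case False
        \<comment> \<open>Here \<open>g\<close> is replaced by its inverse. Since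
          \<open>act g []\<close> cancels against the translate of \<open>act x []\<close>, the word
          of \<open>inv g\<close> begins with \<open>hd ?f\<close>, which differs from
          \<open>hd ?f'\<close>; hence it does not cancel against the end of
          \<open>act x []\<close>.\<close>
        let ?f'' = "act (inv g) []"
        have gi: "inv g \<in> carrier G" "x \<otimes> inv g = inv g \<otimes> x"
          using g int_pow_commute[OF x g xg, of 1 "-1"] x by (simp_all add: int_pow_neg)
        obtain h'' where h'': "h'' \<in> H" "\<And>w. w \<in> tree \<Longrightarrow> act (inv g) w = cat ?f'' (map (shift h'') w)"
          using act_form[OF gi(1)] by blast
        have t'': "?f'' \<in> tree" using act_tree gi by auto
        have m: "map (shift h') ?f'' \<in> tree" by (rule map_shift_tree[OF h'(1) t''])
        have "cat ?f' (map (shift h') ?f'') = []"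
          using h'(2)[OF t''] act_act_inv[OF g Nil_tree] by simp
        then have fr: "map (shift h') ?f'' = flip_rev ?f'"
          using cat_eq_Nil[OF red(2) treeD(2)[OF m]] by simp
        then have l: "length ?f'' = length ?f'" by (metis flip_rev_def length_map length_rev)
        then have ne'': "?f'' \<noteq> []" using ne by auto
        have "shift h' (hd ?f'') = flip (last ?f')"
          using fr ne ne'' by (metis flip_rev_def hd_map hd_rev rev_is_Nil_conv)
        then have "hd ?f'' = hd ?f"
          using c(2) inj_onD[OF shift_inj[OF h'(1)], of "hd ?f''" "hd ?f"] ne ne'' t t'' treeD(1) by auto
        then have "shift h (hd ?f'') \<noteq> flip (last ?f)"
          using c(1) False inj_onD[OF shift_inj[OF h(1)], of "hd ?f" "hd ?f'"] ne t treeD(1) by auto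
        then have nc: "\<not> cancels ?f (map (shift h) ?f'')" using ne'' by (auto simp: cancels_def hd_map)
        have "cat ?f (map (shift h) ?f'') = act (x \<otimes> inv g) []"
          using act_mult[OF x gi(1) Nil_tree] h(2)[OF t''] by simp
        also have "\<dots> = cat ?f'' (map (shift h'') ?f)"
          unfolding gi(2) using act_mult[OF gi(1) x Nil_tree] h''(2)[OF t(1)] by simp
        finally have "\<not> cancels ?f'' (map (shift h'') ?f)"
          using nc length_cat_eq_iff[OF treeD(2)[OF t(1)] treeD(2)[OF map_shift_tree[OF h(1) t'']]]
           length_cat_eq_iff[OF treeD(2)[OF t''] treeD(2)[OF map_shift_tree[OF h''(1) t(1)]]]
          by (simp add: add.commute)
        then have "elliptic_comb x (inv g)"
          using no_cancel[OF gi l h h'' nc _ ne(1) ne''] by blast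
        then show ?thesis using elliptic_comb_inv x g by blast
      next
        case True
        \<comment> \<open>Both words begin with \<open>p\<close> and end with the flip of a
          translate of \<open>p\<close>, so conjugation by the element of this letter strips the two
          ends of each.\<close>
        define p where "p = hd ?f"
        have p: "p \<in> letters" using ne t treeD(1) by (auto simp: p_def)
        define c where "c = letter_elem p"
        have cG: "c \<in> carrier G" using letter_elem_closed[OF p] by (simp add: c_def)
        have shorter: "len (inv c \<otimes> y \<otimes> c) < len y"
          if y: "y \<in> carrier G" "act y [] \<noteq> []" "hd (act y []) = p"
            and k: "k \<in> H" "\<And>w. w \<in> tree \<Longrightarrow> act y w = cat (act y []) (map (shift k) w)"
            and fl: "shift k p = flip (last (act y []))" for y k
        proof -
          let ?u = "act y []"
          have ut: "?u \<in> tree" using act_tree y by auto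
          obtain u where u: "?u = p # u" using y(2,3) by (cases ?u) auto
          \<comment> \<open>The first and last letters have opposite signs, so the word has at least
            two letters.\<close>
          have "snd (shift k p) = snd p" by (simp add: shift_def map_prod_def split_beta)
          then have "u \<noteq> []" using fl u by (auto simp: flip_def)
          then obtain v where v: "?u = p # v @ [flip (shift k p)]"
            using u fl by (metis append_butlast_last_id flip_flip last_ConsR)
          have "reduced (p # v)" using treeD(2)[OF ut] reduced_append[of "p # v"] unfolding v by simp
          then have vt: "p # v \<in> tree" "v \<in> tree"
            using ut unfolding v by (auto simp: tree_def reduced_Cons)
          have "act y [p] = cat ?u [shift k p]"
            using k(2)[of "[p]"] p by (simp add: tree_def)
          also have "\<dots> = cat (p # v) []"
            unfolding v by (simp add: cat_append)
          also have "\<dots> = p # v" using cat_reduced[of "p # v" "[]"] treeD(2)[OF vt(1)] by simp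
          finally have yp: "act y [p] = p # v" .
          have "act c v = p # v"
            using act_letter[OF p vt(2)] push_Cons_reduced[OF treeD(2)[OF vt(1)]] by (simp add: c_def)
          then have "act (inv c) (p # v) = v" using act_inv_act[OF cG vt(2)] by simp
          moreover have "act c [] = [p]" using act_letter[OF p] by (simp add: c_def)
          moreover have "[p] \<in> tree" using p by (simp add: tree_def)
          ultimately have "act (inv c \<otimes> y \<otimes> c) [] = v"
            using yp y cG by (simp add: act_mult act_tree)
          then show ?thesis using v by simp
        qed
        have "elliptic_comb (inv c \<otimes> x \<otimes> c) (inv c \<otimes> g \<otimes> c)"
        proof (rule less.hyps)
          show "len (inv c \<otimes> x \<otimes> c) + len (inv c \<otimes> g \<otimes> c) < len x + len g"
            using shorter[OF x ne(1) _ h] shorter[OF g ne(2) _ h'] \<open>shift h (hd ?f') = flip (last ?f)\<close>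
              \<open>shift h' (hd ?f) = flip (last ?f')\<close> True by (simp add: p_def)
          have "inv c \<otimes> x \<otimes> c \<otimes> (inv c \<otimes> g \<otimes> c) = inv c \<otimes> (x \<otimes> g) \<otimes> c"
            using x g cG by (simp add: m_assoc)
          also have "\<dots> = inv c \<otimes> g \<otimes> c \<otimes> (inv c \<otimes> x \<otimes> c)"
            unfolding xg using x g cG by (simp add: m_assoc)
          finally show "inv c \<otimes> x \<otimes> c \<otimes> (inv c \<otimes> g \<otimes> c) = inv c \<otimes> g \<otimes> c \<otimes> (inv c \<otimes> x \<otimes> c)" .
        qed (use x g cG in auto)
        then show ?thesis using elliptic_comb_conj[OF cG x g] by blast
      qed
    qed
  qed
qed

text \<open>The exponent of \<open>a\<close> vanishes on conjugates of elements of \<open>H\<close>,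
  and on the elliptic combination it equals \<open>i\<close>. So \<open>i = 0\<close>, and
  coprimality leaves \<open>g\<close> or its inverse.\<close>

lemma elliptic_of_commuting:
  assumes x: "x \<in> carrier G" and g: "g \<in> carrier G" and xg: "x \<otimes> g = g \<otimes> x"
    and e: "expo a x = 1" "expo a g = 0"
  shows "elliptic g"
proof -
  obtain i j :: int where ij: "coprime i j" "elliptic (x [^] i \<otimes> g [^] j)"
    using commuting_elliptic_comb[OF x g xg] by (auto simp: elliptic_comb_def)
  obtain y where y: "y \<in> carrier G" "inv y \<otimes> (x [^] i \<otimes> g [^] j) \<otimes> y \<in> H"
    using ij(2) by (auto simp: elliptic_def)
  have "expo a (inv y \<otimes> (x [^] i \<otimes> g [^] j) \<otimes> y) = 0"
    using y(2) by (intro expo_special[of "V - {a}"]) auto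
  then have "i = 0" using y(1) x g e by simp
  then have "j = 1 \<or> j = -1" "elliptic (g [^] j)" using ij g by auto
  then show ?thesis using g elliptic_inv by (auto simp: int_pow_neg)
qed

end

context raag
begin

lemma raag_letterI: "a \<in> V \<Longrightarrow> raag_letter G V adj \<gamma> a"
  by (simp add: raag_letter_def raag_letter_axioms_def raag_axioms)

end

section \<open>Automorphisms of rigid right-angled Artin groups\<close>

context raag
begin

lemma special_V: "\<langle>V\<rangle> = carrier G"
  by (rule generate_gens)

lemma special_Diff:
  assumes "finite W" "x \<in> carrier G" "\<And>a. a \<in> W \<Longrightarrow> x \<in> \<langle>V - {a}\<rangle>"
  shows "x \<in> \<langle>V - W\<rangle>"
  using assms(1,3)
proof (induction W)
  case empty
  then show ?case using assms(2) special_V by simp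
next
  case (insert a W)
  then have "x \<in> \<langle>(V - {a}) \<inter> (V - W)\<rangle>" by (intro special_Int) auto
  moreover have "(V - {a}) \<inter> (V - W) = V - insert a W" by auto
  ultimately show ?case by simp
qed

section \<open>Conjugacy into special subgroups\<close>

definition conj_into :: "'a \<Rightarrow> 'v set \<Rightarrow> bool" where
  "conj_into g A \<longleftrightarrow> (\<exists>y\<in>carrier G. inv y \<otimes> g \<otimes> y \<in> \<langle>A\<rangle>)"

lemma conj_into_mono: "A \<subseteq> B \<Longrightarrow> conj_into g A \<Longrightarrow> conj_into g B"
  unfolding conj_into_def using special_mono by blast

lemma conj_into_conj:
  assumes "g \<in> carrier G" "y \<in> carrier G" "conj_into (inv y \<otimes> g \<otimes> y) A"
  shows "conj_into g A"
proof -
  obtain z where z: "z \<in> carrier G" "inv z \<otimes> (inv y \<otimes> g \<otimes> y) \<otimes> z \<in> \<langle>A\<rangle>"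
    using assms(3) by (auto simp: conj_into_def)
  then have "inv (y \<otimes> z) \<otimes> g \<otimes> (y \<otimes> z) \<in> \<langle>A\<rangle>"
    using assms(1,2) by (simp add: inv_mult_group m_assoc)
  then show ?thesis using z(1) assms(2) conj_into_def by blast
qed

text \<open>Take one conjugate of \<open>g\<close> in \<open>\<langle>A\<rangle>\<close> and one in
  \<open>\<langle>B\<rangle>\<close>. The retraction onto \<open>\<langle>A\<rangle>\<close> fixes
  the first, sends the second into \<open>\<langle>A \<inter> B\<rangle>\<close> and carries along
  the element that conjugates one to the other.\<close>

lemma conj_into_Int:
  assumes g: "g \<in> carrier G" and A: "A \<subseteq> V" "conj_into g A" and B: "B \<subseteq> V" "conj_into g B"
  shows "conj_into g (A \<inter> B)"
proof -
  obtain y where y: "y \<in> carrier G" "inv y \<otimes> g \<otimes> y \<in> \<langle>A\<rangle>" using A by (auto simp: conj_into_def)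
  obtain z where z: "z \<in> carrier G" "inv z \<otimes> g \<otimes> z \<in> \<langle>B\<rangle>" using B by (auto simp: conj_into_def)
  obtain r where r: "r \<in> hom G G" "\<And>x. x \<in> \<langle>A\<rangle> \<Longrightarrow> r x = x"
    "\<And>B x. B \<subseteq> V \<Longrightarrow> x \<in> \<langle>B\<rangle> \<Longrightarrow> r x \<in> \<langle>A \<inter> B\<rangle>"
    using retraction[OF A(1)] by metis
  interpret r: group_hom G G r by (simp add: group_hom_def group_hom_axioms_def r is_group)
  let ?u = "inv y \<otimes> g \<otimes> y" and ?w = "inv z \<otimes> g \<otimes> z" and ?k = "inv y \<otimes> z"
  have "?w = inv ?k \<otimes> ?u \<otimes> ?k" using g y(1) z(1) by (simp add: inv_mult_group m_assoc)
  then have "r ?w = inv (r ?k) \<otimes> ?u \<otimes> r ?k" using r(2)[OF y(2)] y(1) z(1) g by simp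
  then have "conj_into ?u (A \<inter> B)"
    using r(3)[OF B(1) z(2)] y(1) z(1) by (auto simp: conj_into_def intro!: bexI[of _ "r ?k"])
  then show ?thesis using conj_into_conj g y(1) by blast
qed

lemma conj_into_Diff:
  assumes "finite W" and g: "g \<in> carrier G" and "\<And>a. a \<in> W \<Longrightarrow> conj_into g (V - {a})"
  shows "conj_into g (V - W)"
  using assms(1,3)
proof (induction W)
  case empty
  then show ?case using g special_V by (auto simp: conj_into_def intro!: bexI[of _ \<one>])
next
  case (insert a W)
  then have "conj_into g ((V - {a}) \<inter> (V - W))" by (intro conj_into_Int[OF g]) auto
  moreover have "(V - {a}) \<inter> (V - W) = V - insert a W" by auto
  ultimately show ?case by simp
qed

lemma conj_into_of_commuting:
  assumes "a \<in> V" "x \<in> carrier G" "g \<in> carrier G" "x \<otimes> g = g \<otimes> x" "expo a x = 1" "expo a g = 0"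
  shows "conj_into g (V - {a})"
proof -
  interpret T: raag_letter G V adj \<gamma> a by (rule raag_letterI[OF assms(1)])
  show ?thesis using T.elliptic_of_commuting[OF assms(2-6)] by (simp add: T.elliptic_def conj_into_def)
qed

lemma special_singleton:
  assumes v: "v \<in> V" and x: "x \<in> \<langle>{v}\<rangle>" "expo v x = 1"
  shows "x = \<gamma> v"
proof -
  obtain k :: int where "x = \<gamma> v [^] k" using x(1) generate_pow[OF gen_closed[OF v]] by auto
  then show ?thesis using x(2) gen_closed[OF v] v by (simp add: expo_gen)
qed

text \<open>Otherwise \<open>\<gamma> b\<close> fixes two vertices in the tree of \<open>a\<close>,
  so it has a conjugate in the subgroup of the link of \<open>a\<close>, where the exponent of
  \<open>b\<close> is 0.\<close>

lemma special_malnormal: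
  assumes a: "a \<in> V" and b: "b \<in> V" "b \<noteq> a" "\<not> adj a b"
    and k: "k \<in> carrier G" "inv k \<otimes> \<gamma> b \<otimes> k \<in> \<langle>V - {a}\<rangle>"
  shows "k \<in> \<langle>V - {a}\<rangle>"
proof (rule ccontr)
  interpret T: raag_letter G V adj \<gamma> a by (rule raag_letterI[OF a])
  assume "k \<notin> \<langle>V - {a}\<rangle>"
  then obtain y where y: "y \<in> \<langle>V - {a}\<rangle>" "inv y \<otimes> \<gamma> b \<otimes> y \<in> \<langle>{v \<in> V. adj a v}\<rangle>"
    using T.two_fixed_points[of "\<gamma> b" k] k b by (auto intro: gen_special)
  then have "expo b (inv y \<otimes> \<gamma> b \<otimes> y) = 0" using b by (intro expo_special[of "{v \<in> V. adj a v}"]) auto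
  then show False using y(1) special_carrier[of "V - {a}" y] gen_closed b(1) by (simp add: expo_gen)
qed

lemma centralizer_special:
  assumes "a \<in> V" "b \<in> V" "b \<noteq> a" "\<not> adj a b" and k: "k \<in> carrier G" "k \<otimes> \<gamma> b = \<gamma> b \<otimes> k"
  shows "k \<in> \<langle>V - {a}\<rangle>"
proof (rule special_malnormal[OF assms(1-4) k(1)])
  have "inv k \<otimes> \<gamma> b \<otimes> k = inv k \<otimes> (k \<otimes> \<gamma> b)"
    using k gen_closed[OF assms(2)] by (simp add: m_assoc)
  also have "\<dots> = \<gamma> b" using k(1) gen_closed[OF assms(2)] by simp
  finally show "inv k \<otimes> \<gamma> b \<otimes> k \<in> \<langle>V - {a}\<rangle>" using assms(2,3) by (simp add: gen_special)
qed

text \<open>Cosets of special subgroups have the Helly property because the retractions act as gate maps.\<close>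

lemma special_Helly:
  assumes W: "finite W" "W \<subseteq> V" and d: "\<And>a. a \<in> W \<Longrightarrow> d a \<in> carrier G"
    and pw: "\<And>a b. a \<in> W \<Longrightarrow> b \<in> W \<Longrightarrow>
      \<exists>z\<in>carrier G. inv (d a) \<otimes> z \<in> \<langle>V - {a}\<rangle> \<and> inv (d b) \<otimes> z \<in> \<langle>V - {b}\<rangle>"
  shows "\<exists>z\<in>carrier G. \<forall>a\<in>W. inv (d a) \<otimes> z \<in> \<langle>V - {a}\<rangle>"
  using assms
proof (induction W)
  case empty
  then show ?case by auto
next
  case (insert b W)
  have sub: "subgroup \<langle>V - A\<rangle> G" for A by (rule special_subgroup) auto
  have b: "b \<in> V" "d b \<in> carrier G" using insert.prems by auto
  obtain z where z: "z \<in> carrier G" "\<And>a. a \<in> W \<Longrightarrow> inv (d a) \<otimes> z \<in> \<langle>V - {a}\<rangle>"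
    using insert.IH insert.prems by (metis insert_subset insertCI)
  \<comment> \<open>Within the coset of \<open>b\<close>, \<open>y\<close> moves towards
    \<open>z\<close>: its difference from \<open>z\<close> gives up the generators of
    \<open>W\<close> one at a time. For \<open>U = W\<close> it lies in all the cosets.\<close>
  have "\<exists>y\<in>carrier G. inv (d b) \<otimes> y \<in> \<langle>V - {b}\<rangle> \<and> inv z \<otimes> y \<in> \<langle>V - U\<rangle>" if "finite U" "U \<subseteq> W" for U
    using that
  proof (induction U)
    case empty
    then show ?case using b z(1) special_V subgroup.one_closed[OF sub] by (intro bexI[of _ "d b"]) auto
  next
    case (insert a U)
    then obtain y where y: "y \<in> carrier G" "inv (d b) \<otimes> y \<in> \<langle>V - {b}\<rangle>" "inv z \<otimes> y \<in> \<langle>V - U\<rangle>" by auto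
    have a: "a \<in> W" "d a \<in> carrier G" using insert.prems \<open>\<And>a. a \<in> Set.insert b W \<Longrightarrow> d a \<in> carrier G\<close> by auto
    obtain y' where y': "y' \<in> carrier G" "inv (d b) \<otimes> y' \<in> \<langle>V - {b}\<rangle>" "inv (d a) \<otimes> y' \<in> \<langle>V - {a}\<rangle>"
      using \<open>\<And>a b'. a \<in> Set.insert b W \<Longrightarrow> b' \<in> Set.insert b W \<Longrightarrow>
        \<exists>z\<in>carrier G. inv (d a) \<otimes> z \<in> \<langle>V - {a}\<rangle> \<and> inv (d b') \<otimes> z \<in> \<langle>V - {b'}\<rangle>\<close>[of b a] a(1) by auto
    \<comment> \<open>\<open>y'\<close> is a common element of the cosets of \<open>a\<close> and
      \<open>b\<close>. Multiplying \<open>y\<close> by the retract of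
      \<open>inv y \<otimes> y'\<close> stays in the coset of \<open>b\<close> and turns the
      difference from \<open>z\<close> into the retract of \<open>inv z \<otimes> y'\<close>, which
      omits \<open>U\<close> and \<open>a\<close>.\<close>
    obtain r where r: "r \<in> hom G G" "\<And>x. x \<in> \<langle>V - U\<rangle> \<Longrightarrow> r x = x"
      "\<And>B x. B \<subseteq> V \<Longrightarrow> x \<in> \<langle>B\<rangle> \<Longrightarrow> r x \<in> \<langle>(V - U) \<inter> B\<rangle>"
      using retraction[of "V - U"] by (metis Diff_subset)
    have "inv (inv (d a) \<otimes> z) \<otimes> (inv (d a) \<otimes> y') \<in> \<langle>V - {a}\<rangle>"
      by (intro subgroup.m_closed[OF sub] subgroup.m_inv_closed[OF sub] z(2) a(1) y'(3))
    then have u': "inv z \<otimes> y' \<in> \<langle>V - {a}\<rangle>"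
      using z(1) a(2) y'(1) by (simp add: inv_mult_group m_assoc)
    have "inv (inv (d b) \<otimes> y) \<otimes> (inv (d b) \<otimes> y') \<in> \<langle>V - {b}\<rangle>"
      by (intro subgroup.m_closed[OF sub] subgroup.m_inv_closed[OF sub] y(2) y'(2))
    then have q: "inv y \<otimes> y' \<in> \<langle>V - {b}\<rangle>"
      using b(2) y(1) y'(1) by (simp add: inv_mult_group m_assoc)
    then have rq: "r (inv y \<otimes> y') \<in> \<langle>V - {b}\<rangle>" "r (inv y \<otimes> y') \<in> carrier G"
      using r(3)[of "V - {b}"] special_mono[of "(V - U) \<inter> (V - {b})" "V - {b}"] special_carrier[of "V - {b}"]
      by auto
    have "inv z \<otimes> y' = (inv z \<otimes> y) \<otimes> (inv y \<otimes> y')"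
      using z(1) y(1) y'(1) by (simp add: m_assoc)
    then have "r (inv z \<otimes> y') = inv z \<otimes> y \<otimes> r (inv y \<otimes> y')"
      using hom_mult[OF r(1), of "inv z \<otimes> y" "inv y \<otimes> y'"] r(2)[OF y(3)] z(1) y(1) y'(1) by simp
    moreover have "r (inv z \<otimes> y') \<in> \<langle>(V - U) \<inter> (V - {a})\<rangle>" by (rule r(3)[OF _ u']) auto
    moreover have "(V - U) \<inter> (V - {a}) = V - Set.insert a U" by auto
    ultimately have "inv z \<otimes> (y \<otimes> r (inv y \<otimes> y')) \<in> \<langle>V - Set.insert a U\<rangle>"
      using z(1) y(1) rq(2) by (simp add: m_assoc)
    moreover have "inv (d b) \<otimes> (y \<otimes> r (inv y \<otimes> y')) \<in> \<langle>V - {b}\<rangle>"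
      using subgroup.m_closed[OF sub y(2) rq(1)] b(2) y(1) rq(2) by (simp add: m_assoc)
    ultimately show ?case using y(1) rq(2) by (intro bexI[of _ "y \<otimes> r (inv y \<otimes> y')"]) auto
  qed
  from this[of W] obtain y where y: "y \<in> carrier G" "inv (d b) \<otimes> y \<in> \<langle>V - {b}\<rangle>" "inv z \<otimes> y \<in> \<langle>V - W\<rangle>"
    using insert.hyps by auto
  have "inv (d a) \<otimes> y \<in> \<langle>V - {a}\<rangle>" if a: "a \<in> W" for a
  proof -
    have "inv z \<otimes> y \<in> \<langle>V - {a}\<rangle>" by (rule special_mono[OF _ y(3)]) (use a in auto)
    then have "(inv (d a) \<otimes> z) \<otimes> (inv z \<otimes> y) \<in> \<langle>V - {a}\<rangle>"
      by (rule subgroup.m_closed[OF sub z(2)[OF a]])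
    then show ?thesis using insert.prems(2) a z(1) y(1) by (simp add: m_assoc)
  qed
  then show ?case using y by blast
qed

lemma hom_eqI:
  assumes "h \<in> hom G K" "h' \<in> hom G K" "group K" "\<And>v. v \<in> V \<Longrightarrow> h (\<gamma> v) = h' (\<gamma> v)" "x \<in> carrier G"
  shows "h x = h' x"
  by (rule hom_eq_on_generate[OF assms(3,1,2) gens_subset[OF order_refl]])
     (use assms(4,5) generate_gens in auto)

text \<open>Distinct non-adjacent generators violate the exponent identity of commuting elements, as
  1 * 1 is not 0.\<close>

lemma commute_iff_adj:
  assumes "u \<in> V" "v \<in> V" "u \<noteq> v"
  shows "\<gamma> u \<otimes> \<gamma> v = \<gamma> v \<otimes> \<gamma> u \<longleftrightarrow> adj u v"
  using commuting_expo[of "\<gamma> u" "\<gamma> v" u v] gen_commute assms by (auto simp: gen_closed expo_gen)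

lemma inj_gen: "inj_on \<gamma> V"
proof (rule inj_onI)
  fix u v assume uv: "u \<in> V" "v \<in> V" "\<gamma> u = \<gamma> v"
  then have "expo u (\<gamma> v) = 1" using expo_gen[of u u] by simp
  then show "u = v" using expo_gen[OF uv(2), of u] by (auto split: if_splits)
qed

lemma autoD: "\<phi> \<in> auto G \<Longrightarrow> \<phi> \<in> hom G G" "\<phi> \<in> auto G \<Longrightarrow> bij_betw \<phi> (carrier G) (carrier G)"
  "\<phi> \<in> auto G \<Longrightarrow> \<phi> \<in> extensional (carrier G)"
  by (auto simp: auto_def Bij_def)

lemma auto_eqI:
  assumes "\<phi> \<in> auto G" "\<psi> \<in> auto G" "\<And>v. v \<in> V \<Longrightarrow> \<phi> (\<gamma> v) = \<psi> (\<gamma> v)"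
  shows "\<phi> = \<psi>"
proof (rule extensionalityI)
  show "\<phi> \<in> extensional (carrier G)" "\<psi> \<in> extensional (carrier G)" using assms by (auto simp: autoD)
  show "\<phi> x = \<psi> x" if "x \<in> carrier G" for x
    by (rule hom_eqI[OF autoD(1)[OF assms(1)] autoD(1)[OF assms(2)] is_group assms(3) that])
qed

lemma auto_inverse:
  assumes "\<phi> \<in> auto G"
  obtains \<psi> where "\<psi> \<in> auto G" "\<And>x. x \<in> carrier G \<Longrightarrow> \<psi> (\<phi> x) = x" "\<And>x. x \<in> carrier G \<Longrightarrow> \<phi> (\<psi> x) = x"
proof
  let ?\<psi> = "\<lambda>x\<in>carrier G. inv_into (carrier G) \<phi> x"
  have b: "\<phi> ` carrier G = carrier G" "inj_on \<phi> (carrier G)"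
    using autoD(2)[OF assms] by (auto simp: bij_betw_def)
  show "?\<psi> \<in> auto G"
    using restrict_inv_into_hom restrict_inv_into_Bij assms by (auto simp: auto_def)
  show "?\<psi> (\<phi> x) = x" if "x \<in> carrier G" for x
    using that b by auto
  show "\<phi> (?\<psi> x) = x" if "x \<in> carrier G" for x
    using that b f_inv_into_f[of x \<phi> "carrier G"] by auto
qed

section \<open>Signed graph automorphisms\<close>

text \<open>A sign as a truth value, \<open>True\<close> for inversion; signs then compose by
  exclusive or.\<close>

definition spow :: "bool \<Rightarrow> 'a \<Rightarrow> 'a" where
  "spow b x = (if b then inv x else x)"

definition graph_aut :: "('v \<Rightarrow> 'v) \<Rightarrow> bool" where
  "graph_aut \<pi> \<longleftrightarrow> bij_betw \<pi> V V \<and> (\<forall>u\<in>V. \<forall>v\<in>V. adj (\<pi> u) (\<pi> v) \<longleftrightarrow> adj u v)"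

lemma spow_closed [simp]: "x \<in> carrier G \<Longrightarrow> spow b x \<in> carrier G"
  by (simp add: spow_def)

lemma spow_False [simp]: "spow False x = x"
  by (simp add: spow_def)

lemma spow_spow: "x \<in> carrier G \<Longrightarrow> spow b (spow c x) = spow (b \<noteq> c) x"
  by (auto simp: spow_def)

lemma hom_spow: "h \<in> hom G G \<Longrightarrow> x \<in> carrier G \<Longrightarrow> h (spow b x) = spow b (h x)"
  using group_hom.hom_inv[of G G h x] by (simp add: spow_def group_hom_def group_hom_axioms_def is_group)

lemma spow_commute:
  assumes "x \<in> carrier G" "y \<in> carrier G" "x \<otimes> y = y \<otimes> x"
  shows "spow b x \<otimes> spow c y = spow c y \<otimes> spow b x"
  using int_pow_commute[OF assms, of "if b then -1 else 1" "if c then -1 else 1"] assms(1,2)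
  by (simp add: spow_def int_pow_neg split: if_splits)

lemma graph_aut_inv: "graph_aut \<pi> \<Longrightarrow> graph_aut (inv_into V \<pi>)"
  unfolding graph_aut_def
proof (elim conjE, intro conjI ballI)
  assume b: "bij_betw \<pi> V V" and a: "\<forall>u\<in>V. \<forall>v\<in>V. adj (\<pi> u) (\<pi> v) \<longleftrightarrow> adj u v"
  show "bij_betw (inv_into V \<pi>) V V" by (rule bij_betw_inv_into[OF b])
  fix u v assume "u \<in> V" "v \<in> V"
  then show "adj (inv_into V \<pi> u) (inv_into V \<pi> v) \<longleftrightarrow> adj u v"
    using a b bij_betw_inv_into_right[OF b] bij_betw_apply[OF bij_betw_inv_into[OF b]] by metis
qed

lemma signed_hom:
  assumes "graph_aut \<pi>"
  obtains h where "h \<in> hom G G" "\<And>v. v \<in> V \<Longrightarrow> h (\<gamma> v) = spow (v \<in> E) (\<gamma> (\<pi> v))"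
proof -
  have p: "\<pi> v \<in> V" if "v \<in> V" for v using assms that by (auto simp: graph_aut_def bij_betw_def)
  show thesis
  proof (rule hom_extension[OF is_group, where f="\<lambda>v. spow (v \<in> E) (\<gamma> (\<pi> v))"])
    show "spow (u \<in> E) (\<gamma> (\<pi> u)) \<otimes> spow (v \<in> E) (\<gamma> (\<pi> v)) = spow (v \<in> E) (\<gamma> (\<pi> v)) \<otimes> spow (u \<in> E) (\<gamma> (\<pi> u))"
      if "u \<in> V" "v \<in> V" "adj u v" for u v
      using that assms p by (intro spow_commute gen_commute gen_closed) (auto simp: graph_aut_def)
  qed (use that p gen_closed in auto)
qed

text \<open>The inverse is the signed homomorphism of the inverse vertex map, with the set of
  inverted vertices carried along by \<pi>.\<close>

lemma signed_auto:
  assumes \<pi>: "graph_aut \<pi>"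
  shows "\<exists>\<omega>\<in>auto G. \<forall>v\<in>V. \<omega> (\<gamma> v) = spow (v \<in> E) (\<gamma> (\<pi> v))"
proof -
  let ?\<rho> = "inv_into V \<pi>"
  have b: "bij_betw \<pi> V V" "bij_betw ?\<rho> V V" using \<pi> graph_aut_inv by (auto simp: graph_aut_def)
  have V: "\<pi> v \<in> V" "?\<rho> v \<in> V" "\<pi> (?\<rho> v) = v" "?\<rho> (\<pi> v) = v" if "v \<in> V" for v
    using that b bij_betw_apply bij_betw_inv_into_right[OF b(1)] bij_betw_inv_into_left[OF b(1)] by metis+
  obtain h where h: "h \<in> hom G G" "\<And>v. v \<in> V \<Longrightarrow> h (\<gamma> v) = spow (v \<in> E) (\<gamma> (\<pi> v))"
    using signed_hom[OF \<pi>] by metis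
  obtain k where k: "k \<in> hom G G" "\<And>v. v \<in> V \<Longrightarrow> k (\<gamma> v) = spow (v \<in> \<pi> ` (V \<inter> E)) (\<gamma> (?\<rho> v))"
    using signed_hom[OF graph_aut_inv[OF \<pi>]] by metis
  have E: "\<pi> v \<in> \<pi> ` (V \<inter> E) \<longleftrightarrow> v \<in> E" if "v \<in> V" for v
    using that b(1) by (auto simp: bij_betw_def inj_on_eq_iff)
  have E': "?\<rho> v \<in> E \<longleftrightarrow> v \<in> \<pi> ` (V \<inter> E)" if "v \<in> V" for v
    using E[OF V(2)[OF that]] V(3)[OF that] by simp
  have id: "(\<lambda>x. x) \<in> hom G G" by (simp add: hom_def)
  have "(k \<circ> h) x = x" if "x \<in> carrier G" for x
    by (rule hom_eqI[OF Group.hom_compose[OF h(1) k(1)] id is_group _ that])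
       (use h k V E hom_spow[OF k(1)] gen_closed in \<open>simp add: spow_spow\<close>)
  moreover have "(h \<circ> k) x = x" if "x \<in> carrier G" for x
    by (rule hom_eqI[OF Group.hom_compose[OF k(1) h(1)] id is_group _ that])
       (use h k V E' hom_spow[OF h(1)] gen_closed in \<open>simp add: spow_spow\<close>)
  moreover have "h x \<in> carrier G" "k x \<in> carrier G" if "x \<in> carrier G" for x
    using that h(1) k(1) by (auto simp: hom_def)
  ultimately have "bij_betw h (carrier G) (carrier G)"
    by (intro bij_betw_byWitness[where f'=k]) auto
  then have "bij_betw (restrict h (carrier G)) (carrier G) (carrier G)" by (simp cong: bij_betw_cong)
  moreover have "restrict h (carrier G) \<in> hom G G" using h(1) by (auto simp: hom_def)
  ultimately have "restrict h (carrier G) \<in> auto G" by (simp add: auto_def Bij_def)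
  then show ?thesis using h(2) gen_closed by (intro bexI[of _ "restrict h (carrier G)"]) auto
qed

definition signed :: "('v \<Rightarrow> 'v) \<Rightarrow> 'v set \<Rightarrow> 'a \<Rightarrow> 'a" where
  "signed \<pi> E = (SOME \<omega>. \<omega> \<in> auto G \<and> (\<forall>v\<in>V. \<omega> (\<gamma> v) = spow (v \<in> E) (\<gamma> (\<pi> v))))"

lemma signed_spec:
  assumes "graph_aut \<pi>"
  shows "signed \<pi> E \<in> auto G \<and> (\<forall>v\<in>V. signed \<pi> E (\<gamma> v) = spow (v \<in> E) (\<gamma> (\<pi> v)))"
proof -
  have "\<exists>\<omega>. \<omega> \<in> auto G \<and> (\<forall>v\<in>V. \<omega> (\<gamma> v) = spow (v \<in> E) (\<gamma> (\<pi> v)))"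
    using signed_auto[OF assms] by blast
  then show ?thesis unfolding signed_def by (rule someI_ex)
qed

lemma signed_auto_mem: "graph_aut \<pi> \<Longrightarrow> signed \<pi> E \<in> auto G" and
  signed_gen: "graph_aut \<pi> \<Longrightarrow> v \<in> V \<Longrightarrow> signed \<pi> E (\<gamma> v) = spow (v \<in> E) (\<gamma> (\<pi> v))"
  using signed_spec by auto

lemma expo_spow: "x \<in> carrier G \<Longrightarrow> expo t (spow b x) = (if b then - expo t x else expo t x)"
  by (simp add: spow_def)

lemma realize_expo:
  assumes "finite A" "A \<subseteq> V"
  shows "\<exists>x\<in>\<langle>A\<rangle>. \<forall>u\<in>A. expo u x = f u"
  using assms
proof (induction A)
  case (insert v A)
  then obtain x where x: "x \<in> \<langle>A\<rangle>" "\<And>u. u \<in> A \<Longrightarrow> expo u x = f u" by auto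
  have v: "v \<in> V" "\<gamma> v \<in> carrier G" using insert.prems gen_closed by auto
  have xG: "x \<in> carrier G" using special_carrier[OF _ x(1)] insert.prems by simp
  have "expo v x = 0" using expo_special[OF _ insert.hyps(2) x(1)] insert.prems by simp
  then have "\<forall>u\<in>Set.insert v A. expo u (x \<otimes> \<gamma> v [^] f v) = f u"
    using x(2) xG v insert.hyps(2) by (auto simp: expo_gen)
  moreover have sub: "subgroup \<langle>Set.insert v A\<rangle> G" by (rule special_subgroup[OF insert.prems])
  have "x \<otimes> \<gamma> v [^] f v \<in> \<langle>Set.insert v A\<rangle>"
    by (intro subgroup.m_closed[OF sub] subgroup_int_pow_closed[OF sub] special_mono[OF _ x(1)] gen_special)
       auto
  ultimately show ?case by blast
qed (auto intro: generate.one)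

end

section \<open>Automorphisms under the rigidity conditions\<close>

lemma (in group) conj_commute:
  assumes "y \<in> carrier G" "a \<in> carrier G" "b \<in> carrier G" "a \<otimes> b = b \<otimes> a"
  shows "(inv y \<otimes> a \<otimes> y) \<otimes> (inv y \<otimes> b \<otimes> y) = (inv y \<otimes> b \<otimes> y) \<otimes> (inv y \<otimes> a \<otimes> y)"
  using hom_mult[OF conj_hom[OF assms(1)] assms(2,3)] hom_mult[OF conj_hom[OF assms(1)] assms(3,2)] assms(4)
  by simp

lemma (in group) conj_solve:
  "z \<in> carrier G \<Longrightarrow> x \<in> carrier G \<Longrightarrow> inv z \<otimes> x \<otimes> z = y \<Longrightarrow> x = z \<otimes> y \<otimes> inv z"
  by (auto simp: m_assoc)

text \<open>\<open>link_card\<close> makes the action on the abelianization a signed permutation,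
  ruling out transvections; \<open>link_separates\<close> recovers a vertex from its link;
  \<open>non_star_connected\<close> rules out partial conjugations; \<open>star_escape\<close> gives
  each neighbor of \<open>a\<close> a neighbor outside the star of \<open>a\<close>, which controls
  its image; \<open>stars_avoid\<close> makes cosets meet and the center trivial.\<close>

locale rigid_raag = raag +
  assumes link_separates: "v \<in> V \<Longrightarrow> w \<in> V \<Longrightarrow> v \<noteq> w \<Longrightarrow> \<exists>u\<in>V. adj v u \<and> \<not> adj w u"
    and non_star_connected: "a \<in> V \<Longrightarrow> b \<in> V - {a} \<Longrightarrow> c \<in> V - {a} \<Longrightarrow> \<not> adj a b \<Longrightarrow> \<not> adj a c \<Longrightarrow>
      (b, c) \<in> {(x, y). x \<in> V - {a} \<and> y \<in> V - {a} \<and> \<not> adj a x \<and> \<not> adj a y \<and> adj x y}\<^sup>*"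
    and star_escape: "a \<in> V \<Longrightarrow> u \<in> V \<Longrightarrow> adj a u \<Longrightarrow> \<exists>w\<in>V - {a}. \<not> adj a w \<and> adj u w"
    and stars_avoid: "a \<in> V \<Longrightarrow> b \<in> V \<Longrightarrow> \<exists>c\<in>V - {a, b}. \<not> adj a c \<and> \<not> adj b c"
    and link_card: "s \<in> V \<Longrightarrow> t \<in> V \<Longrightarrow> s \<noteq> t \<Longrightarrow> v \<in> V \<Longrightarrow>
      card {u \<in> V. adj s u \<and> adj t u} + 1 < card {u \<in> V. adj v u}"
begin

lemma expo_iso_sum:
  assumes \<psi>: "\<psi> \<in> hom G G" and x: "x \<in> carrier G"
  shows "expo u (\<psi> x) = (\<Sum>t\<in>V. expo t x * expo u (\<psi> (\<gamma> t)))"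
proof -
  have "(expo u \<circ> \<psi>) \<in> hom G integer_group"
    by (rule Group.hom_compose[OF \<psi> expo_hom])
  from hom_integer_expo[OF this x] show ?thesis by simp
qed

text \<open>The centralizer of \<open>\<phi> (\<gamma> v)\<close> surjects modulo \<open>p\<close> onto a space of dimension
  \<open>1 + card (link v)\<close>. Two non-zero exponents of \<open>\<phi> (\<gamma> v)\<close>, at \<open>s\<close> and \<open>t\<close>, would cut this
  dimension down to \<open>2 + card (link s \<inter> link t)\<close>.\<close>

lemma expo_auto_single:
  assumes \<phi>: "\<phi> \<in> hom G G" and \<psi>: "\<psi> \<in> hom G G" "\<And>x. x \<in> carrier G \<Longrightarrow> \<psi> (\<phi> x) = x"
    and v: "v \<in> V" and st: "s \<in> V" "t \<in> V" "s \<noteq> t"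
  shows "expo s (\<phi> (\<gamma> v)) = 0 \<or> expo t (\<phi> (\<gamma> v)) = 0"
proof (rule ccontr)
  let ?g = "\<phi> (\<gamma> v)"
  assume "\<not> (expo s ?g = 0 \<or> expo t ?g = 0)"
  then have nz: "expo s ?g \<noteq> 0" "expo t ?g \<noteq> 0" by auto
  have \<phi>G: "\<phi> x \<in> carrier G" if "x \<in> carrier G" for x using that \<phi> by (auto simp: hom_def)
  \<comment> \<open>A prime above both absolute values divides neither of the two nonzero
    exponents.\<close>
  obtain p :: nat where p: "prime p" "p > nat (\<bar>expo s ?g\<bar> + \<bar>expo t ?g\<bar>)" using bigger_prime by blast
  have nd: "\<not> int p dvd expo s ?g" "\<not> int p dvd expo t ?g"
    using nz p(2) dvd_imp_le_int[of "expo s ?g" "int p"] dvd_imp_le_int[of "expo t ?g" "int p"] by auto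
  have pr: "prime (int p)" using p(1) by simp
  \<comment> \<open>\<open>\<langle>?A\<rangle>\<close> centralizes \<open>\<gamma> v\<close> and
    realizes arbitrary exponents on \<open>?A\<close>; modulo \<open>p\<close>, the exponents of the
    images turn out to be determined by those on \<open>?D\<close>.\<close>
  let ?A = "Set.insert v {u \<in> V. adj v u}"
  let ?D = "Set.insert s (Set.insert t {u \<in> V. adj s u \<and> adj t u})"
  have A: "finite ?A" "?A \<subseteq> V" "finite ?D" "?D \<subseteq> V" using finite_V v st by auto
  have "\<exists>x. x \<in> \<langle>?A\<rangle> \<and> (\<forall>u\<in>?A. expo u x = f u)" for f
    using realize_expo[OF A(1,2), of f] by blast
  then obtain X where X: "\<And>f. X f \<in> \<langle>?A\<rangle>" "\<And>f u. u \<in> ?A \<Longrightarrow> expo u (X f) = f u" by metis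
  have XG: "X f \<in> carrier G" for f by (rule special_carrier[OF A(2) X(1)])
  have comm: "\<phi> (X f) \<otimes> ?g = ?g \<otimes> \<phi> (X f)" for f
  proof -
    have "\<langle>?A\<rangle> \<subseteq> {x \<in> carrier G. x \<otimes> \<gamma> v = \<gamma> v \<otimes> x}"
      by (rule generate_subgroup_incl[OF _ centralizer_subgroup])
         (use v gen_closed gen_commute adj_sym in auto)
    then have "X f \<otimes> \<gamma> v = \<gamma> v \<otimes> X f" using X(1) by blast
    then show ?thesis using hom_mult[OF \<phi>] XG gen_closed[OF v] by metis
  qed
  \<comment> \<open>As \<open>\<phi> (X f)\<close> commutes with \<open>?g\<close>, its exponents at
    \<open>s'\<close> and at a vertex \<open>c\<close> not adjacent to \<open>s'\<close> are
    proportional to those of \<open>?g\<close>. Modulo \<open>p\<close> the exponent of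
    \<open>?g\<close> at \<open>s'\<close> is invertible, so the one at \<open>s'\<close> determines
    the one at \<open>c\<close>.\<close>
  have key: "int p dvd expo c (\<phi> (X f)) - expo c (\<phi> (X f'))"
    if "s' \<in> V" "\<not> int p dvd expo s' ?g" "int p dvd expo s' (\<phi> (X f)) - expo s' (\<phi> (X f'))"
      and "c \<in> V" "\<not> adj s' c" for s' c f f'
  proof (cases "c = s'")
    case False
    have rel: "expo s' (\<phi> (X h)) * expo c ?g = expo c (\<phi> (X h)) * expo s' ?g" for h
      using commuting_expo[OF \<phi>G[OF XG] \<phi>G[OF gen_closed[OF v]] comm that(1,4,5)] False by blast
    have "(expo c (\<phi> (X f)) - expo c (\<phi> (X f'))) * expo s' ?g
        = (expo s' (\<phi> (X f)) - expo s' (\<phi> (X f'))) * expo c ?g"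
      using rel[of f] rel[of f'] by (simp add: left_diff_distrib)
    then have "int p dvd (expo c (\<phi> (X f)) - expo c (\<phi> (X f'))) * expo s' ?g"
      using that(3) by simp
    then show ?thesis using prime_dvd_mult_iff[OF pr] that(2) by blast
  qed (use that in auto)
  let ?F = "\<lambda>f. \<lambda>c\<in>?D. expo c (\<phi> (X f)) mod int p"
  let ?P = "?A \<rightarrow>\<^sub>E {0..<int p}"
  have "inj_on ?F ?P"
  proof (rule inj_onI)
    fix f f' assume f: "f \<in> ?P" "f' \<in> ?P" and eq: "?F f = ?F f'"
    have D: "int p dvd expo c (\<phi> (X f)) - expo c (\<phi> (X f'))" if "c \<in> ?D" for c
      using fun_cong[OF eq, of c] that by (simp add: mod_eq_dvd_iff split: if_splits)
    \<comment> \<open>A vertex outside \<open>?D\<close> fails to be adjacent to \<open>s\<close> or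
      to \<open>t\<close>, and its residue follows from the residue there.\<close>
    have all: "int p dvd expo c (\<phi> (X f)) - expo c (\<phi> (X f'))" if "c \<in> V" for c
      using D[of c] D[of s] D[of t] key[OF st(1) nd(1) _ that] key[OF st(2) nd(2) _ that] that by blast
    show "f = f'"
    proof (rule PiE_ext[OF f])
      fix u assume u: "u \<in> ?A"
      \<comment> \<open>The left inverse \<psi> recovers the exponents of \<open>X f\<close>, that
        is \<open>f\<close>, linearly from those of its image.\<close>
      have "expo u (X h) = (\<Sum>c\<in>V. expo c (\<phi> (X h)) * expo u (\<psi> (\<gamma> c)))" for h
        using expo_iso_sum[OF \<psi>(1) \<phi>G[OF XG], of u h] \<psi>(2)[OF XG] by simp
      then have "expo u (X f) - expo u (X f')
          = (\<Sum>c\<in>V. (expo c (\<phi> (X f)) - expo c (\<phi> (X f'))) * expo u (\<psi> (\<gamma> c)))"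
        by (simp add: sum_subtractf left_diff_distrib)
      also have "int p dvd \<dots>" using all by (intro dvd_sum) simp
      finally have "f u mod int p = f' u mod int p" using X(2)[OF u] by (simp add: mod_eq_dvd_iff)
      moreover have "f u \<in> {0..<int p}" "f' u \<in> {0..<int p}" using f u by (auto simp: PiE_iff)
      ultimately show "f u = f' u" by simp
    qed
  qed
  moreover have "?F ` ?P \<subseteq> ?D \<rightarrow>\<^sub>E {0..<int p}" using prime_gt_0_nat[OF p(1)]
    by (intro image_subsetI) (simp only: restrict_PiE_iff, simp)
  moreover have "finite (?D \<rightarrow>\<^sub>E {0..<int p})" using A by (intro finite_PiE) auto
  ultimately have "card ?P \<le> card (?D \<rightarrow>\<^sub>E {0..<int p})" by (rule card_inj_on_le)
  then have "p ^ card ?A \<le> p ^ card ?D" using A by (simp add: card_PiE)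
  then have "card ?A \<le> card ?D" using prime_gt_1_nat[OF p(1)] by simp
  moreover have "card ?A = Suc (card {u \<in> V. adj v u})"
    using finite_V adj_irrefl[OF v] by (intro card_insert_disjoint) auto
  moreover have "card ?D \<le> card {u \<in> V. adj s u \<and> adj t u} + 2"
    using finite_V by (simp add: card_insert_if)
  ultimately show False using link_card[OF st v] by simp
qed

text \<open>As \<psi> undoes \<phi>, the exponent 1 of \<open>v\<close> in \<open>\<gamma> v\<close>
  is a sum with a single nonzero term, a product of two integers. The last conjunct serves to show
  that the vertex maps of \<phi> and \<psi> are inverse to each other.\<close>

lemma expo_auto:
  assumes \<phi>: "\<phi> \<in> hom G G" and \<psi>: "\<psi> \<in> hom G G" "\<And>x. x \<in> carrier G \<Longrightarrow> \<psi> (\<phi> x) = x"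
    and v: "v \<in> V"
  shows "\<exists>s\<in>V. (expo s (\<phi> (\<gamma> v)) = 1 \<or> expo s (\<phi> (\<gamma> v)) = -1) \<and>
    (\<forall>t\<in>V. t \<noteq> s \<longrightarrow> expo t (\<phi> (\<gamma> v)) = 0) \<and> expo v (\<psi> (\<gamma> s)) \<noteq> 0"
proof -
  let ?g = "\<phi> (\<gamma> v)"
  have g: "?g \<in> carrier G" using \<phi> gen_closed[OF v] by (auto simp: hom_def)
  have sum: "1 = (\<Sum>t\<in>V. expo t ?g * expo v (\<psi> (\<gamma> t)))"
    using expo_iso_sum[OF \<psi>(1) g, of v] \<psi>(2)[OF gen_closed[OF v]] v by (simp add: expo_gen)
  have "\<exists>s\<in>V. expo s ?g \<noteq> 0"
  proof (rule ccontr)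
    assume "\<not> (\<exists>s\<in>V. expo s ?g \<noteq> 0)"
    then have "(\<Sum>t\<in>V. expo t ?g * expo v (\<psi> (\<gamma> t))) = 0" by (intro sum.neutral) auto
    then show False using sum by simp
  qed
  then obtain s where s: "s \<in> V" "expo s ?g \<noteq> 0" by auto
  have z: "expo t ?g = 0" if "t \<in> V" "t \<noteq> s" for t
    using expo_auto_single[OF \<phi> \<psi> v s(1) that(1)] that s(2) by auto
  have "1 = (\<Sum>t\<in>V. if t = s then expo s ?g * expo v (\<psi> (\<gamma> s)) else 0)"
    unfolding sum by (rule sum.cong) (use z in auto)
  then have "expo s ?g * expo v (\<psi> (\<gamma> s)) = 1" using s(1) finite_V by simp
  then have "(expo s ?g = 1 \<or> expo s ?g = -1) \<and> expo v (\<psi> (\<gamma> s)) \<noteq> 0"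
    by (metis mult_zero_right zero_neq_one zmult_eq_1_iff)
  then show ?thesis using s(1) z by blast
qed

text \<open>Adjacency is read off from commutation: images of adjacent generators commute, and if
  their vertices were not adjacent, \<open>commuting_expo\<close> would make a product of two units
  vanish. The inverse automorphism gives the converse.\<close>

lemma auto_graph_aut:
  assumes "\<phi> \<in> auto G"
  obtains \<pi> E where "graph_aut \<pi>"
    "\<And>v t. v \<in> V \<Longrightarrow> t \<in> V \<Longrightarrow> expo t (\<phi> (\<gamma> v)) = (if t = \<pi> v then if v \<in> E then -1 else 1 else 0)"
proof -
  obtain \<psi> where \<psi>: "\<psi> \<in> auto G" "\<And>x. x \<in> carrier G \<Longrightarrow> \<psi> (\<phi> x) = x" "\<And>x. x \<in> carrier G \<Longrightarrow> \<phi> (\<psi> x) = x"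
    using auto_inverse[OF assms] by metis
  note \<phi>h = autoD(1)[OF assms] and \<psi>h = autoD(1)[OF \<psi>(1)]
  obtain \<pi> where \<pi>: "\<And>v. v \<in> V \<Longrightarrow> \<pi> v \<in> V"
     "\<And>v. v \<in> V \<Longrightarrow> expo (\<pi> v) (\<phi> (\<gamma> v)) = 1 \<or> expo (\<pi> v) (\<phi> (\<gamma> v)) = -1"
     "\<And>v t. v \<in> V \<Longrightarrow> t \<in> V \<Longrightarrow> t \<noteq> \<pi> v \<Longrightarrow> expo t (\<phi> (\<gamma> v)) = 0"
     "\<And>v. v \<in> V \<Longrightarrow> expo v (\<psi> (\<gamma> (\<pi> v))) \<noteq> 0"
    using expo_auto[OF \<phi>h \<psi>h \<psi>(2)] by metis
  obtain \<rho> where \<rho>: "\<And>v. v \<in> V \<Longrightarrow> \<rho> v \<in> V"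
     "\<And>v. v \<in> V \<Longrightarrow> expo (\<rho> v) (\<psi> (\<gamma> v)) = 1 \<or> expo (\<rho> v) (\<psi> (\<gamma> v)) = -1"
     "\<And>v t. v \<in> V \<Longrightarrow> t \<in> V \<Longrightarrow> t \<noteq> \<rho> v \<Longrightarrow> expo t (\<psi> (\<gamma> v)) = 0"
     "\<And>v. v \<in> V \<Longrightarrow> expo v (\<phi> (\<gamma> (\<rho> v))) \<noteq> 0"
    using expo_auto[OF \<psi>h \<phi>h \<psi>(3)] by metis
  \<comment> \<open>\<open>\<psi> (\<gamma> (\<pi> v))\<close> has a nonzero exponent at
    \<open>v\<close>, while \<open>\<rho> (\<pi> v)\<close> is the only vertex where it can have
    one.\<close>
  have inv: "\<rho> (\<pi> v) = v" "\<pi> (\<rho> v) = v" if "v \<in> V" for v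
    using \<pi>(1,4)[OF that] \<rho>(3)[of "\<pi> v" v] \<rho>(1,4)[OF that] \<pi>(3)[of "\<rho> v" v] that by metis+
  have adj_pres: "adj (\<sigma> u) (\<sigma> v)"
    if h: "h \<in> hom G G" and \<sigma>: "\<And>v. v \<in> V \<Longrightarrow> \<sigma> v \<in> V" "inj_on \<sigma> V"
       "\<And>v. v \<in> V \<Longrightarrow> expo (\<sigma> v) (h (\<gamma> v)) = 1 \<or> expo (\<sigma> v) (h (\<gamma> v)) = -1"
       "\<And>v t. v \<in> V \<Longrightarrow> t \<in> V \<Longrightarrow> t \<noteq> \<sigma> v \<Longrightarrow> expo t (h (\<gamma> v)) = 0"
      and uv: "u \<in> V" "v \<in> V" "adj u v" for h \<sigma> u v
  proof (rule ccontr)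
    assume n: "\<not> adj (\<sigma> u) (\<sigma> v)"
    have "u \<noteq> v" using uv adj_irrefl by auto
    then have ne: "\<sigma> u \<noteq> \<sigma> v" using \<sigma>(2) uv by (auto simp: inj_on_def)
    have hG: "h (\<gamma> u) \<in> carrier G" "h (\<gamma> v) \<in> carrier G" using h gen_closed uv by (auto simp: hom_def)
    have "h (\<gamma> u) \<otimes> h (\<gamma> v) = h (\<gamma> v) \<otimes> h (\<gamma> u)"
      using hom_mult[OF h] gen_commute[OF uv] gen_closed uv by metis
    from commuting_expo[OF hG this \<sigma>(1)[OF uv(1)] \<sigma>(1)[OF uv(2)] n ne]
    have "expo (\<sigma> u) (h (\<gamma> u)) * expo (\<sigma> v) (h (\<gamma> v)) = 0"
      using \<sigma>(4)[OF uv(1) \<sigma>(1)[OF uv(2)]] ne by simp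
    then show False using \<sigma>(3)[OF uv(1)] \<sigma>(3)[OF uv(2)] by auto
  qed
  have inj: "inj_on \<pi> V" "inj_on \<rho> V" using inv by (metis inj_onI)+
  have "adj (\<pi> u) (\<pi> v) \<longleftrightarrow> adj u v" if uv: "u \<in> V" "v \<in> V" for u v
    using adj_pres[OF \<phi>h \<pi>(1) inj(1) \<pi>(2,3) uv] adj_pres[OF \<psi>h \<rho>(1) inj(2) \<rho>(2,3) \<pi>(1)[OF uv(1)] \<pi>(1)[OF uv(2)]]
      inv(1)[OF uv(1)] inv(1)[OF uv(2)] by auto
  moreover have "bij_betw \<pi> V V" by (rule bij_betw_byWitness[where f'=\<rho>]) (use inv \<pi>(1) \<rho>(1) in auto)
  ultimately have "graph_aut \<pi>" by (simp add: graph_aut_def)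
  then show thesis
    using that[of \<pi> "{v. expo (\<pi> v) (\<phi> (\<gamma> v)) = -1}"] \<pi>(2,3) by fastforce
qed

text \<open>For each neighbor \<open>u\<close> of \<open>v\<close>, commuting with
  \<open>\<phi> (\<gamma> u)\<close> makes the image elliptic in the tree of \<open>u\<close>, so
  some conjugate omits all neighbors of \<open>v\<close>. That conjugate fixes two vertices in each
  of these trees and is therefore conjugate into the link of \<open>u\<close>. Since links separate
  vertices only \<open>v\<close> survives, and the exponent fixes the power.\<close>

lemma trivial_expo_conj:
  assumes \<phi>: "\<phi> \<in> hom G G"
    and e: "\<And>v t. v \<in> V \<Longrightarrow> t \<in> V \<Longrightarrow> expo t (\<phi> (\<gamma> v)) = (if t = v then 1 else 0)"
    and v: "v \<in> V"
  shows "\<exists>y\<in>carrier G. \<phi> (\<gamma> v) = y \<otimes> \<gamma> v \<otimes> inv y"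
proof -
  let ?g = "\<phi> (\<gamma> v)"
  have G: "\<phi> (\<gamma> u) \<in> carrier G" if "u \<in> V" for u using \<phi> gen_closed[OF that] by (auto simp: hom_def)
  have comm: "\<phi> (\<gamma> u) \<otimes> ?g = ?g \<otimes> \<phi> (\<gamma> u)" if "u \<in> V" "adj v u" for u
    using hom_mult[OF \<phi>] gen_commute[OF v that] gen_closed v that by metis
  let ?L = "{u \<in> V. adj v u}"
  have vL: "v \<noteq> u" if "u \<in> ?L" for u using that adj_irrefl v by auto
  have "conj_into ?g (V - {u})" if u: "u \<in> ?L" for u
    using conj_into_of_commuting[of u "\<phi> (\<gamma> u)" ?g] u comm[of u] e[of u u] e[of v u] G v vL[OF u] by simp
  then have "conj_into ?g (V - ?L)" using conj_into_Diff[of ?L ?g] finite_V G[OF v] by simp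
  then obtain y where y: "y \<in> carrier G" "inv y \<otimes> ?g \<otimes> y \<in> \<langle>V - ?L\<rangle>" by (auto simp: conj_into_def)
  let ?h = "inv y \<otimes> ?g \<otimes> y"
  have hG: "?h \<in> carrier G" using y(1) G[OF v] by simp
  have lk: "conj_into ?h {w \<in> V. adj u w}" if u: "u \<in> ?L" for u
  proof -
    interpret T: raag_letter G V adj \<gamma> u by (rule raag_letterI) (use u in auto)
    let ?x = "inv y \<otimes> \<phi> (\<gamma> u) \<otimes> y"
    have uV: "u \<in> V" and x: "?x \<in> carrier G" using u y(1) G by auto
    have "expo u ?x = 1" using e[OF uV uV] y(1) G[OF uV] by simp
    \<comment> \<open>With exponent 1 at \<open>u\<close>, \<open>?x\<close> moves the base vertex
      of the tree of \<open>u\<close>. As \<open>?h\<close> fixes the base vertex and commutes with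
      \<open>?x\<close>, it fixes the image too.\<close>
    then have nx: "?x \<notin> \<langle>V - {u}\<rangle>" using expo_special[of "V - {u}" u ?x] by auto
    have hu: "?h \<in> \<langle>V - {u}\<rangle>" by (rule special_mono[OF _ y(2)]) (use u in auto)
    have "?h \<otimes> ?x = ?x \<otimes> ?h"
      using conj_commute[OF y(1) G[OF v] G[OF uV]] comm[of u] u by simp
    then have "inv ?x \<otimes> ?h \<otimes> ?x = inv ?x \<otimes> (?x \<otimes> ?h)" using x hG by (simp only: m_assoc inv_closed)
    then have "inv ?x \<otimes> ?h \<otimes> ?x = ?h" using x hG by (simp only: inv_mult_cancel)
    then have "\<exists>z\<in>\<langle>V - {u}\<rangle>. inv z \<otimes> ?h \<otimes> z \<in> \<langle>{w \<in> V. adj u w}\<rangle>"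
      using T.two_fixed_points[OF hu x nx] hu by simp
    then show ?thesis using special_carrier[of "V - {u}"] by (auto simp: conj_into_def)
  qed
  have "conj_into ?h (V - {w})" if w: "w \<in> V - {v}" for w
  proof -
    obtain u where u: "u \<in> V" "adj v u" "\<not> adj w u" using link_separates[OF v, of w] w by auto
    have "{w' \<in> V. adj u w'} \<subseteq> V - {w}" using u(3) adj_sym by auto
    then show ?thesis using lk[of u] u conj_into_mono by blast
  qed
  then have "conj_into ?h (V - (V - {v}))" using conj_into_Diff[OF _ hG, of "V - {v}"] finite_V by simp
  moreover have "V - (V - {v}) = {v}" using v by auto
  ultimately have "conj_into ?g {v}" using conj_into_conj[OF G[OF v] y(1)] by simp
  then obtain z where z: "z \<in> carrier G" "inv z \<otimes> ?g \<otimes> z \<in> \<langle>{v}\<rangle>" by (auto simp: conj_into_def)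
  have "expo v (inv z \<otimes> ?g \<otimes> z) = 1" using z(1) G[OF v] e[OF v v] by simp
  then have "inv z \<otimes> ?g \<otimes> z = \<gamma> v" by (rule special_singleton[OF v z(2)])
  then have "?g = z \<otimes> \<gamma> v \<otimes> inv z" by (rule conj_solve[OF z(1) G[OF v]])
  then show ?thesis using z(1) by blast
qed

text \<open>The conjugators \<open>c v\<close> are determined only up to centralizers. For
  \<open>v\<close> outside the star of \<open>a\<close>, the cosets of
  \<open>\<langle>V - {a}\<rangle>\<close> absorb this ambiguity, which is why the conjugators are
  compared for one \<open>a\<close> at a time.\<close>

lemma trivial_expo_inner:
  assumes \<phi>: "\<phi> \<in> hom G G"
    and e: "\<And>v t. v \<in> V \<Longrightarrow> t \<in> V \<Longrightarrow> expo t (\<phi> (\<gamma> v)) = (if t = v then 1 else 0)"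
  shows "\<exists>g\<in>carrier G. \<forall>v\<in>V. \<phi> (\<gamma> v) = g \<otimes> \<gamma> v \<otimes> inv g"
proof -
  obtain c where c: "\<And>v. v \<in> V \<Longrightarrow> c v \<in> carrier G" "\<And>v. v \<in> V \<Longrightarrow> \<phi> (\<gamma> v) = c v \<otimes> \<gamma> v \<otimes> inv (c v)"
    using trivial_expo_conj[OF \<phi> e] by metis
  have G: "\<phi> (\<gamma> u) \<in> carrier G" if "u \<in> V" for u using \<phi> gen_closed[OF that] by (auto simp: hom_def)
  have sub: "subgroup \<langle>V - A\<rangle> G" for A by (rule special_subgroup) auto
  define N where "N a = {b \<in> V - {a}. \<not> adj a b}" for a
  \<comment> \<open>After conjugation by \<open>c b\<close>, the image of a neighbor of
    \<open>b\<close> commutes with \<open>\<gamma> b\<close>, so it can be written without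
    \<open>a\<close>.\<close>
  have cent: "inv (c b) \<otimes> \<phi> (\<gamma> u) \<otimes> c b \<in> \<langle>V - {a}\<rangle>"
    if a: "a \<in> V" and b: "b \<in> N a" and u: "u \<in> V" "adj b u" for a b u
  proof (rule centralizer_special[OF a])
    show bN: "b \<in> V" "b \<noteq> a" "\<not> adj a b" using b by (auto simp: N_def)
    have comm: "\<phi> (\<gamma> u) \<otimes> \<phi> (\<gamma> b) = \<phi> (\<gamma> b) \<otimes> \<phi> (\<gamma> u)"
      using hom_mult[OF \<phi>] gen_commute[OF bN(1) u] gen_closed bN(1) u(1) by metis
    have \<gamma>b: "\<gamma> b = inv (c b) \<otimes> \<phi> (\<gamma> b) \<otimes> c b"
      using c[OF bN(1)] gen_closed[OF bN(1)] by (simp add: m_assoc)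
    show "inv (c b) \<otimes> \<phi> (\<gamma> u) \<otimes> c b \<otimes> \<gamma> b = \<gamma> b \<otimes> (inv (c b) \<otimes> \<phi> (\<gamma> u) \<otimes> c b)"
      using conj_commute[OF c(1)[OF bN(1)] G[OF u(1)] G[OF bN(1)] comm] unfolding \<gamma>b[symmetric] .
    show "inv (c b) \<otimes> \<phi> (\<gamma> u) \<otimes> c b \<in> carrier G" using c(1)[OF bN(1)] G[OF u(1)] by simp
  qed
  \<comment> \<open>By the preceding fact \<open>inv (c b') \<otimes> c b\<close> conjugates
    \<open>\<gamma> b'\<close> into \<open>\<langle>V - {a}\<rangle>\<close>, and malnormality puts
    it there.\<close>
  have step: "inv (c b) \<otimes> c b' \<in> \<langle>V - {a}\<rangle>"
    if a: "a \<in> V" and b: "b \<in> N a" "b' \<in> N a" "adj b b'" for a b b'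
  proof -
    have V: "b \<in> V" "b' \<in> V" "b' \<noteq> a" "\<not> adj a b'" using b by (auto simp: N_def)
    let ?k = "inv (c b') \<otimes> c b"
    have k: "?k \<in> carrier G" using c(1) V by simp
    have "inv ?k \<otimes> \<gamma> b' \<otimes> ?k = inv (c b) \<otimes> \<phi> (\<gamma> b') \<otimes> c b"
      using c(1)[OF V(1)] c[OF V(2)] gen_closed[OF V(2)] by (simp add: m_assoc inv_mult_group)
    then have "?k \<in> \<langle>V - {a}\<rangle>"
      using special_malnormal[OF a V(2-4) k] cent[OF a b(1) V(2) b(3)] by simp
    then have "inv ?k \<in> \<langle>V - {a}\<rangle>" by (rule subgroup.m_inv_closed[OF sub])
    then show ?thesis using c(1) V by (simp add: inv_mult_group)
  qed
  have conn: "inv (c b) \<otimes> c b' \<in> \<langle>V - {a}\<rangle>" if a: "a \<in> V" and b: "b \<in> N a" "b' \<in> N a" for a b b'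
  proof -
    have bV: "c b \<in> carrier G" using b c(1) by (auto simp: N_def)
    have "(b, b') \<in> {(x, y). x \<in> V - {a} \<and> y \<in> V - {a} \<and> \<not> adj a x \<and> \<not> adj a y \<and> adj x y}\<^sup>*"
      using non_star_connected[OF a] b by (auto simp: N_def)
    then show ?thesis
    proof (induction rule: rtrancl_induct)
      case base
      then show ?case using bV subgroup.one_closed[OF sub] by simp
    next
      case (step x y)
      then have xy: "x \<in> N a" "y \<in> N a" "adj x y" by (auto simp: N_def)
      then have V: "c x \<in> carrier G" "c y \<in> carrier G" using c(1) by (auto simp: N_def)
      have "inv (c b) \<otimes> c y = (inv (c b) \<otimes> c x) \<otimes> (inv (c x) \<otimes> c y)" using V bV by (simp add: m_assoc)
      then show ?case
        using subgroup.m_closed[OF sub step.IH \<open>\<And>a b b'. a \<in> V \<Longrightarrow> b \<in> N a \<Longrightarrow> b' \<in> N a \<Longrightarrow> adj b b' \<Longrightarrow>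
          inv (c b) \<otimes> c b' \<in> \<langle>V - {a}\<rangle>\<close>[OF a xy]] by simp
    qed
  qed
  have conj_mem: "inv m \<otimes> x \<otimes> m \<in> \<langle>V - {a}\<rangle>" if "m \<in> \<langle>V - {a}\<rangle>" "x \<in> \<langle>V - {a}\<rangle>" for m x a
    using that subgroup.m_closed[OF sub] subgroup.m_inv_closed[OF sub] by metis
  have stab: "inv (c b) \<otimes> \<phi> (\<gamma> u) \<otimes> c b \<in> \<langle>V - {a}\<rangle>"
    if a: "a \<in> V" and b: "b \<in> N a" and u: "u \<in> V - {a}" for a b u
  proof -
    \<comment> \<open>A neighbor \<open>u\<close> of \<open>a\<close> is not in \<open>N a\<close>,
      so a neighbor of \<open>u\<close> outside the star of \<open>a\<close> takes its place; any
      other \<open>u\<close> serves itself.\<close>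
    have "\<exists>w\<in>N a. inv (c w) \<otimes> \<phi> (\<gamma> u) \<otimes> c w \<in> \<langle>V - {a}\<rangle>"
    proof (cases "adj a u")
      case True
      then obtain w where w: "w \<in> V - {a}" "\<not> adj a w" "adj u w" using star_escape[OF a, of u] u by auto
      then have "w \<in> N a" "adj w u" using adj_sym by (auto simp: N_def)
      then show ?thesis using cent[OF a, of w u] u by auto
    next
      case False
      have "inv (c u) \<otimes> \<phi> (\<gamma> u) \<otimes> c u = \<gamma> u" using c[of u] u gen_closed[of u] by (simp add: m_assoc)
      then show ?thesis using False u by (intro bexI[of _ u]) (auto simp: N_def intro: gen_special)
    qed
    then obtain w where w: "w \<in> N a" "inv (c w) \<otimes> \<phi> (\<gamma> u) \<otimes> c w \<in> \<langle>V - {a}\<rangle>" by auto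
    have V: "c b \<in> carrier G" "c w \<in> carrier G" using b w c(1) by (auto simp: N_def)
    have "inv (inv (c w) \<otimes> c b) \<otimes> (inv (c w) \<otimes> \<phi> (\<gamma> u) \<otimes> c w) \<otimes> (inv (c w) \<otimes> c b) \<in> \<langle>V - {a}\<rangle>"
      by (rule conj_mem[OF conn[OF a w(1) b] w(2)])
    then show ?thesis using V G u by (simp add: m_assoc inv_mult_group)
  qed
  have "\<exists>b. b \<in> N a" if "a \<in> V" for a using stars_avoid[OF that that] by (auto simp: N_def)
  then obtain \<beta> where \<beta>: "\<And>a. a \<in> V \<Longrightarrow> \<beta> a \<in> N a" by metis
  then have \<beta>V: "\<beta> a \<in> V" if "a \<in> V" for a using that by (auto simp: N_def)
  have "\<exists>z\<in>carrier G. \<forall>a\<in>V. inv (c (\<beta> a)) \<otimes> z \<in> \<langle>V - {a}\<rangle>"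
  proof (rule special_Helly[OF finite_V order_refl])
    fix a b assume ab: "a \<in> V" "b \<in> V"
    \<comment> \<open>For \<open>d\<close> outside both stars, \<open>c d\<close> lies in the coset
      of \<open>a\<close> and in that of \<open>b\<close>.\<close>
    obtain d where "d \<in> N a" "d \<in> N b" using stars_avoid[OF ab] by (auto simp: N_def)
    then show "\<exists>z\<in>carrier G. inv (c (\<beta> a)) \<otimes> z \<in> \<langle>V - {a}\<rangle> \<and> inv (c (\<beta> b)) \<otimes> z \<in> \<langle>V - {b}\<rangle>"
      using conn[OF ab(1) \<beta>[OF ab(1)]] conn[OF ab(2) \<beta>[OF ab(2)]] c(1)
      by (intro bexI[of _ "c d"]) (auto simp: N_def)
  qed (use \<beta>V c(1) in auto)
  then obtain z where z: "z \<in> carrier G" "\<And>a. a \<in> V \<Longrightarrow> inv (c (\<beta> a)) \<otimes> z \<in> \<langle>V - {a}\<rangle>" by auto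
  have "\<phi> (\<gamma> v) = z \<otimes> \<gamma> v \<otimes> inv z" if v: "v \<in> V" for v
  proof -
    \<comment> \<open>Conjugated by the common element \<open>z\<close>, the image of
      \<open>\<gamma> v\<close> omits every other generator, so it is a power of
      \<open>\<gamma> v\<close>, and its exponent is 1.\<close>
    let ?x = "inv z \<otimes> \<phi> (\<gamma> v) \<otimes> z"
    have xG: "?x \<in> carrier G" using z(1) G[OF v] by simp
    have "?x \<in> \<langle>V - {a}\<rangle>" if a: "a \<in> V - {v}" for a
    proof -
      have aV: "a \<in> V" "v \<in> V - {a}" using a v by auto
      have cG: "c (\<beta> a) \<in> carrier G" using c(1) \<beta>V aV by auto
      have "inv (inv (c (\<beta> a)) \<otimes> z) \<otimes> (inv (c (\<beta> a)) \<otimes> \<phi> (\<gamma> v) \<otimes> c (\<beta> a)) \<otimes> (inv (c (\<beta> a)) \<otimes> z) \<in> \<langle>V - {a}\<rangle>"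
        by (rule conj_mem[OF z(2)[OF aV(1)] stab[OF aV(1) \<beta>[OF aV(1)] aV(2)]])
      then show ?thesis using cG z(1) G[OF v] by (simp add: m_assoc inv_mult_group)
    qed
    then have "?x \<in> \<langle>V - (V - {v})\<rangle>" using special_Diff[OF _ xG, of "V - {v}"] finite_V by simp
    moreover have "V - (V - {v}) = {v}" using v by auto
    ultimately have "?x \<in> \<langle>{v}\<rangle>" by (simp only:)
    moreover have "expo v ?x = 1" using z(1) G[OF v] e[OF v v] by simp
    ultimately have x: "?x = \<gamma> v" by (rule special_singleton[OF v])
    show ?thesis by (rule conj_solve[OF z(1) G[OF v] x])
  qed
  then show ?thesis using z(1) by blast
qed

text \<open>Composing with the inverse of the signed automorphism that has the same exponents leaves
  an automorphism that is trivial on the abelianization.\<close>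

theorem auto_decomposition:
  assumes "\<phi> \<in> auto G"
  shows "\<exists>g\<in>carrier G. \<exists>\<pi> E. graph_aut \<pi> \<and> (\<forall>x\<in>carrier G. \<phi> x = g \<otimes> signed \<pi> E x \<otimes> inv g)"
proof -
  obtain \<pi> E where \<pi>: "graph_aut \<pi>"
    and e: "\<And>v t. v \<in> V \<Longrightarrow> t \<in> V \<Longrightarrow> expo t (\<phi> (\<gamma> v)) = (if t = \<pi> v then if v \<in> E then -1 else 1 else 0)"
    using auto_graph_aut[OF assms] by metis
  note \<omega> = signed_auto_mem[OF \<pi>, of E]
  obtain \<psi> where \<psi>: "\<psi> \<in> auto G" "\<And>x. x \<in> carrier G \<Longrightarrow> \<psi> (signed \<pi> E x) = x"
    using auto_inverse[OF \<omega>] by metis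
  note h = autoD(1)[OF assms] autoD(1)[OF \<psi>(1)]
  have \<psi>\<gamma>: "\<psi> (\<gamma> (\<pi> v)) = spow (v \<in> E) (\<gamma> v)" if v: "v \<in> V" for v
  proof -
    have \<pi>v: "\<pi> v \<in> V" using \<pi> v by (auto simp: graph_aut_def bij_betw_def)
    have "\<gamma> v = spow (v \<in> E) (\<psi> (\<gamma> (\<pi> v)))"
      using \<psi>(2)[OF gen_closed[OF v]] signed_gen[OF \<pi> v, of E] hom_spow[OF h(2) gen_closed[OF \<pi>v]] by simp
    then have "spow (v \<in> E) (\<gamma> v) = spow False (\<psi> (\<gamma> (\<pi> v)))"
      using spow_spow[of "\<psi> (\<gamma> (\<pi> v))" "v \<in> E" "v \<in> E"] hom_in_carrier[OF h(2)] gen_closed[OF \<pi>v] by simp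
    then show ?thesis by simp
  qed
  have "\<exists>g\<in>carrier G. \<forall>u\<in>V. (\<phi> \<circ> \<psi>) (\<gamma> u) = g \<otimes> \<gamma> u \<otimes> inv g"
  proof (rule trivial_expo_inner[OF Group.hom_compose[OF h(2,1)]])
    fix u t assume u: "u \<in> V" and t: "t \<in> V"
    have "u \<in> \<pi> ` V" using \<pi> u by (simp add: graph_aut_def bij_betw_def)
    then obtain v where v: "v \<in> V" "u = \<pi> v" by blast
    show "expo t ((\<phi> \<circ> \<psi>) (\<gamma> u)) = (if t = u then 1 else 0)"
      using \<psi>\<gamma>[OF v(1)] v hom_spow[OF h(1) gen_closed[OF v(1)]] e[OF v(1) t]
        hom_in_carrier[OF h(1) gen_closed[OF v(1)]]
      by (cases "t = \<pi> v") (simp_all add: expo_spow)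
  qed
  then obtain g where g: "g \<in> carrier G" "\<And>u. u \<in> V \<Longrightarrow> \<phi> (\<psi> (\<gamma> u)) = g \<otimes> \<gamma> u \<otimes> inv g" by auto
  have conj: "(\<lambda>x. g \<otimes> x \<otimes> inv g) \<in> hom G G" using conj_hom[of "inv g"] g(1) by simp
  have "\<phi> x = g \<otimes> signed \<pi> E x \<otimes> inv g" if x: "x \<in> carrier G" for x
  proof -
    have sx: "signed \<pi> E x \<in> carrier G" using hom_in_carrier[OF autoD(1)[OF \<omega>] x] .
    have "(\<phi> \<circ> \<psi>) (signed \<pi> E x) = g \<otimes> signed \<pi> E x \<otimes> inv g"
      by (rule hom_eqI[OF Group.hom_compose[OF h(2,1)] conj is_group _ sx]) (simp add: g(2))
    then show ?thesis using \<psi>(2)[OF x] by simp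
  qed
  then show ?thesis using g(1) \<pi> by blast
qed

text \<open>For each \<open>a\<close>, a central element centralizes a generator outside the star of
  \<open>a\<close>, hence omits \<open>a\<close>.\<close>

lemma trivial_center:
  assumes z: "z \<in> carrier G" and c: "\<And>v. v \<in> V \<Longrightarrow> z \<otimes> \<gamma> v = \<gamma> v \<otimes> z"
  shows "z = \<one>"
proof -
  have "z \<in> \<langle>V - {a}\<rangle>" if a: "a \<in> V" for a
  proof -
    obtain b where b: "b \<in> V - {a}" "\<not> adj a b" using stars_avoid[OF a a] by auto
    then show ?thesis using centralizer_special[OF a, of b z] z c by auto
  qed
  then have "z \<in> \<langle>V - V\<rangle>" by (rule special_Diff[OF finite_V z])
  then show ?thesis using generate_empty by simp
qed

text \<open>Conjugation preserves exponents, so \<pi> fixes every vertex and none is inverted; then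
  \<open>g\<close> commutes with all generators.\<close>

lemma signed_eq_conj:
  assumes \<pi>: "graph_aut \<pi>" and g: "g \<in> carrier G"
    and eq: "\<And>x. x \<in> carrier G \<Longrightarrow> signed \<pi> E x = g \<otimes> x \<otimes> inv g"
  shows "g = \<one>"
proof (rule trivial_center[OF g])
  fix v assume v: "v \<in> V"
  have \<pi>v: "\<pi> v \<in> V" using \<pi> v by (auto simp: graph_aut_def bij_betw_def)
  have s: "spow (v \<in> E) (\<gamma> (\<pi> v)) = g \<otimes> \<gamma> v \<otimes> inv g"
    using eq[OF gen_closed[OF v]] signed_gen[OF \<pi> v] by simp
  have "expo v (spow (v \<in> E) (\<gamma> (\<pi> v))) = 1" unfolding s using g gen_closed[OF v] v by (simp add: expo_gen)
  then have "\<pi> v = v" "v \<notin> E" using \<pi>v gen_closed by (auto simp: expo_spow expo_gen split: if_splits)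
  then have "\<gamma> v = g \<otimes> \<gamma> v \<otimes> inv g" using s by simp
  then have "\<gamma> v \<otimes> g = g \<otimes> \<gamma> v \<otimes> inv g \<otimes> g" by simp
  then show "g \<otimes> \<gamma> v = \<gamma> v \<otimes> g" using g gen_closed[OF v] by (simp add: m_assoc)
qed

end

section \<open>The symmetric group inside the virtual twin group\<close>

lemma vt_rel:
  assumes "(l, r) \<in> vt_rels n" "set l \<subseteq> vt_gens n" "set r \<subseteq> vt_gens n"
  shows "vt_elem n l = vt_elem n r"
proof -
  have "(pos_word l, pos_word r) \<in> vt_word_rels n" using assms(1) by force
  then have "word_eq (vt_gens n) (vt_word_rels n) ([] @ pos_word l @ []) ([] @ pos_word r @ [])"
    using assms(2,3) by (intro word_rel) auto
  then show ?thesis by (simp add: vt_elem_def word_class_eqI)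
qed

lemma S_in_gens [simp]: "S i \<in> vt_gens n \<longleftrightarrow> 1 \<le> i \<and> i < n"
  and Rho_in_gens [simp]: "Rho i \<in> vt_gens n \<longleftrightarrow> 1 \<le> i \<and> i < n"
  by (auto simp: vt_gens_def)

definition perm_of :: "nat list \<Rightarrow> nat \<Rightarrow> nat" where
  "perm_of xs = foldr (\<circ>) (map (\<lambda>i. transpose i (i + 1)) xs) id"

lemma perm_of_Nil [simp]: "perm_of [] = id"
  and perm_of_Cons: "perm_of (i # xs) = transpose i (i + 1) \<circ> perm_of xs"
  by (simp_all add: perm_of_def)

lemma perm_of_append: "perm_of (xs @ ys) = perm_of xs \<circ> perm_of ys"
  by (induction xs) (simp_all add: perm_of_Cons comp_assoc)

lemma perm_of_rev: "perm_of (rev xs) \<circ> perm_of xs = id" "perm_of xs \<circ> perm_of (rev xs) = id"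
proof -
  have "perm_of (rev xs) (perm_of xs y) = y" for xs y
    by (induction xs arbitrary: y) (simp_all add: perm_of_append perm_of_Cons)
  from this[of xs] this[of "rev xs"] show "perm_of (rev xs) \<circ> perm_of xs = id" "perm_of xs \<circ> perm_of (rev xs) = id"
    by (simp_all add: fun_eq_iff)
qed

lemma perm_of_permutes: "set xs \<subseteq> {1..<m} \<Longrightarrow> perm_of xs permutes {1..m}"
proof (induction xs)
  case (Cons i xs)
  then have "transpose i (i + 1) permutes {1..m}" by (intro permutes_swap_id) auto
  then show ?case using Cons unfolding perm_of_Cons by (intro permutes_compose) auto
qed (simp add: permutes_id)

text \<open>\<open>rev [k..<m]\<close> is the descending run of adjacent transpositions with indices
  \<open>m - 1\<close> to \<open>k\<close>. These runs, for \<open>k\<close> from 1 to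
  \<open>m\<close>, represent the cosets of the permutations of \<open>{1..m - 1}\<close> in those
  of \<open>{1..m}\<close>.\<close>

lemma perm_of_desc: "k \<le> m \<Longrightarrow> perm_of (rev [k..<m]) k = m"
  by (induction m rule: dec_induct) (auto simp: perm_of_Cons)

lemma perm_of_desc_less: "j < k \<Longrightarrow> perm_of (rev [k..<m]) j = j"
  by (induction m) (auto simp: perm_of_Cons transpose_def)

text \<open>Peel off the run that takes the preimage of the largest point to that point; what is
  left fixes it.\<close>

lemma ex_perm_of:
  "p permutes {1..m} \<Longrightarrow> \<exists>xs. set xs \<subseteq> {1..<m} \<and> perm_of xs = p"
proof (induction m arbitrary: p)
  case 0
  then show ?case by (intro exI[of _ "[]"]) auto
next
  case (Suc m)
  let ?k = "inv' p (Suc m)"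
  have pk: "p ?k = Suc m" using permutes_inverses(1)[OF Suc.prems] .
  have "?k \<in> {1..Suc m}" using permutes_in_image[OF permutes_inv[OF Suc.prems], of "Suc m"] by simp
  then have k: "1 \<le> ?k" "?k \<le> Suc m" by auto
  let ?d = "rev [?k..<Suc m]"
  have d: "set ?d \<subseteq> {1..<Suc m}" using k by auto
  let ?q = "p \<circ> perm_of (rev ?d)"
  have "perm_of (rev ?d) (Suc m) = ?k"
    using perm_of_desc[OF k(2)] fun_cong[OF perm_of_rev(1)[of ?d], of ?k] by simp
  then have fixed: "?q (Suc m) = Suc m" using pk by simp
  have "?q permutes {1..Suc m}"
    by (rule permutes_compose[OF perm_of_permutes Suc.prems]) (use k in auto)
  then have "?q permutes {1..m}"
  proof (rule permutes_superset)
    fix x assume "x \<in> {1..Suc m} - {1..m}"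
    then have "x = Suc m" by auto
    then show "?q x = x" using fixed by (simp only:)
  qed
  then obtain us where us: "set us \<subseteq> {1..<m}" "perm_of us = ?q" using Suc.IH by blast
  have "perm_of (us @ ?d) = p \<circ> (perm_of (rev ?d) \<circ> perm_of ?d)"
    unfolding perm_of_append us(2) by (simp only: comp_assoc)
  then have "perm_of (us @ ?d) = p" unfolding perm_of_rev(1) by simp
  moreover have "set (us @ ?d) \<subseteq> {1..<Suc m}" using us(1) d by auto
  ultimately show ?case by blast
qed

section \<open>A normal form for words in the involutions \<open>Rho i\<close>\<close>

definition rho :: "nat \<Rightarrow> nat list \<Rightarrow> vt_gen word set" where
  "rho n xs = vt_elem n (map Rho xs)"

context
  fixes n :: nat
begin

interpretation VT: group "VT n" by (rule VT_group)

abbreviation vt_mult :: "vt_gen word set \<Rightarrow> vt_gen word set \<Rightarrow> vt_gen word set" (infixl \<open>\<bullet>\<close> 70) where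
  "x \<bullet> y \<equiv> x \<otimes>\<^bsub>VT n\<^esub> y"

abbreviation ix :: "nat set" where "ix \<equiv> {1..<n}"

lemma Rho_words: "set xs \<subseteq> ix \<Longrightarrow> set (map Rho xs) \<subseteq> vt_gens n"
  by auto

lemma rho_closed: "set xs \<subseteq> ix \<Longrightarrow> rho n xs \<in> carrier (VT n)"
  unfolding rho_def by (rule vt_elem_carrier[OF Rho_words])

lemma rho_append: "set xs \<subseteq> ix \<Longrightarrow> set ys \<subseteq> ix \<Longrightarrow> rho n (xs @ ys) = rho n xs \<bullet> rho n ys"
  unfolding rho_def by (simp add: vt_elem_mult[OF Rho_words Rho_words])

lemma vt_elem_Nil: "vt_elem n [] = \<one>\<^bsub>VT n\<^esub>"
  by (simp add: vt_elem_def VT_def presented_group_def pos_word_def)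

lemma rho_Nil: "rho n [] = \<one>\<^bsub>VT n\<^esub>"
  by (simp add: rho_def vt_elem_Nil)

lemma rho_context:
  assumes "rho n xs = rho n ys" "set xs \<subseteq> ix" "set ys \<subseteq> ix" "set us \<subseteq> ix" "set vs \<subseteq> ix"
  shows "rho n (us @ xs @ vs) = rho n (us @ ys @ vs)"
  using assms by (simp add: rho_append)

lemma rho_square: "i \<in> ix \<Longrightarrow> rho n [i, i] = rho n []"
  using vt_rel[OF vt_rels.intros(2)[of i n]] by (simp add: rho_def)

lemma rho_far: "i \<in> ix \<Longrightarrow> j \<in> ix \<Longrightarrow> i + 2 \<le> j \<or> j + 2 \<le> i \<Longrightarrow> rho n [i, j] = rho n [j, i]"
  using vt_rel[OF vt_rels.intros(4)[of i n j]] by (auto simp: rho_def)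

lemma rho_braid: "1 \<le> i \<Longrightarrow> i + 2 \<le> n \<Longrightarrow> rho n [i, i + 1, i] = rho n [i + 1, i, i + 1]"
  using vt_rel[OF vt_rels.intros(6)[of i n]] by (simp add: rho_def)

lemma rho_far_list:
  assumes "i \<in> ix" "set xs \<subseteq> ix" "\<And>j. j \<in> set xs \<Longrightarrow> i + 2 \<le> j \<or> j + 2 \<le> i"
  shows "rho n (xs @ [i]) = rho n (i # xs)"
  using assms(2,3)
proof (induction xs)
  case (Cons j xs)
  have "rho n ((j # xs) @ [i]) = rho n ([j] @ (xs @ [i]) @ [])" by simp
  also have "\<dots> = rho n ([j] @ (i # xs) @ [])"
    using Cons assms(1) by (intro rho_context) auto
  also have "\<dots> = rho n ([] @ [j, i] @ xs)" by simp
  also have "\<dots> = rho n ([] @ [i, j] @ xs)"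
    using Cons.prems assms(1) rho_far[of i j] by (intro rho_context) auto
  finally show ?case by simp
qed simp

text \<open>On meeting \<open>i\<close> from the right, the run grows if \<open>i + 1 = k\<close>,
  shrinks if \<open>i = k\<close>, lets \<open>i\<close> pass if \<open>i + 1 < k\<close>, and turns
  it into \<open>i - 1\<close> by a braid relation if \<open>k < i\<close>. An index that comes out
  on the left is below \<open>m - 1\<close>.\<close>

lemma rho_desc_step:
  assumes m: "m \<le> n" "1 \<le> k" "k \<le> m" and i: "i \<in> {1..<m}"
  shows "\<exists>us k'. set us \<subseteq> {1..<m - 1} \<and> 1 \<le> k' \<and> k' \<le> m \<and>
    rho n (rev [k..<m] @ [i]) = rho n (us @ rev [k'..<m])"
proof -
  have d: "set (rev [j..<l]) \<subseteq> ix" if "1 \<le> j" "l \<le> n" for j l using that by auto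
  consider "i + 1 = k" | "i = k" | "i + 1 < k" | "k < i" by linarith
  then show ?thesis
  proof cases
    case 1
    then have "rev [k..<m] @ [i] = [] @ rev [i..<m]" using m by (simp add: upt_conv_Cons)
    then show ?thesis using i by (intro exI[of _ "[]"] exI[of _ i]) auto
  next
    case 2
    then have eq: "rev [k..<m] @ [i] = rev [k + 1..<m] @ [i, i] @ []"
      using i by (simp add: upt_conv_Cons)
    have "rho n (rev [k..<m] @ [i]) = rho n (rev [k + 1..<m] @ [] @ [])"
      unfolding eq using m i 2 rho_square[of i] by (intro rho_context) auto
    then show ?thesis using i 2 by (intro exI[of _ "[]"] exI[of _ "k + 1"]) auto
  next
    case 3
    have "rho n (rev [k..<m] @ [i]) = rho n ([i] @ rev [k..<m])"
      using m i 3 rho_far_list[of i "rev [k..<m]"] by auto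
    then show ?thesis using m i 3 by (intro exI[of _ "[i]"] exI[of _ k]) auto
  next
    case 4
    let ?a = "rev [i + 1..<m]" and ?b = "rev [k..<i - 1]"
    have "[k..<m] = [k..<i - 1] @ [i - 1, i] @ [i + 1..<m]"
    proof -
      have "[k..<m] = [k..<i - 1] @ [i - 1..<m]" using 4 i upt_add_eq_append[of k "i - 1" "m - (i - 1)"] by simp
      also have "[i - 1..<m] = [i - 1, i] @ [i + 1..<m]" using 4 i by (simp add: upt_conv_Cons)
      finally show ?thesis .
    qed
    then have dec: "rev [k..<m] = ?a @ [i, i - 1] @ ?b" by simp
    have ab: "set ?a \<subseteq> ix" "set ?b \<subseteq> ix" "i \<in> ix" "i - 1 \<in> ix" using m i 4 by auto
    have "rho n (rev [k..<m] @ [i]) = rho n ((?a @ [i, i - 1]) @ (?b @ [i]) @ [])" by (simp add: dec)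
    also have "\<dots> = rho n ((?a @ [i, i - 1]) @ (i # ?b) @ [])"
      using ab by (intro rho_context rho_far_list) auto
    also have "\<dots> = rho n (?a @ [i, i - 1, i] @ ?b)" by simp
    also have "\<dots> = rho n (?a @ [i - 1, i, i - 1] @ ?b)"
      using ab m i 4 rho_braid[of "i - 1"] by (intro rho_context) auto
    also have "\<dots> = rho n ([] @ (?a @ [i - 1]) @ ([i, i - 1] @ ?b))" by simp
    also have "\<dots> = rho n ([] @ ((i - 1) # ?a) @ ([i, i - 1] @ ?b))"
      using ab by (intro rho_context rho_far_list) auto
    also have "\<dots> = rho n ([i - 1] @ rev [k..<m])" by (simp add: dec)
    finally show ?thesis using m i 4 by (intro exI[of _ "[i - 1]"] exI[of _ k]) auto
  qed
qed

lemma rho_normal_form: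
  assumes m: "1 \<le> m" "m \<le> n" and xs: "set xs \<subseteq> {1..<m}"
  shows "\<exists>us k. set us \<subseteq> {1..<m - 1} \<and> 1 \<le> k \<and> k \<le> m \<and> rho n xs = rho n (us @ rev [k..<m])"
  using xs
proof (induction xs rule: rev_induct)
  case Nil
  then show ?case using m by (intro exI[of _ "[]"] exI[of _ m]) auto
next
  case (snoc i xs)
  then obtain us k where us: "set us \<subseteq> {1..<m - 1}" "1 \<le> k" "k \<le> m" "rho n xs = rho n (us @ rev [k..<m])"
    by auto
  obtain vs k' where vs: "set vs \<subseteq> {1..<m - 1}" "1 \<le> k'" "k' \<le> m"
    "rho n (rev [k..<m] @ [i]) = rho n (vs @ rev [k'..<m])"
    using rho_desc_step[OF m(2) us(2,3), of i] snoc.prems by auto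
  have sub: "set us \<subseteq> ix" "set vs \<subseteq> ix" "set (rev [k..<m]) \<subseteq> ix" "set (rev [k'..<m]) \<subseteq> ix" "i \<in> ix" "set xs \<subseteq> ix"
  proof -
    have "{1..<m - 1} \<subseteq> ix" using m by auto
    then show "set us \<subseteq> ix" "set vs \<subseteq> ix" using us(1) vs(1) by blast+
  qed (use us vs m snoc.prems in auto)
  have "rho n (xs @ [i]) = rho n (us @ (rev [k..<m] @ [i]))"
    using us(4) sub by (simp add: rho_append VT.m_assoc rho_closed)
  also have "\<dots> = rho n (us @ vs @ rev [k'..<m])"
    using rho_append[of us "rev [k..<m] @ [i]"] rho_append[of us "vs @ rev [k'..<m]"] vs(4) sub by simp
  finally have "rho n (xs @ [i]) = rho n ((us @ vs) @ rev [k'..<m])" by simp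
  then show ?case using us vs by (intro exI[of _ "us @ vs"] exI[of _ k']) auto
qed

lemma vt_to_sym_rho: "set xs \<subseteq> ix \<Longrightarrow> vt_to_sym n (rho n xs) = perm_of xs"
  unfolding rho_def using vt_to_sym_elem[OF Rho_words] by (simp add: perm_of_def comp_def)

text \<open>Faithfulness of the Coxeter presentation of the symmetric group.\<close>

lemma rho_trivial:
  "m \<le> n \<Longrightarrow> set xs \<subseteq> {1..<m} \<Longrightarrow> perm_of xs = id \<Longrightarrow> rho n xs = \<one>\<^bsub>VT n\<^esub>"
proof (induction m arbitrary: xs)
  case 0
  then show ?case by (simp add: rho_Nil)
next
  case (Suc m)
  obtain us k where us: "set us \<subseteq> {1..<m}" "1 \<le> k" "k \<le> Suc m" "rho n xs = rho n (us @ rev [k..<Suc m])"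
    using rho_normal_form[of "Suc m" xs] Suc.prems by auto
  have sub: "set xs \<subseteq> ix" "set (us @ rev [k..<Suc m]) \<subseteq> ix" using Suc.prems us by auto
  have perm: "perm_of us \<circ> perm_of (rev [k..<Suc m]) = id"
    using vt_to_sym_rho[OF sub(1)] vt_to_sym_rho[OF sub(2)] us(4) Suc.prems(3) by (simp only: perm_of_append)
  \<comment> \<open>The run takes \<open>k\<close> to \<open>Suc m\<close>, which \<open>us\<close>
    fixes; so \<open>k = Suc m\<close> and the run is empty.\<close>
  have "perm_of us (Suc m) = k"
    using fun_cong[OF perm, of k] perm_of_desc[OF us(3)] by simp
  moreover have "perm_of us (Suc m) = Suc m"
    by (rule permutes_not_in[OF perm_of_permutes[OF us(1)]]) auto
  ultimately have "[k..<Suc m] = []" by simp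
  then have "rho n xs = rho n us" "perm_of us = id" using us(4) perm by auto
  then show ?case using Suc.IH[of us] Suc.prems(1) us(1) by simp
qed

lemma rho_rev: "set xs \<subseteq> ix \<Longrightarrow> rho n (rev xs) = inv\<^bsub>VT n\<^esub> rho n xs"
proof -
  assume "set xs \<subseteq> ix"
  then have "rho n (rev xs) \<bullet> rho n xs = \<one>\<^bsub>VT n\<^esub>"
    using rho_trivial[of n "rev xs @ xs"] by (simp add: rho_append perm_of_append perm_of_rev)
  then show ?thesis using \<open>set xs \<subseteq> ix\<close> by (intro VT.inv_equality[symmetric]) (auto simp: rho_closed)
qed

lemma rho_eqI:
  assumes "set xs \<subseteq> ix" "set ys \<subseteq> ix" "perm_of xs = perm_of ys"
  shows "rho n xs = rho n ys"
proof -
  have "rho n xs \<bullet> inv\<^bsub>VT n\<^esub> rho n ys = \<one>\<^bsub>VT n\<^esub>"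
    using rho_trivial[of n "xs @ rev ys"] assms
    by (simp add: rho_append perm_of_append perm_of_rev rho_rev)
  then show ?thesis using assms rho_closed VT.inv_equality[of "rho n xs" "inv\<^bsub>VT n\<^esub> rho n ys"] by simp
qed

text \<open>The splitting of \<open>vt_to_sym n\<close>. By \<open>rho_eqI\<close>, that is by
  faithfulness of the Coxeter presentation, the chosen word does not matter.\<close>

definition sym_emb :: "(nat \<Rightarrow> nat) \<Rightarrow> vt_gen word set" where
  "sym_emb p = rho n (SOME xs. set xs \<subseteq> ix \<and> perm_of xs = p)"

lemma sym_emb_rho: "set xs \<subseteq> ix \<Longrightarrow> sym_emb (perm_of xs) = rho n xs"
proof -
  assume xs: "set xs \<subseteq> ix"
  have "set (SOME ys. set ys \<subseteq> ix \<and> perm_of ys = perm_of xs) \<subseteq> ix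
      \<and> perm_of (SOME ys. set ys \<subseteq> ix \<and> perm_of ys = perm_of xs) = perm_of xs"
    by (rule someI_ex) (use xs in auto)
  then show ?thesis unfolding sym_emb_def using rho_eqI xs by blast
qed

lemma sym_emb_closed: "p permutes {1..n} \<Longrightarrow> sym_emb p \<in> carrier (VT n)"
  using ex_perm_of[of p n] sym_emb_rho rho_closed by metis

lemma sym_emb_mult:
  assumes "p permutes {1..n}" "q permutes {1..n}"
  shows "sym_emb (p \<circ> q) = sym_emb p \<bullet> sym_emb q"
proof -
  obtain xs ys where *: "set xs \<subseteq> ix" "perm_of xs = p" "set ys \<subseteq> ix" "perm_of ys = q"
    using ex_perm_of assms by metis
  then show ?thesis
    using sym_emb_rho[of "xs @ ys"] sym_emb_rho[of xs] sym_emb_rho[of ys] rho_append[of xs ys]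
    by (simp add: perm_of_append)
qed

lemma sym_emb_id: "sym_emb id = \<one>\<^bsub>VT n\<^esub>"
  using sym_emb_rho[of "[]"] by (simp add: rho_Nil)

lemma sym_emb_inv: "p permutes {1..n} \<Longrightarrow> sym_emb (inv' p) = inv\<^bsub>VT n\<^esub> sym_emb p"
  using sym_emb_mult[of "inv' p" p] sym_emb_id
  by (intro VT.inv_equality[symmetric]) (auto simp: permutes_inv permutes_inv_o sym_emb_closed)

lemma vt_to_sym_emb: "p permutes {1..n} \<Longrightarrow> vt_to_sym n (sym_emb p) = p"
  using ex_perm_of[of p n] sym_emb_rho vt_to_sym_rho by metis

section \<open>The generators of the pure virtual twin group as a conjugacy orbit\<close>

definition lam :: "nat \<Rightarrow> vt_gen word set" where
  "lam i = vt_elem n [S i, Rho i]"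

text \<open>\<open>Lam x y\<close> is \<open>\<lambda>\<^sub>x\<^sub>,\<^sub>y\<close> for \<open>x < y\<close> and the inverse of \<open>\<lambda>\<^sub>y\<^sub>,\<^sub>x\<close> for \<open>x > y\<close>; with this convention the
  symmetric group permutes these elements by acting on the indices.\<close>

definition Lam :: "nat \<Rightarrow> nat \<Rightarrow> vt_gen word set" where
  "Lam x y = (let p = SOME p. p permutes {1..n} \<and> p (n - 1) = x \<and> p n = y in
     sym_emb p \<bullet> lam (n - 1) \<bullet> inv\<^bsub>VT n\<^esub> sym_emb p)"

lemma lam_closed: "i \<in> ix \<Longrightarrow> lam i \<in> carrier (VT n)"
  unfolding lam_def by (rule vt_elem_carrier) auto

lemma S_Rho_far: "i \<in> ix \<Longrightarrow> j \<in> ix \<Longrightarrow> i + 2 \<le> j \<or> j + 2 \<le> i \<Longrightarrow> lam j \<bullet> rho n [i] = rho n [i] \<bullet> lam j"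
proof -
  assume i: "i \<in> ix" "j \<in> ix" "i + 2 \<le> j \<or> j + 2 \<le> i"
  have e: "vt_elem n [S j] \<in> carrier (VT n)" "rho n [i] \<in> carrier (VT n)" "rho n [j] \<in> carrier (VT n)"
    using i by (auto intro: vt_elem_carrier rho_closed)
  have l: "lam j = vt_elem n [S j] \<bullet> rho n [j]"
    unfolding lam_def rho_def using i vt_elem_mult[of "[S j]" n "[Rho j]"] by simp
  have c1: "rho n [j] \<bullet> rho n [i] = rho n [i] \<bullet> rho n [j]"
    using rho_far[OF i] rho_append[of "[i]" "[j]"] rho_append[of "[j]" "[i]"] i by simp
  have "vt_elem n [Rho i, S j] = vt_elem n [S j, Rho i]"
    using vt_rels.intros(5)[of i n j] i by (intro vt_rel) auto
  then have c2: "vt_elem n [S j] \<bullet> rho n [i] = rho n [i] \<bullet> vt_elem n [S j]"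
    unfolding rho_def using i vt_elem_mult[of "[S j]" n "[Rho i]"] vt_elem_mult[of "[Rho i]" n "[S j]"] by simp
  have "lam j \<bullet> rho n [i] = vt_elem n [S j] \<bullet> rho n [i] \<bullet> rho n [j]"
    unfolding l using e c1 by (simp add: VT.m_assoc)
  also have "\<dots> = rho n [i] \<bullet> lam j" unfolding c2 l using e by (simp add: VT.m_assoc)
  finally show ?thesis .
qed

lemma lam_far: 
  assumes i: "i \<in> ix" "j \<in> ix" "i + 2 \<le> j \<or> j + 2 \<le> i"
  shows "lam i \<bullet> lam j = lam j \<bullet> lam i"
proof -
  have e: "vt_elem n [S i] \<in> carrier (VT n)" "rho n [i] \<in> carrier (VT n)"
     "vt_elem n [S j] \<in> carrier (VT n)" "rho n [j] \<in> carrier (VT n)"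
    using i by (auto intro: vt_elem_carrier rho_closed)
  have l: "lam j = vt_elem n [S j] \<bullet> rho n [j]" "lam i = vt_elem n [S i] \<bullet> rho n [i]"
    unfolding lam_def rho_def using i vt_elem_mult[of "[S j]" n "[Rho j]"] vt_elem_mult[of "[S i]" n "[Rho i]"]
    by simp_all
  have "vt_elem n [S i, S j] = vt_elem n [S j, S i]"
    using vt_rels.intros(3)[of i n j] i by (intro vt_rel) auto
  then have c1: "vt_elem n [S i] \<bullet> vt_elem n [S j] = vt_elem n [S j] \<bullet> vt_elem n [S i]"
    using i vt_elem_mult[of "[S j]" n "[S i]"] vt_elem_mult[of "[S i]" n "[S j]"] by simp
  have "vt_elem n [Rho j, S i] = vt_elem n [S i, Rho j]"
    using vt_rels.intros(5)[of j n i] i by (intro vt_rel) auto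
  then have c2: "vt_elem n [S i] \<bullet> rho n [j] = rho n [j] \<bullet> vt_elem n [S i]"
    unfolding rho_def using i vt_elem_mult[of "[S i]" n "[Rho j]"] vt_elem_mult[of "[Rho j]" n "[S i]"] by simp
  have "lam i \<bullet> lam j = vt_elem n [S i] \<bullet> (rho n [i] \<bullet> lam j)" unfolding l(2) using e i lam_closed by (simp add: VT.m_assoc)
  also have "\<dots> = vt_elem n [S i] \<bullet> lam j \<bullet> rho n [i]"
    unfolding S_Rho_far[OF i, symmetric] using e i lam_closed by (simp add: VT.m_assoc)
  also have "vt_elem n [S i] \<bullet> lam j = vt_elem n [S j] \<bullet> (vt_elem n [S i] \<bullet> rho n [j])"
    unfolding l(1) using e c1 by (simp flip: VT.m_assoc)
  also have "\<dots> = lam j \<bullet> vt_elem n [S i]" unfolding c2 l(1) using e by (simp add: VT.m_assoc)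
  also have "lam j \<bullet> vt_elem n [S i] \<bullet> rho n [i] = lam j \<bullet> lam i"
    unfolding l(2) using e i lam_closed by (simp add: VT.m_assoc)
  finally show ?thesis .
qed

end

section \<open>The action on indices and the commutation of the generators\<close>

text \<open>The complements of \<open>T\<close> and of its image in \<open>A\<close> have the same
  size, so a bijection between them can be glued to \<open>f\<close>.\<close>

lemma permutes_extend:
  assumes S: "finite A" "T \<subseteq> A" and f: "inj_on f T" "f ` T \<subseteq> A"
  obtains p where "p permutes A" "\<And>t. t \<in> T \<Longrightarrow> p t = f t"
proof -
  have fin: "finite T" "finite (f ` T)" using S finite_subset by auto
  have "card (A - T) = card (A - f ` T)"
    using S f fin by (simp add: card_Diff_subset card_image)
  then obtain g where g: "bij_betw g (A - T) (A - f ` T)"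
    using S(1) finite_same_card_bij[of "A - T" "A - f ` T"] by auto
  let ?p = "\<lambda>x. if x \<in> T then f x else if x \<in> A then g x else x"
  have "bij_betw ?p T (f ` T)" using f(1) by (simp add: bij_betw_def inj_on_def)
  moreover have "bij_betw ?p (A - T) (A - f ` T) = bij_betw g (A - T) (A - f ` T)"
    by (rule bij_betw_cong) auto
  then have "bij_betw ?p (A - T) (A - f ` T)" using g by (rule iffD2)
  ultimately have "bij_betw ?p (T \<union> (A - T)) (f ` T \<union> (A - f ` T))" by (rule bij_betw_combine) auto
  moreover have "T \<union> (A - T) = A" "f ` T \<union> (A - f ` T) = A" using S(2) f(2) by auto
  ultimately have "bij_betw ?p A A" by (simp only:)
  then have "?p permutes A" by (rule bij_imp_permutes) (use S(2) in auto)
  then show thesis by (rule that) simp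
qed

context
  fixes n :: nat
  assumes n5: "n \<ge> 5"
begin

interpretation VT: group "VT n" by (rule VT_group)

text \<open>Such a permutation is a word in indices up to \<open>n - 3\<close>, at distance at least
  2 from \<open>n - 1\<close>. This makes \<open>Lam\<close> independent of the permutation chosen
  in its definition.\<close>

lemma sym_emb_stabilizer:
  assumes d: "d permutes {1..n}" "d (n - 1) = n - 1" "d n = n"
  shows "sym_emb n d \<otimes>\<^bsub>VT n\<^esub> lam n (n - 1) = lam n (n - 1) \<otimes>\<^bsub>VT n\<^esub> sym_emb n d"
proof -
  have "d permutes {1..n - 2}"
  proof (rule permutes_superset[OF d(1)])
    fix x assume "x \<in> {1..n} - {1..n - 2}"
    then have "x = n - 1 \<or> x = n" by auto
    then show "d x = x" using d by auto
  qed
  then obtain xs where xs: "set xs \<subseteq> {1..<n - 2}" "perm_of xs = d" using ex_perm_of by blast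
  have l: "lam n (n - 1) \<in> carrier (VT n)" using n5 by (intro lam_closed) auto
  have "rho n xs \<otimes>\<^bsub>VT n\<^esub> lam n (n - 1) = lam n (n - 1) \<otimes>\<^bsub>VT n\<^esub> rho n xs"
    using xs(1)
  proof (induction xs)
    case Nil
    then show ?case using l by (simp add: rho_Nil)
  next
    case (Cons i xs)
    have "{1..<n - 2} \<subseteq> {1..<n}" by auto
    then have "set (i # xs) \<subseteq> {1..<n}" using Cons.prems by (rule subset_trans[rotated])
    then have sub: "set [i] \<subseteq> {1..<n}" "set xs \<subseteq> {1..<n}" by auto
    have c: "rho n [i] \<in> carrier (VT n)" "rho n xs \<in> carrier (VT n)" using sub rho_closed by blast+
    have r: "rho n (i # xs) = rho n [i] \<otimes>\<^bsub>VT n\<^esub> rho n xs" using rho_append[OF sub] by simp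
    have "rho n (i # xs) \<otimes>\<^bsub>VT n\<^esub> lam n (n - 1) = rho n [i] \<otimes>\<^bsub>VT n\<^esub> lam n (n - 1) \<otimes>\<^bsub>VT n\<^esub> rho n xs"
      unfolding r using c l Cons by (simp add: VT.m_assoc)
    also have "rho n [i] \<otimes>\<^bsub>VT n\<^esub> lam n (n - 1) = lam n (n - 1) \<otimes>\<^bsub>VT n\<^esub> rho n [i]"
      using Cons.prems n5 by (intro S_Rho_far[symmetric]) auto
    finally show ?case unfolding r using c l by (simp add: VT.m_assoc)
  qed
  moreover have "{1..<n - 2} \<subseteq> {1..<n}" by auto
  then have "set xs \<subseteq> {1..<n}" by (rule subset_trans[OF xs(1)])
  ultimately show ?thesis using sym_emb_rho[of xs n] xs(2) by simp
qed

lemma lam_last: "lam n (n - 1) \<in> carrier (VT n)"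
  using n5 by (intro lam_closed) auto

lemma ex_perm_pair:
  assumes "x \<in> {1..n}" "y \<in> {1..n}" "x \<noteq> y"
  obtains p where "p permutes {1..n}" "p (n - 1) = x" "p n = y"
proof -
  have n1: "n - 1 \<noteq> n" using n5 by simp
  obtain p where p: "p permutes {1..n}" "\<And>t. t \<in> {n - 1, n} \<Longrightarrow> p t = (if t = n then y else x)"
    by (rule permutes_extend[of "{1..n}" "{n - 1, n}" "\<lambda>t. if t = n then y else x"])
       (use assms n5 in \<open>auto simp: inj_on_def\<close>)
  then show thesis using that[OF p(1)] p(2)[of n] p(2)[of "n - 1"] n1 by simp
qed

lemma Lam_eq:
  assumes p: "p permutes {1..n}"
  shows "sym_emb n p \<otimes>\<^bsub>VT n\<^esub> lam n (n - 1) \<otimes>\<^bsub>VT n\<^esub> inv\<^bsub>VT n\<^esub> sym_emb n p = Lam n (p (n - 1)) (p n)"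
proof -
  let ?P = "\<lambda>q. q permutes {1..n} \<and> q (n - 1) = p (n - 1) \<and> q n = p n"
  define q where "q = (SOME q. ?P q)"
  have "?P q" unfolding q_def by (rule someI[of ?P p]) (use p in simp)
  then have q: "q permutes {1..n}" "q (n - 1) = p (n - 1)" "q n = p n" by auto
  let ?d = "inv' p \<circ> q"
  have d: "?d permutes {1..n}" "?d (n - 1) = n - 1" "?d n = n"
    using q p permutes_compose[OF q(1) permutes_inv[OF p]] permutes_inverses(2)[OF p] by auto
  have "q = p \<circ> ?d" using permutes_inverses(1)[OF p] by (auto simp: fun_eq_iff)
  then have r: "sym_emb n q = sym_emb n p \<otimes>\<^bsub>VT n\<^esub> sym_emb n ?d" using sym_emb_mult[OF p d(1)] by simp
  have c: "sym_emb n p \<in> carrier (VT n)" "sym_emb n ?d \<in> carrier (VT n)"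
    using sym_emb_closed p d(1) by auto
  have "sym_emb n q \<otimes>\<^bsub>VT n\<^esub> lam n (n - 1) \<otimes>\<^bsub>VT n\<^esub> inv\<^bsub>VT n\<^esub> sym_emb n q
      = sym_emb n p \<otimes>\<^bsub>VT n\<^esub> (sym_emb n ?d \<otimes>\<^bsub>VT n\<^esub> lam n (n - 1)) \<otimes>\<^bsub>VT n\<^esub> inv\<^bsub>VT n\<^esub> sym_emb n ?d
          \<otimes>\<^bsub>VT n\<^esub> inv\<^bsub>VT n\<^esub> sym_emb n p"
    unfolding r using c lam_last by (simp add: VT.m_assoc VT.inv_mult_group)
  also have "\<dots> = sym_emb n p \<otimes>\<^bsub>VT n\<^esub> lam n (n - 1) \<otimes>\<^bsub>VT n\<^esub> inv\<^bsub>VT n\<^esub> sym_emb n p"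
    unfolding sym_emb_stabilizer[OF d] using c lam_last by (simp add: VT.m_assoc)
  finally show ?thesis unfolding Lam_def Let_def q_def by simp
qed

lemma Lam_closed:
  assumes "x \<in> {1..n}" "y \<in> {1..n}" "x \<noteq> y"
  shows "Lam n x y \<in> carrier (VT n)"
proof -
  obtain p where p: "p permutes {1..n}" "p (n - 1) = x" "p n = y" using ex_perm_pair[OF assms] .
  then show ?thesis using Lam_eq[OF p(1)] sym_emb_closed[OF p(1)] lam_last by (metis VT.inv_closed VT.m_closed)
qed

lemma Lam_conj:
  assumes q: "q permutes {1..n}" and xy: "x \<in> {1..n}" "y \<in> {1..n}" "x \<noteq> y"
  shows "sym_emb n q \<otimes>\<^bsub>VT n\<^esub> Lam n x y \<otimes>\<^bsub>VT n\<^esub> inv\<^bsub>VT n\<^esub> sym_emb n q = Lam n (q x) (q y)"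
proof -
  obtain p where p: "p permutes {1..n}" "p (n - 1) = x" "p n = y" using ex_perm_pair[OF xy] .
  have c: "sym_emb n p \<in> carrier (VT n)" "sym_emb n q \<in> carrier (VT n)" using sym_emb_closed p(1) q by auto
  have "Lam n (q x) (q y) = sym_emb n (q \<circ> p) \<otimes>\<^bsub>VT n\<^esub> lam n (n - 1) \<otimes>\<^bsub>VT n\<^esub> inv\<^bsub>VT n\<^esub> sym_emb n (q \<circ> p)"
    using Lam_eq[OF permutes_compose[OF p(1) q]] p by simp
  also have "\<dots> = sym_emb n q \<otimes>\<^bsub>VT n\<^esub>
      (sym_emb n p \<otimes>\<^bsub>VT n\<^esub> lam n (n - 1) \<otimes>\<^bsub>VT n\<^esub> inv\<^bsub>VT n\<^esub> sym_emb n p) \<otimes>\<^bsub>VT n\<^esub> inv\<^bsub>VT n\<^esub> sym_emb n q"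
    unfolding sym_emb_mult[OF q p(1)] using c lam_last by (simp add: VT.m_assoc VT.inv_mult_group)
  finally show ?thesis unfolding Lam_eq[OF p(1)] p(2,3) by simp
qed

lemma rho_involution: "i \<in> {1..<n} \<Longrightarrow> inv\<^bsub>VT n\<^esub> rho n [i] = rho n [i]"
  using rho_rev[of "[i]" n] by simp

lemma S_involution:
  assumes "i \<in> {1..<n}" shows "inv\<^bsub>VT n\<^esub> vt_elem n [S i] = vt_elem n [S i]"
proof -
  have "vt_elem n [S i] \<otimes>\<^bsub>VT n\<^esub> vt_elem n [S i] = \<one>\<^bsub>VT n\<^esub>"
    using vt_rel[OF vt_rels.intros(1)[OF assms]] vt_elem_mult[of "[S i]" n "[S i]"] assms vt_elem_Nil by simp
  then show ?thesis using assms by (intro VT.inv_equality vt_elem_carrier) auto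
qed

lemma lam_S_rho:
  assumes "i \<in> {1..<n}" shows "lam n i = vt_elem n [S i] \<otimes>\<^bsub>VT n\<^esub> rho n [i]"
  unfolding lam_def rho_def using assms vt_elem_mult[of "[S i]" n "[Rho i]"] by simp

lemma S_closed: "i \<in> {1..<n} \<Longrightarrow> vt_elem n [S i] \<in> carrier (VT n)"
  by (intro vt_elem_carrier) auto

lemma rho1_closed: "i \<in> {1..<n} \<Longrightarrow> rho n [i] \<in> carrier (VT n)"
  by (intro rho_closed) auto

text \<open>Precompose with the transposition of \<open>n - 1\<close> and \<open>n\<close>: as
  \<open>lam\<close> is \<open>s rho\<close> with involutions \<open>s\<close> and
  \<open>rho\<close>, conjugating it by \<open>rho\<close> gives \<open>rho s\<close>, its
  inverse.\<close>

lemma Lam_flip: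
  assumes xy: "x \<in> {1..n}" "y \<in> {1..n}" "x \<noteq> y"
  shows "Lam n y x = inv\<^bsub>VT n\<^esub> Lam n x y"
proof -
  obtain p where p: "p permutes {1..n}" "p (n - 1) = x" "p n = y" using ex_perm_pair[OF xy] .
  define i where "i = n - 1"
  have i: "i \<in> {1..<n}" "i + 1 = n" using n5 by (auto simp: i_def)
  note p = p[folded i_def] and Lam_eq' = Lam_eq[folded i_def]
  have t: "perm_of [i] permutes {1..n}" using i by (intro perm_of_permutes) auto
  have q: "(p \<circ> perm_of [i]) i = y" "(p \<circ> perm_of [i]) n = x"
    using p(2,3) i by (auto simp: perm_of_Cons transpose_def)
  note c = rho1_closed[OF i(1)] S_closed[OF i(1)] sym_emb_closed[OF p(1)] lam_last[folded i_def]
  have "sym_emb n (perm_of [i]) = rho n [i]" using i(1) by (intro sym_emb_rho) auto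
  then have r: "sym_emb n (p \<circ> perm_of [i]) = sym_emb n p \<otimes>\<^bsub>VT n\<^esub> rho n [i]"
    using sym_emb_mult[OF p(1) t] by simp
  have "rho n [i] \<otimes>\<^bsub>VT n\<^esub> rho n [i] = \<one>\<^bsub>VT n\<^esub>" using rho_involution[OF i(1)] VT.r_inv[OF c(1)] by simp
  moreover have "inv\<^bsub>VT n\<^esub> lam n i = rho n [i] \<otimes>\<^bsub>VT n\<^esub> vt_elem n [S i]"
    unfolding lam_S_rho[OF i(1)] using c by (simp add: VT.inv_mult_group rho_involution[OF i(1)] S_involution[OF i(1)])
  ultimately have l: "rho n [i] \<otimes>\<^bsub>VT n\<^esub> lam n i \<otimes>\<^bsub>VT n\<^esub> rho n [i] = inv\<^bsub>VT n\<^esub> lam n i"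
    unfolding lam_S_rho[OF i(1)] using c by (simp add: VT.m_assoc)
  have "Lam n y x = sym_emb n p \<otimes>\<^bsub>VT n\<^esub> (rho n [i] \<otimes>\<^bsub>VT n\<^esub> lam n i \<otimes>\<^bsub>VT n\<^esub> rho n [i])
      \<otimes>\<^bsub>VT n\<^esub> inv\<^bsub>VT n\<^esub> sym_emb n p"
    using Lam_eq'[OF permutes_compose[OF t p(1)]] c
    unfolding q r by (simp add: VT.m_assoc VT.inv_mult_group rho_involution[OF i(1)])
  also have "\<dots> = inv\<^bsub>VT n\<^esub> (sym_emb n p \<otimes>\<^bsub>VT n\<^esub> lam n i \<otimes>\<^bsub>VT n\<^esub> inv\<^bsub>VT n\<^esub> sym_emb n p)"
    unfolding l using c by (simp add: VT.m_assoc VT.inv_mult_group)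
  finally show ?thesis unfolding Lam_eq'[OF p(1)] p(2,3) .
qed

text \<open>Descending induction from \<open>n - 1\<close>, where the identity serves in
  \<open>Lam_eq\<close>. By the braid and the mixed relation \<open>?w\<close> conjugates
  \<open>lam n i\<close> to \<open>lam n (i + 1)\<close>, and the inverse of \<open>?w\<close> lifts
  a permutation taking \<open>i + 1, i + 2\<close> to \<open>i, i + 1\<close>.\<close>

lemma lam_Lam: "i \<in> {1..<n} \<Longrightarrow> lam n i = Lam n i (i + 1)"
proof -
  assume i: "i \<in> {1..<n}"
  then have "i \<le> n - 1" "1 \<le> i" by auto
  then show ?thesis
  proof (induction rule: inc_induct)
    case base
    show ?case using Lam_eq[OF permutes_id] sym_emb_id[of n] lam_last n5 by simp
  next
    case (step i)
    then have i: "i \<in> {1..<n}" "i + 1 \<in> {1..<n}" "i + 2 \<le> n" using n5 by auto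
    let ?w = "rho n [i] \<otimes>\<^bsub>VT n\<^esub> rho n [i + 1]" and ?q = "perm_of [i + 1, i]"
    note c = rho1_closed[OF i(1)] rho1_closed[OF i(2)] S_closed[OF i(1)] S_closed[OF i(2)]
      lam_closed[OF i(1)] lam_closed[OF i(2)]
    have w: "?w = rho n [i, i + 1]" using rho_append[of "[i]" n "[i + 1]"] i by simp
    have "?w \<otimes>\<^bsub>VT n\<^esub> vt_elem n [S i] = vt_elem n [S (i + 1)] \<otimes>\<^bsub>VT n\<^esub> ?w"
      using vt_rel[OF vt_rels.intros(7)[of i n]] i vt_elem_mult[of "[Rho i, Rho (i + 1)]" n "[S i]"]
       vt_elem_mult[of "[S (i + 1)]" n "[Rho i, Rho (i + 1)]"]
      unfolding w by (simp add: rho_def)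
    moreover have "?w \<otimes>\<^bsub>VT n\<^esub> rho n [i] = rho n [i + 1] \<otimes>\<^bsub>VT n\<^esub> ?w"
      using rho_braid[of i n] i rho_append[of "[i, i + 1]" n "[i]"] rho_append[of "[i + 1]" n "[i, i + 1]"]
      unfolding w by simp
    ultimately have "?w \<otimes>\<^bsub>VT n\<^esub> lam n i = lam n (i + 1) \<otimes>\<^bsub>VT n\<^esub> ?w"
      unfolding lam_S_rho[OF i(1)] lam_S_rho[OF i(2)] using c
      by (metis VT.m_assoc VT.m_closed)
    then have "lam n i = inv\<^bsub>VT n\<^esub> ?w \<otimes>\<^bsub>VT n\<^esub> lam n (i + 1) \<otimes>\<^bsub>VT n\<^esub> ?w"
      using c by (simp add: VT.m_assoc VT.inv_solve_left)
    moreover have "sym_emb n ?q = inv\<^bsub>VT n\<^esub> ?w"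
      unfolding w using sym_emb_rho[of "[i + 1, i]" n] rho_rev[of "[i, i + 1]" n] i by simp
    ultimately have "lam n i = sym_emb n ?q \<otimes>\<^bsub>VT n\<^esub> Lam n (i + 1) (i + 2) \<otimes>\<^bsub>VT n\<^esub> inv\<^bsub>VT n\<^esub> sym_emb n ?q"
      using step.IH c by simp
    also have "\<dots> = Lam n (?q (i + 1)) (?q (i + 2))"
      using i by (intro Lam_conj perm_of_permutes) auto
    finally show ?case by (simp add: perm_of_Cons transpose_def)
  qed
qed

text \<open>The conjugating word is a descending run whose permutation fixes \<open>i\<close> and
  takes \<open>i + 1\<close> to \<open>j\<close>.\<close>

lemma pvt_gen_Lam:
  assumes ij: "1 \<le> i" "i < j" "j \<le> n"
  shows "pvt_gen n i j = Lam n i j"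
proof -
  let ?u = "[i + 1..<j]"
  have u: "set (rev ?u) \<subseteq> {1..<n}" "set ?u \<subseteq> {1..<n}" "i \<in> {1..<n}" using ij by auto
  have sub: "set (map Rho (rev ?u)) \<subseteq> vt_gens n" "set (map Rho ?u) \<subseteq> vt_gens n" "set [S i, Rho i] \<subseteq> vt_gens n"
    using u by auto
  have "pvt_gen n i j = rho n (rev ?u) \<otimes>\<^bsub>VT n\<^esub> (lam n i \<otimes>\<^bsub>VT n\<^esub> rho n ?u)"
    unfolding pvt_gen_def rho_def lam_def using sub by (simp add: vt_elem_mult del: set_map set_rev)
  also have "rho n ?u = inv\<^bsub>VT n\<^esub> rho n (rev ?u)" using rho_rev[OF u(1)] by simp
  also have "rho n (rev ?u) = sym_emb n (perm_of (rev ?u))" using sym_emb_rho[OF u(1)] by simp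
  finally have "pvt_gen n i j = sym_emb n (perm_of (rev ?u)) \<otimes>\<^bsub>VT n\<^esub> lam n i \<otimes>\<^bsub>VT n\<^esub> inv\<^bsub>VT n\<^esub> sym_emb n (perm_of (rev ?u))"
    using sym_emb_closed[OF perm_of_permutes[OF u(1)]] lam_closed[OF u(3)] by (simp add: VT.m_assoc)
  also have "\<dots> = Lam n (perm_of (rev ?u) i) (perm_of (rev ?u) (i + 1))"
    unfolding lam_Lam[OF u(3)] by (rule Lam_conj[OF perm_of_permutes[OF u(1)]]) (use ij in auto)
  also have "perm_of (rev ?u) i = i" by (rule perm_of_desc_less) simp
  also have "perm_of (rev ?u) (i + 1) = j" by (rule perm_of_desc) (use ij in simp)
  finally show ?thesis .
qed

lemma Lam_commute:
  assumes "x \<in> {1..n}" "y \<in> {1..n}" "x \<noteq> y" "z \<in> {1..n}" "w \<in> {1..n}" "z \<noteq> w" "{x, y} \<inter> {z, w} = {}"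
  shows "Lam n x y \<otimes>\<^bsub>VT n\<^esub> Lam n z w = Lam n z w \<otimes>\<^bsub>VT n\<^esub> Lam n x y"
proof -
  \<comment> \<open>\<open>lam n (n - 3)\<close> and \<open>lam n (n - 1)\<close> are the model for
    two disjoint index pairs; a permutation transports it to the given ones.\<close>
  define m where "m = n - 3"
  have m: "n = m + 3" "n - 1 = m + 2" "2 \<le> m" using n5 by (auto simp: m_def)
  have d: "x \<noteq> z" "x \<noteq> w" "y \<noteq> z" "y \<noteq> w" "x \<noteq> y" "z \<noteq> w" using assms by auto
  let ?f = "\<lambda>t. if t = m + 3 then y else if t = m + 2 then x else if t = m + 1 then w else z"
  obtain q where q: "q permutes {1..n}" "\<And>t. t \<in> {m, m + 1, m + 2, m + 3} \<Longrightarrow> q t = ?f t"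
  proof (rule permutes_extend[of "{1..n}" "{m, m + 1, m + 2, m + 3}" ?f])
    show "inj_on ?f {m, m + 1, m + 2, m + 3}" using d by simp
    show "{m, m + 1, m + 2, m + 3} \<subseteq> {1..n}" using m by auto
    show "?f ` {m, m + 1, m + 2, m + 3} \<subseteq> {1..n}" using assms by simp
  qed (use that in auto)
  have qv: "q (m + 3) = y" "q (m + 2) = x" "q (m + 1) = w" "q m = z"
    using q(2)[of "m + 3"] q(2)[of "m + 2"] q(2)[of "m + 1"] q(2)[of m] by simp_all
  have "lam n (m + 2) \<otimes>\<^bsub>VT n\<^esub> lam n m = lam n m \<otimes>\<^bsub>VT n\<^esub> lam n (m + 2)"
    using m by (intro lam_far) auto
  moreover have i2: "m + 2 \<in> {1..<n}" "m \<in> {1..<n}" and s: "m + 2 + 1 = m + 3" using m by auto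
  ultimately have b: "Lam n (m + 2) (m + 3) \<otimes>\<^bsub>VT n\<^esub> Lam n m (m + 1) = Lam n m (m + 1) \<otimes>\<^bsub>VT n\<^esub> Lam n (m + 2) (m + 3)"
    using lam_Lam[OF i2(1), unfolded s] lam_Lam[OF i2(2)] by (simp only:)
  have ix: "m \<in> {1..n}" "m + 1 \<in> {1..n}" "m + 2 \<in> {1..n}" "m + 3 \<in> {1..n}" using m by auto
  have e: "Lam n x y = sym_emb n q \<otimes>\<^bsub>VT n\<^esub> Lam n (m + 2) (m + 3) \<otimes>\<^bsub>VT n\<^esub> inv\<^bsub>VT n\<^esub> sym_emb n q"
    "Lam n z w = sym_emb n q \<otimes>\<^bsub>VT n\<^esub> Lam n m (m + 1) \<otimes>\<^bsub>VT n\<^esub> inv\<^bsub>VT n\<^esub> sym_emb n q"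
    using Lam_conj[OF q(1) ix(3,4)] Lam_conj[OF q(1) ix(1,2)] qv by simp_all
  have c: "sym_emb n q \<in> carrier (VT n)" "Lam n (m + 2) (m + 3) \<in> carrier (VT n)" "Lam n m (m + 1) \<in> carrier (VT n)"
    using sym_emb_closed[OF q(1)] Lam_closed[OF ix(3,4)] Lam_closed[OF ix(1,2)] by simp_all
  show ?thesis unfolding e using VT.conj_commute[of "inv\<^bsub>VT n\<^esub> sym_emb n q", OF _ c(2,3) b] c(1) by simp
qed

lemma Lam_PVT:
  assumes "x \<in> {1..n}" "y \<in> {1..n}" "x \<noteq> y"
  shows "Lam n x y \<in> carrier (PVT n)"
proof (cases "x < y")
  case True
  then have "pvt_gen n x y \<in> pvt_gens n" using assms by (auto simp: pvt_gens_def)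
  then have "Lam n x y \<in> pvt_gens n" using pvt_gen_Lam[of x y] assms True by simp
  then show ?thesis using pvt_gens_subset by blast
next
  case False
  then have "y < x" using assms by simp
  then have "pvt_gen n y x \<in> pvt_gens n" using assms by (auto simp: pvt_gens_def)
  then have "Lam n y x \<in> pvt_gens n" using pvt_gen_Lam[of y x] assms False by simp
  then have P: "Lam n y x \<in> carrier (PVT n)" using pvt_gens_subset by blast
  interpret h: group_hom "VT n" "sym_group n" "vt_to_sym n"
    by (simp add: group_hom_def group_hom_axioms_def VT_group sym_group_is_group vt_to_sym_hom)
  have "inv\<^bsub>VT n\<^esub> Lam n y x \<in> carrier (PVT n)"
    using subgroup.m_inv_closed[OF h.subgroup_kernel] P by (simp add: PVT_def)
  then show ?thesis using Lam_flip[of y x] assms by simp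
qed

end

section \<open>The right-angled Artin presentation of the pure virtual twin group\<close>

lemma presented_group_inv_gen:
  "x \<in> X \<Longrightarrow> inv\<^bsub>presented_group X R\<^esub> word_class X R [(x, True)] = word_class X R [(x, False)]"
proof (rule group.inv_equality[OF presented_group_group])
  assume x: "x \<in> X"
  have "word_eq X R ([] @ [(x, False), (x, \<not> False)] @ []) ([] @ [])" using x by (intro word_cancel) auto
  then have "word_class X R [(x, False), (x, True)] = word_class X R []" by (intro word_class_eqI) simp
  then show "word_class X R [(x, False)] \<otimes>\<^bsub>presented_group X R\<^esub> word_class X R [(x, True)] = \<one>\<^bsub>presented_group X R\<^esub>"
    using x by (simp add: presented_group_mult) (simp add: presented_group_def)
qed (auto simp: presented_group_def)

lemma presented_group_word_eval:
  "w \<in> words X \<Longrightarrow> word_eval (presented_group X R) (\<lambda>x. word_class X R [(x, True)]) w = word_class X R w"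
proof (induction w)
  case Nil
  then show ?case by (simp add: word_eval_def presented_group_def)
next
  case (Cons p w)
  obtain x b where p: "p = (x, b)" by (cases p)
  interpret group "presented_group X R" by (rule presented_group_group)
  show ?case
    using Cons p presented_group_mult[of "[p]" X w R]
    by (auto simp: word_eval_Cons presented_group_inv_gen)
qed

text \<open>On the canonical generators the induced homomorphism is the identity.\<close>

lemma raag_presented_group:
  assumes "finite V" "\<And>u v. adj u v \<Longrightarrow> adj v u" "\<And>v. v \<in> V \<Longrightarrow> \<not> adj v v"
  defines "R \<equiv> comm_rels V adj"
  shows "raag (presented_group V R) V adj (\<lambda>v. word_class V R [(v, True)])"
proof -
  interpret P: group "presented_group V R" by (rule presented_group_group)
  let ?g = "\<lambda>v. word_class V R [(v, True)]"
  have g: "?g \<in> V \<rightarrow> carrier (presented_group V R)" by (auto simp: presented_group_def)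
  have c: "?g u \<otimes>\<^bsub>presented_group V R\<^esub> ?g v = ?g v \<otimes>\<^bsub>presented_group V R\<^esub> ?g u"
    if "u \<in> V" "v \<in> V" "adj u v" for u v
  proof -
    have "word_eq V R ([] @ [(u, True), (v, True)] @ []) ([] @ [(v, True), (u, True)] @ [])"
      using that by (intro word_rel) (auto simp: R_def comm_rels_def)
    then show ?thesis using that by (simp add: presented_group_mult word_class_eqI)
  qed
  note resp = P.comm_rels_respected[where adj=adj, OF g c]
  have id: "induced_hom (presented_group V R) ?g x = x" if x: "x \<in> carrier (presented_group V R)" for x
  proof -
    obtain w where w: "w \<in> words V" "x = word_class V R w" using x by (auto simp: presented_group_def)
    show ?thesis unfolding w(2) presented_group_word_eval[OF w(1), symmetric]
      using P.induced_hom_class[OF g _ w(1), of R] resp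
      by (simp add: R_def presented_group_word_eval[OF w(1)])
  qed
  have "induced_hom (presented_group V R) ?g \<in> hom (presented_group V R) (presented_group V R)"
    by (rule P.induced_hom_hom[OF g]) (use resp in \<open>auto simp: R_def\<close>)
  moreover have "bij_betw (induced_hom (presented_group V R) ?g) (carrier (presented_group V R)) (carrier (presented_group V R))
      = bij_betw (\<lambda>x. x) (carrier (presented_group V R)) (carrier (presented_group V R))"
    by (rule bij_betw_cong) (rule id)
  ultimately have "induced_hom (presented_group V R) ?g \<in> iso (presented_group V R) (presented_group V R)"
    by (simp add: iso_def bij_betw_def)
  then show ?thesis
    using assms(1-3) g c P.is_group unfolding raag_def raag_axioms_def R_def by blast
qed

section \<open>The abstract Artin group on pairs with the action of the symmetric group\<close>

definition pairs :: "nat \<Rightarrow> nat set set" where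
  "pairs n = {e. e \<subseteq> {1..n} \<and> card e = 2}"

text \<open>The vertices are unordered pairs; \<open>Min\<close> and \<open>Max\<close> recover the
  index order \<open>i < j\<close>.\<close>

definition pair_gen :: "nat \<Rightarrow> nat set \<Rightarrow> vt_gen word set" where
  "pair_gen n e = pvt_gen n (Min e) (Max e)"

definition artin :: "nat \<Rightarrow> nat set word set monoid" where
  "artin n = presented_group (pairs n) (comm_rels (pairs n) disjnt)"

definition artin_gen :: "nat \<Rightarrow> nat set \<Rightarrow> nat set word set" where
  "artin_gen n e = word_class (pairs n) (comm_rels (pairs n) disjnt) [(e, True)]"

lemma pairsE:
  assumes "e \<in> pairs n"
  obtains x y where "x \<in> {1..n}" "y \<in> {1..n}" "x < y" "e = {x, y}" "Min e = x" "Max e = y"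
proof -
  obtain x y where "e = {x, y}" "x \<noteq> y" using assms by (auto simp: pairs_def card_2_iff)
  then obtain x y where xy: "e = {x, y}" "x < y" by (metis insert_commute nat_neq_iff)
  then have "x \<in> {1..n}" "y \<in> {1..n}" using assms by (auto simp: pairs_def)
  then show thesis using that xy by auto
qed

lemma pairsI: "x \<in> {1..n} \<Longrightarrow> y \<in> {1..n} \<Longrightarrow> x \<noteq> y \<Longrightarrow> {x, y} \<in> pairs n"
  by (auto simp: pairs_def)

lemma finite_pairs: "finite (pairs n)"
  unfolding pairs_def by (rule finite_subset[of _ "Pow {1..n}"]) auto

lemma pairs_not_disjnt: "e \<in> pairs n \<Longrightarrow> \<not> disjnt e e"
  by (auto simp: disjnt_def pairs_def)

lemma raag_artin: "raag (artin n) (pairs n) disjnt (artin_gen n)"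
  unfolding artin_def artin_gen_def
  by (rule raag_presented_group) (rule finite_pairs, erule disjnt_sym, erule pairs_not_disjnt)

lemma (in group) AutoGroup_mult:
  "f \<in> auto G \<Longrightarrow> g \<in> auto G \<Longrightarrow> f \<otimes>\<^bsub>AutoGroup G\<^esub> g = compose (carrier G) f g"
  by (simp add: AutoGroup_def BijGroup_def auto_def)

lemma (in group) auto_compose: "f \<in> auto G \<Longrightarrow> g \<in> auto G \<Longrightarrow> compose (carrier G) f g \<in> auto G"
  using group.is_monoid[OF AutoGroup] monoid.m_closed[of "AutoGroup G" f g] AutoGroup_mult[of f g]
  by (simp add: AutoGroup_def)

lemma image_in_pairs:
  assumes "\<sigma> permutes {1..n}"
  shows "\<sigma> ` e \<in> pairs n \<longleftrightarrow> e \<in> pairs n"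
proof -
  have "\<sigma> ` e \<subseteq> {1..n} \<longleftrightarrow> e \<subseteq> {1..n}" using permutes_in_image[OF assms] by blast
  moreover have "card (\<sigma> ` e) = card e" using permutes_inj[OF assms] by (simp add: card_image inj_on_subset)
  ultimately show ?thesis by (simp add: pairs_def)
qed

lemma raag_graph_aut_image:
  assumes "raag G (pairs n) disjnt \<gamma>" and p: "\<sigma> permutes {1..n}"
  shows "raag.graph_aut (pairs n) disjnt ((`) \<sigma>)"
proof -
  interpret raag G "pairs n" disjnt \<gamma> by (rule assms)
  have "bij_betw ((`) \<sigma>) (pairs n) (pairs n)"
    by (rule bij_betw_byWitness[where f'="(`) (inv' \<sigma>)"])
       (use image_in_pairs[OF p] image_in_pairs[OF permutes_inv[OF p]] in
         \<open>auto simp: image_comp permutes_inv_o[OF p]\<close>)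
  moreover have "disjnt (\<sigma> ` d) (\<sigma> ` e) \<longleftrightarrow> disjnt d e" for d e
    using permutes_inj[OF p] by (auto simp: disjnt_def inj_def)
  ultimately show ?thesis by (simp add: graph_aut_def)
qed

context
  fixes n :: nat
begin

interpretation R: raag "artin n" "pairs n" disjnt "artin_gen n" by (rule raag_artin)

text \<open>The counterpart of \<open>Lam\<close> in the abstract group, with the same sign
  convention.\<close>

definition mu :: "nat \<Rightarrow> nat \<Rightarrow> nat set word set" where
  "mu x y = (if x < y then artin_gen n {x, y} else inv\<^bsub>artin n\<^esub> artin_gen n {x, y})"

text \<open>The inverted pairs are those whose order \<sigma> reverses. With this sign
  \<open>theta \<sigma>\<close> acts on \<open>mu x y\<close> through the indices, as conjugation by
  \<open>sym_emb n \<sigma>\<close> does on \<open>Lam n x y\<close>.\<close>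

definition theta :: "(nat \<Rightarrow> nat) \<Rightarrow> nat set word set \<Rightarrow> nat set word set" where
  "theta \<sigma> = raag.signed (artin n) (pairs n) (artin_gen n) ((`) \<sigma>) {e. \<sigma> (Max e) < \<sigma> (Min e)}"

lemma mu_closed: "x \<in> {1..n} \<Longrightarrow> y \<in> {1..n} \<Longrightarrow> x \<noteq> y \<Longrightarrow> mu x y \<in> carrier (artin n)"
  using R.gen_closed[OF pairsI] by (simp add: mu_def)

lemma mu_flip: "x \<in> {1..n} \<Longrightarrow> y \<in> {1..n} \<Longrightarrow> x \<noteq> y \<Longrightarrow> mu y x = inv\<^bsub>artin n\<^esub> mu x y"
  using R.gen_closed[OF pairsI[of x n y]] by (auto simp: mu_def insert_commute)

lemma artin_gen_mu: "e \<in> pairs n \<Longrightarrow> artin_gen n e = mu (Min e) (Max e)"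
  by (auto simp: mu_def elim!: pairsE)

lemma mu_commute:
  assumes "x \<in> {1..n}" "y \<in> {1..n}" "x \<noteq> y" "z \<in> {1..n}" "w \<in> {1..n}" "z \<noteq> w" "{x, y} \<inter> {z, w} = {}"
  shows "mu x y \<otimes>\<^bsub>artin n\<^esub> mu z w = mu z w \<otimes>\<^bsub>artin n\<^esub> mu x y"
proof -
  have g: "artin_gen n {x, y} \<in> carrier (artin n)" "artin_gen n {z, w} \<in> carrier (artin n)"
    using assms by (auto intro!: R.gen_closed pairsI)
  have c: "artin_gen n {x, y} \<otimes>\<^bsub>artin n\<^esub> artin_gen n {z, w} = artin_gen n {z, w} \<otimes>\<^bsub>artin n\<^esub> artin_gen n {x, y}"
    using assms by (intro R.gen_commute) (auto intro!: pairsI simp: disjnt_def)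
  show ?thesis using R.spow_commute[OF g c, of "\<not> x < y" "\<not> z < w"]
    by (simp add: mu_def R.spow_def split: if_splits)
qed

lemma theta_auto: "\<sigma> permutes {1..n} \<Longrightarrow> theta \<sigma> \<in> auto (artin n)"
  unfolding theta_def by (rule R.signed_auto_mem[OF raag_graph_aut_image[OF raag_artin]])

lemma theta_hom: "\<sigma> permutes {1..n} \<Longrightarrow> theta \<sigma> \<in> hom (artin n) (artin n)"
  using R.autoD(1)[OF theta_auto] .

lemma theta_mu:
  assumes s: "\<sigma> permutes {1..n}" and xy: "x \<in> {1..n}" "y \<in> {1..n}" "x \<noteq> y"
  shows "theta \<sigma> (mu x y) = mu (\<sigma> x) (\<sigma> y)"
proof -
  interpret t: group_hom "artin n" "artin n" "theta \<sigma>"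
    by (simp add: group_hom_def group_hom_axioms_def R.is_group theta_hom[OF s])
  have *: "theta \<sigma> (mu x y) = mu (\<sigma> x) (\<sigma> y)" if "x \<in> {1..n}" "y \<in> {1..n}" "x < y" for x y
  proof -
    have e: "{x, y} \<in> pairs n" using that by (intro pairsI) auto
    have "\<sigma> x \<noteq> \<sigma> y" using that permutes_inj[OF s] by (auto simp: inj_eq)
    moreover have "theta \<sigma> (mu x y) = R.spow (\<sigma> y < \<sigma> x) (artin_gen n {\<sigma> x, \<sigma> y})"
      using R.signed_gen[OF raag_graph_aut_image[OF raag_artin s] e] that by (simp add: theta_def mu_def)
    ultimately show ?thesis by (auto simp: R.spow_def mu_def)
  qed
  show ?thesis
  proof (cases "x < y")
    case False
    then have "y < x" using xy by simp
    moreover have "\<sigma> x \<in> {1..n}" "\<sigma> y \<in> {1..n}" "\<sigma> x \<noteq> \<sigma> y"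
      using xy permutes_in_image[OF s] permutes_inj[OF s] by (auto simp: inj_eq simp del: atLeastAtMost_iff)
    ultimately show ?thesis
      using *[of y x] mu_flip[of y x] mu_flip[of "\<sigma> y" "\<sigma> x"] xy mu_closed[of y x] by simp
  qed (use * xy in auto)
qed

lemma theta_compose:
  assumes s: "\<sigma> permutes {1..n}" and t: "\<tau> permutes {1..n}"
  shows "theta (\<sigma> \<circ> \<tau>) = compose (carrier (artin n)) (theta \<sigma>) (theta \<tau>)"
proof (rule R.auto_eqI[OF theta_auto[OF permutes_compose[OF t s]] R.auto_compose[OF theta_auto[OF s] theta_auto[OF t]]])
  fix e assume e: "e \<in> pairs n"
  then obtain x y where xy: "x \<in> {1..n}" "y \<in> {1..n}" "x < y" "e = {x, y}" by (elim pairsE)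
  then have g: "artin_gen n e = mu x y" by (simp add: mu_def)
  have "\<tau> x \<in> {1..n}" "\<tau> y \<in> {1..n}" "\<tau> x \<noteq> \<tau> y"
    using xy permutes_in_image[OF t] permutes_inj[OF t] by (auto simp: inj_eq simp del: atLeastAtMost_iff)
  then show "theta (\<sigma> \<circ> \<tau>) (artin_gen n e) = compose (carrier (artin n)) (theta \<sigma>) (theta \<tau>) (artin_gen n e)"
    unfolding g
    using xy(1-3) theta_mu[OF permutes_compose[OF t s]] theta_mu[OF t] theta_mu[OF s] mu_closed[of x y]
    by (simp add: compose_def)
qed

lemma theta_one: "\<sigma> permutes {1..n} \<Longrightarrow> theta \<sigma> \<one>\<^bsub>artin n\<^esub> = \<one>\<^bsub>artin n\<^esub>"
  using hom_one[OF theta_hom R.is_group R.is_group] .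

lemma theta_group_hom: "theta \<in> hom (sym_group n) (AutoGroup (artin n))"
proof (rule homI)
  fix \<sigma> \<tau> assume "\<sigma> \<in> carrier (sym_group n)" "\<tau> \<in> carrier (sym_group n)"
  then have *: "\<sigma> permutes {1..n}" "\<tau> permutes {1..n}" by (auto simp: sym_group_carrier)
  show "theta \<sigma> \<in> carrier (AutoGroup (artin n))" using theta_auto[OF *(1)] by (simp add: AutoGroup_def)
  show "theta (\<sigma> \<otimes>\<^bsub>sym_group n\<^esub> \<tau>) = theta \<sigma> \<otimes>\<^bsub>AutoGroup (artin n)\<^esub> theta \<tau>"
    using theta_compose[OF *] R.AutoGroup_mult[OF theta_auto theta_auto] * by (simp add: sym_group_mult)
qed

lemma theta_id: "a \<in> carrier (artin n) \<Longrightarrow> theta id a = a"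
proof -
  assume a: "a \<in> carrier (artin n)"
  have "theta id = (\<lambda>x\<in>carrier (artin n). x)"
    using hom_one[OF theta_group_hom sym_group_is_group R.AutoGroup]
    by (simp add: sym_group_one AutoGroup_def BijGroup_def)
  then show ?thesis using a by simp
qed

section \<open>The map from the virtual twin group to a semidirect product\<close>

definition semi :: "(nat set word set \<times> (nat \<Rightarrow> nat)) monoid" where
  "semi = semidirect_product (artin n) (sym_group n) theta"

lemma semi_group: "group semi"
  unfolding semi_def by (rule semidirect_product_group[OF R.is_group sym_group_is_group theta_group_hom])

lemma semi_mult: "(a, p) \<otimes>\<^bsub>semi\<^esub> (b, q) = (a \<otimes>\<^bsub>artin n\<^esub> theta p b, p \<circ> q)"
  and semi_one: "\<one>\<^bsub>semi\<^esub> = (\<one>\<^bsub>artin n\<^esub>, id)"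
  and semi_carrier: "(a, p) \<in> carrier semi \<longleftrightarrow> a \<in> carrier (artin n) \<and> p permutes {1..n}"
  by (simp_all add: semi_def semidirect_product_def sym_group_mult sym_group_one sym_group_carrier)

text \<open>As \<open>lam n i\<close> is the product of \<open>S i\<close> and the involution
  \<open>Rho i\<close>, the image of \<open>S i\<close> has to be that of \<open>lam n i\<close>
  times that of \<open>Rho i\<close>.\<close>

fun vt_img :: "vt_gen \<Rightarrow> nat set word set \<times> (nat \<Rightarrow> nat)" where
  "vt_img (S i) = (mu i (i + 1), transpose i (i + 1))"
| "vt_img (Rho i) = (\<one>\<^bsub>artin n\<^esub>, transpose i (i + 1))"

abbreviation vt_eval :: "vt_gen list \<Rightarrow> nat set word set \<times> (nat \<Rightarrow> nat)" where
  "vt_eval xs \<equiv> word_eval semi vt_img (pos_word xs)"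

lemma vt_eval_Nil: "vt_eval [] = (\<one>\<^bsub>artin n\<^esub>, id)"
  by (simp add: word_eval_def pos_word_def semi_one)

lemma vt_eval_Cons: "vt_eval (x # xs) = vt_img x \<otimes>\<^bsub>semi\<^esub> vt_eval xs"
  by (simp add: word_eval_def pos_word_def)

lemma transpose_permutes: "i \<in> {1..<n} \<Longrightarrow> transpose i (Suc i) permutes {1..n}"
  by (rule permutes_swap_id) auto

lemma vt_img_closed: "vt_img \<in> vt_gens n \<rightarrow> carrier semi"
proof
  fix x assume "x \<in> vt_gens n"
  then show "vt_img x \<in> carrier semi"
    using transpose_permutes[simplified] mu_closed by (cases x) (auto simp: semi_carrier)
qed

lemma vt_img_rels:
  assumes "(l, r) \<in> vt_word_rels n"
  shows "word_eval semi vt_img l = word_eval semi vt_img r"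
proof -
  obtain xs ys where r: "(xs, ys) \<in> vt_rels n" "l = pos_word xs" "r = pos_word ys" using assms by auto
  note simps = vt_eval_Nil vt_eval_Cons semi_mult theta_one transpose_permutes[simplified] mu_closed
  from r(1) have "vt_eval xs = vt_eval ys"
  proof cases
    case (1 i)
    \<comment> \<open>The transposition exchanges the two indices, so the square of the image is
      \<open>mu i (Suc i)\<close> times its inverse.\<close>
    then have "mu (Suc i) i = inv\<^bsub>artin n\<^esub> mu i (Suc i)" by (intro mu_flip) auto
    then show ?thesis using 1 theta_mu[OF transpose_permutes[of i], of i "Suc i"] by (simp add: simps)
  next
    case (2 i)
    then show ?thesis by (simp add: simps)
  next
    case (3 i j)
    then have "transpose i (Suc i) \<circ> transpose j (Suc j) = transpose j (Suc j) \<circ> transpose i (Suc i)"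
      by (auto simp: fun_eq_iff transpose_def)
    moreover have "mu i (Suc i) \<otimes>\<^bsub>artin n\<^esub> mu j (Suc j) = mu j (Suc j) \<otimes>\<^bsub>artin n\<^esub> mu i (Suc i)"
      using 3 by (intro mu_commute) auto
    moreover have "theta (transpose i (Suc i)) (mu j (Suc j)) = mu j (Suc j)"
      using 3 theta_mu[OF transpose_permutes[of i], of j "Suc j"] by (auto simp: transpose_def)
    moreover have "theta (transpose j (Suc j)) (mu i (Suc i)) = mu i (Suc i)"
      using 3 theta_mu[OF transpose_permutes[of j], of i "Suc i"] by (auto simp: transpose_def)
    ultimately show ?thesis using 3 by (simp add: simps)
  next
    case (4 i j)
    then have "transpose i (Suc i) \<circ> transpose j (Suc j) = transpose j (Suc j) \<circ> transpose i (Suc i)"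
      by (auto simp: fun_eq_iff transpose_def)
    then show ?thesis using 4 by (simp add: simps)
  next
    case (5 i j)
    then have "transpose i (Suc i) \<circ> transpose j (Suc j) = transpose j (Suc j) \<circ> transpose i (Suc i)"
      by (auto simp: fun_eq_iff transpose_def)
    moreover have "theta (transpose i (Suc i)) (mu j (Suc j)) = mu j (Suc j)"
      using 5 theta_mu[OF transpose_permutes[of i], of j "Suc j"] by (auto simp: transpose_def)
    ultimately show ?thesis using 5 by (simp add: simps)
  next
    case (6 i)
    then have "transpose i (Suc i) \<circ> (transpose (Suc i) (Suc (Suc i)) \<circ> transpose i (Suc i))
       = transpose (Suc i) (Suc (Suc i)) \<circ> (transpose i (Suc i) \<circ> transpose (Suc i) (Suc (Suc i)))"
      by (auto simp: fun_eq_iff transpose_def)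
    then show ?thesis using 6 by (simp add: simps)
  next
    case (7 i)
    have p: "transpose i (Suc i) \<circ> (transpose (Suc i) (Suc (Suc i)) \<circ> transpose i (Suc i))
       = transpose (Suc i) (Suc (Suc i)) \<circ> (transpose i (Suc i) \<circ> transpose (Suc i) (Suc (Suc i)))"
      by (auto simp: fun_eq_iff transpose_def)
    \<comment> \<open>The index pair moves from \<open>i, i + 1\<close> through
      \<open>i, i + 2\<close> to \<open>i + 1, i + 2\<close>, the pair of the generator on the other
      side.\<close>
    have "theta (transpose (Suc i) (Suc (Suc i))) (mu i (Suc i)) = mu i (Suc (Suc i))"
      using 7 theta_mu[OF transpose_permutes[of "Suc i"], of i "Suc i"] by (auto simp: transpose_def)
    moreover have "theta (transpose i (Suc i)) (mu i (Suc (Suc i))) = mu (Suc i) (Suc (Suc i))"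
      using 7 theta_mu[OF transpose_permutes[of i], of i "Suc (Suc i)"] by (auto simp: transpose_def)
    ultimately show ?thesis using 7 p by (simp add: simps)
  qed
  then show ?thesis using r(2,3) by simp
qed

definition vt_hom :: "vt_gen word set \<Rightarrow> nat set word set \<times> (nat \<Rightarrow> nat)" where
  "vt_hom = induced_hom semi vt_img"

lemma vt_hom_hom: "vt_hom \<in> hom (VT n) semi"
  unfolding vt_hom_def VT_def
  by (rule group.induced_hom_hom[OF semi_group vt_img_closed]) (rule vt_img_rels)

lemma vt_hom_elem: "set xs \<subseteq> vt_gens n \<Longrightarrow> vt_hom (vt_elem n xs) = vt_eval xs"
  unfolding vt_hom_def vt_elem_def
  by (rule group.induced_hom_class[OF semi_group vt_img_closed]) (auto intro: vt_img_rels)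

lemma vt_hom_rho: "set xs \<subseteq> {1..<n} \<Longrightarrow> vt_hom (rho n xs) = (\<one>\<^bsub>artin n\<^esub>, perm_of xs)"
proof -
  have "set xs \<subseteq> {1..<n} \<Longrightarrow> vt_eval (map Rho xs) = (\<one>\<^bsub>artin n\<^esub>, perm_of xs)"
    by (induction xs)
       (auto simp: vt_eval_Nil vt_eval_Cons semi_mult theta_one transpose_permutes[simplified] perm_of_Cons)
  then show "set xs \<subseteq> {1..<n} \<Longrightarrow> ?thesis" using vt_hom_elem[OF Rho_words] unfolding rho_def by auto
qed

lemma vt_hom_sym_emb:
  assumes "p permutes {1..n}" shows "vt_hom (sym_emb n p) = (\<one>\<^bsub>artin n\<^esub>, p)"
proof -
  obtain xs where "set xs \<subseteq> {1..<n}" "perm_of xs = p" using ex_perm_of[OF assms] by blast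
  then show ?thesis using vt_hom_rho[of xs] sym_emb_rho[of xs n] by simp
qed

lemma vt_hom_lam: "i \<in> {1..<n} \<Longrightarrow> vt_hom (lam n i) = (mu i (i + 1), id)"
  using vt_hom_elem[of "[S i, Rho i]"] unfolding lam_def
  by (simp add: vt_eval_Nil vt_eval_Cons semi_mult theta_one transpose_permutes[simplified] mu_closed)

end

section \<open>Identification of the pure virtual twin group with the Artin group\<close>

lemma PVT_mult: "x \<otimes>\<^bsub>PVT n\<^esub> y = x \<otimes>\<^bsub>VT n\<^esub> y"
  by (simp add: PVT_def)

lemma PVT_subgroup: "subgroup (carrier (PVT n)) (VT n)"
proof -
  interpret h: group_hom "VT n" "sym_group n" "vt_to_sym n"
    by (simp add: group_hom_def group_hom_axioms_def VT_group sym_group_is_group vt_to_sym_hom)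
  show ?thesis using h.subgroup_kernel by (simp add: PVT_def)
qed

lemma PVT_carrier: "x \<in> carrier (PVT n) \<longleftrightarrow> x \<in> carrier (VT n) \<and> vt_to_sym n x = id"
  by (auto simp: PVT_def kernel_def sym_group_one)

context
  fixes n :: nat
  assumes n5: "n \<ge> 5"
begin

interpretation VT: group "VT n" by (rule VT_group)
interpretation P: group "PVT n" by (rule PVT_group)
interpretation R: raag "artin n" "pairs n" disjnt "artin_gen n" by (rule raag_artin)
interpretation M: group "semi n" by (rule semi_group)
interpretation vh: group_hom "VT n" "semi n" "vt_hom n"
  by (simp add: group_hom_def group_hom_axioms_def VT_group semi_group vt_hom_hom)

lemma vt_hom_Lam:
  assumes xy: "x \<in> {1..n}" "y \<in> {1..n}" "x \<noteq> y"
  shows "vt_hom n (Lam n x y) = (mu n x y, id)"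
proof -
  obtain p where p: "p permutes {1..n}" "p (n - 1) = x" "p n = y" using ex_perm_pair[OF n5 xy] .
  have c: "sym_emb n p \<in> carrier (VT n)" "sym_emb n (inv' p) \<in> carrier (VT n)" "lam n (n - 1) \<in> carrier (VT n)"
    using sym_emb_closed p(1) permutes_inv lam_last[OF n5] by auto
  have i: "n - 1 \<in> {1..n}" "n \<in> {1..n}" "n - 1 \<noteq> n" "n - 1 \<in> {1..<n}" "n - 1 + 1 = n" using n5 by auto
  have l: "vt_hom n (lam n (n - 1)) = (mu n (n - 1) n, id)" using vt_hom_lam[OF i(4)] i(5) by simp
  have "Lam n x y = sym_emb n p \<otimes>\<^bsub>VT n\<^esub> lam n (n - 1) \<otimes>\<^bsub>VT n\<^esub> sym_emb n (inv' p)"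
    using Lam_eq[OF n5 p(1)] p sym_emb_inv[OF p(1)] by simp
  then have "vt_hom n (Lam n x y) = (\<one>\<^bsub>artin n\<^esub>, p) \<otimes>\<^bsub>semi n\<^esub> (mu n (n - 1) n, id) \<otimes>\<^bsub>semi n\<^esub> (\<one>\<^bsub>artin n\<^esub>, inv' p)"
    using c vt_hom_sym_emb[OF p(1)] vt_hom_sym_emb[OF permutes_inv[OF p(1)]] l by simp
  also have "\<dots> = (theta n p (mu n (n - 1) n), id)"
    using theta_one[OF p(1)] theta_mu[OF p(1) i(1-3)] mu_closed[OF xy] p
    by (simp add: semi_mult permutes_inv_o)
  finally show ?thesis using theta_mu[OF p(1) i(1-3)] p by simp
qed

lemma pair_gen_Lam:
  assumes "e \<in> pairs n"
  obtains x y where "x \<in> {1..n}" "y \<in> {1..n}" "x < y" "e = {x, y}" "pair_gen n e = Lam n x y"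
    "artin_gen n e = mu n x y"
proof -
  obtain x y where xy: "x \<in> {1..n}" "y \<in> {1..n}" "x < y" "e = {x, y}" "Min e = x" "Max e = y"
    using pairsE[OF assms] .
  then show thesis using that pvt_gen_Lam[OF n5, of x y] artin_gen_mu[OF assms] by (auto simp: pair_gen_def)
qed

lemma pair_gen_closed: "e \<in> pairs n \<Longrightarrow> pair_gen n e \<in> carrier (PVT n)"
  using Lam_PVT[OF n5] by (elim pair_gen_Lam) auto

lemma pair_gen_commute:
  assumes "d \<in> pairs n" "e \<in> pairs n" "disjnt d e"
  shows "pair_gen n d \<otimes>\<^bsub>PVT n\<^esub> pair_gen n e = pair_gen n e \<otimes>\<^bsub>PVT n\<^esub> pair_gen n d"
proof -
  obtain x y where xy: "x \<in> {1..n}" "y \<in> {1..n}" "x < y" "d = {x, y}" "pair_gen n d = Lam n x y"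
    using pair_gen_Lam[OF assms(1)] by metis
  obtain z w where zw: "z \<in> {1..n}" "w \<in> {1..n}" "z < w" "e = {z, w}" "pair_gen n e = Lam n z w"
    using pair_gen_Lam[OF assms(2)] by metis
  show ?thesis unfolding PVT_mult xy(5) zw(5)
    using xy zw assms(3) by (intro Lam_commute[OF n5]) (auto simp: disjnt_def)
qed

definition artin_to_PVT :: "nat set word set \<Rightarrow> vt_gen word set" where
  "artin_to_PVT = induced_hom (PVT n) (pair_gen n)"

lemma pair_gen_funcset: "pair_gen n \<in> pairs n \<rightarrow> carrier (PVT n)"
  using pair_gen_closed by auto

lemma pair_gen_respected:
  "(l, r) \<in> comm_rels (pairs n) disjnt \<Longrightarrow> word_eval (PVT n) (pair_gen n) l = word_eval (PVT n) (pair_gen n) r"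
  by (rule P.comm_rels_respected[where adj=disjnt, OF pair_gen_funcset pair_gen_commute])

lemma artin_to_PVT_hom: "artin_to_PVT \<in> hom (artin n) (PVT n)"
  unfolding artin_to_PVT_def artin_def
  by (rule P.induced_hom_hom[OF pair_gen_funcset])
     (rule pair_gen_respected)

lemma artin_to_PVT_gen: "e \<in> pairs n \<Longrightarrow> artin_to_PVT (artin_gen n e) = pair_gen n e"
proof -
  assume e: "e \<in> pairs n"
  have "induced_hom (PVT n) (pair_gen n) (artin_gen n e) = word_eval (PVT n) (pair_gen n) [(e, True)]"
    unfolding artin_gen_def
    by (rule P.induced_hom_class[OF pair_gen_funcset])
       (use e pair_gen_respected in \<open>simp_all\<close>)
  then show ?thesis using pair_gen_closed[OF e] by (simp add: artin_to_PVT_def word_eval_def)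
qed

text \<open>Both sides are homomorphisms that agree on the generators. As the first component
  returns \<open>x\<close>, \<open>artin_to_PVT\<close> is injective: the pure group has no
  relations beyond commutation.\<close>

lemma artin_to_PVT_section:
  assumes x: "x \<in> carrier (artin n)"
  shows "vt_hom n (artin_to_PVT x) = (x, id)"
proof -
  have h: "(vt_hom n \<circ> artin_to_PVT) \<in> hom (artin n) (semi n)"
  proof (rule homI)
    fix x y assume x: "x \<in> carrier (artin n)" and y: "y \<in> carrier (artin n)"
    have c: "artin_to_PVT x \<in> carrier (VT n)" "artin_to_PVT y \<in> carrier (VT n)"
      using hom_in_carrier[OF artin_to_PVT_hom] x y by (auto simp: PVT_carrier)
    then show "(vt_hom n \<circ> artin_to_PVT) x \<in> carrier (semi n)" by simp
    show "(vt_hom n \<circ> artin_to_PVT) (x \<otimes>\<^bsub>artin n\<^esub> y)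
        = (vt_hom n \<circ> artin_to_PVT) x \<otimes>\<^bsub>semi n\<^esub> (vt_hom n \<circ> artin_to_PVT) y"
      using hom_mult[OF artin_to_PVT_hom x y] c by (simp add: PVT_mult)
  qed
  have i: "(\<lambda>x. (x, id)) \<in> hom (artin n) (semi n)"
    by (rule homI) (auto simp: semi_carrier semi_mult theta_id permutes_id)
  have "(vt_hom n \<circ> artin_to_PVT) x = (x, id)"
  proof (rule R.hom_eqI[OF h i semi_group _ x])
    fix e assume e: "e \<in> pairs n"
    then obtain x y where "x \<in> {1..n}" "y \<in> {1..n}" "x < y" "pair_gen n e = Lam n x y" "artin_gen n e = mu n x y"
      by (elim pair_gen_Lam) blast
    then show "(vt_hom n \<circ> artin_to_PVT) (artin_gen n e) = (artin_gen n e, id)"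
      using artin_to_PVT_gen[OF e] vt_hom_Lam[of x y] by simp
  qed
  then show ?thesis by simp
qed

text \<open>The image \<open>?L\<close> contains every \<open>Lam n x y\<close> and is normalized by
  the lifted permutations. Hence the products of \<open>?L\<close> with these lifts are stable under
  left multiplication by generators and exhaust \<open>VT n\<close>; on a pure element the
  permutation is trivial.\<close>

lemma artin_to_PVT_surj: "artin_to_PVT ` carrier (artin n) = carrier (PVT n)"
proof
  interpret h: group_hom "artin n" "PVT n" artin_to_PVT
    by (simp add: group_hom_def group_hom_axioms_def R.is_group PVT_group artin_to_PVT_hom)
  show "artin_to_PVT ` carrier (artin n) \<subseteq> carrier (PVT n)" using h.hom_closed by blast
  let ?L = "artin_to_PVT ` carrier (artin n)"
  have "subgroup ?L (PVT n)" by (rule h.img_is_subgroup)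
  then have L: "subgroup ?L (VT n)"
    using VT.incl_subgroup[OF PVT_subgroup, of ?L] by (simp add: PVT_def)
  have Lc: "l \<in> carrier (VT n)" if "l \<in> ?L" for l using subgroup.mem_carrier[OF L that] .
  have Lam_L: "Lam n x y \<in> ?L" if xy: "x \<in> {1..n}" "y \<in> {1..n}" "x \<noteq> y" for x y
  proof -
    have *: "Lam n x y \<in> ?L" if "x \<in> {1..n}" "y \<in> {1..n}" "x < y" for x y
    proof -
      have e: "{x, y} \<in> pairs n" using that by (intro pairsI) auto
      have "Lam n x y = artin_to_PVT (artin_gen n {x, y})"
        using artin_to_PVT_gen[OF e] that pvt_gen_Lam[OF n5, of x y] by (simp add: pair_gen_def)
      then show ?thesis using R.gen_closed[OF e] by blast
    qed
    show ?thesis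
    proof (cases "x < y")
      case False
      then have "Lam n y x \<in> ?L" using * xy by simp
      then have "inv\<^bsub>VT n\<^esub> Lam n y x \<in> ?L" by (rule subgroup.m_inv_closed[OF L])
      then show ?thesis using Lam_flip[OF n5, of y x] xy by simp
    qed (use * xy in blast)
  qed
  have conj: "sym_emb n q \<otimes>\<^bsub>VT n\<^esub> l \<otimes>\<^bsub>VT n\<^esub> inv\<^bsub>VT n\<^esub> sym_emb n q \<in> ?L"
    if q: "q permutes {1..n}" and l: "l \<in> ?L" for q l
  proof -
    let ?r = "sym_emb n q"
    have rc: "?r \<in> carrier (VT n)" by (rule sym_emb_closed[OF q])
    have "(\<lambda>x. inv\<^bsub>VT n\<^esub> (inv\<^bsub>VT n\<^esub> ?r) \<otimes>\<^bsub>VT n\<^esub> x \<otimes>\<^bsub>VT n\<^esub> inv\<^bsub>VT n\<^esub> ?r) \<in> hom (VT n) (VT n)"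
      using rc by (intro VT.conj_hom) simp
    then have c: "(\<lambda>x. ?r \<otimes>\<^bsub>VT n\<^esub> x \<otimes>\<^bsub>VT n\<^esub> inv\<^bsub>VT n\<^esub> ?r) \<in> hom (VT n) (VT n)" using rc by simp
    have "artin_to_PVT \<in> hom (artin n) (VT n)"
      using artin_to_PVT_hom by (auto simp: hom_def PVT_mult PVT_carrier)
    \<comment> \<open>Conjugation after \<open>artin_to_PVT\<close> is a homomorphism, so it is
      enough to look at the generators, whose indices are merely permuted.\<close>
    then have h': "(\<lambda>x. ?r \<otimes>\<^bsub>VT n\<^esub> x \<otimes>\<^bsub>VT n\<^esub> inv\<^bsub>VT n\<^esub> ?r) \<circ> artin_to_PVT \<in> hom (artin n) (VT n)"
      using c by (rule Group.hom_compose)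
    have "((\<lambda>x. ?r \<otimes>\<^bsub>VT n\<^esub> x \<otimes>\<^bsub>VT n\<^esub> inv\<^bsub>VT n\<^esub> ?r) \<circ> artin_to_PVT) x \<in> ?L" if x: "x \<in> carrier (artin n)" for x
    proof (rule R.hom_generate_subgroup[OF h' VT_group R.gens_subset[OF order_refl] L])
      fix s assume "s \<in> artin_gen n ` pairs n"
      then obtain e where e: "e \<in> pairs n" "s = artin_gen n e" by blast
      then obtain x y where xy: "x \<in> {1..n}" "y \<in> {1..n}" "x < y" "pair_gen n e = Lam n x y"
        by (elim pair_gen_Lam) blast
      have q': "q x \<in> {1..n}" "q y \<in> {1..n}" "q x \<noteq> q y"
        using xy permutes_in_image[OF q] permutes_inj[OF q] by (auto simp: inj_eq simp del: atLeastAtMost_iff)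
      have "((\<lambda>x. ?r \<otimes>\<^bsub>VT n\<^esub> x \<otimes>\<^bsub>VT n\<^esub> inv\<^bsub>VT n\<^esub> ?r) \<circ> artin_to_PVT) s = Lam n (q x) (q y)"
        using Lam_conj[OF n5 q xy(1,2)] xy(3,4) e(2) artin_to_PVT_gen[OF e(1)] by simp
      then show "((\<lambda>x. ?r \<otimes>\<^bsub>VT n\<^esub> x \<otimes>\<^bsub>VT n\<^esub> inv\<^bsub>VT n\<^esub> ?r) \<circ> artin_to_PVT) s \<in> ?L"
        using Lam_L[OF q'] by simp
    qed (use x R.generate_gens in simp)
    then show ?thesis using l by auto
  qed
  have decomp: "\<exists>l\<in>?L. \<exists>p. p permutes {1..n} \<and> g = l \<otimes>\<^bsub>VT n\<^esub> sym_emb n p" if g: "g \<in> carrier (VT n)" for g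
  proof -
    let ?P = "\<lambda>g. \<exists>l\<in>?L. \<exists>p. p permutes {1..n} \<and> g = l \<otimes>\<^bsub>VT n\<^esub> sym_emb n p"
    have rho_step: "?P (rho n [i] \<otimes>\<^bsub>VT n\<^esub> g)" if i: "i \<in> {1..<n}" and g: "?P g" for i g
    proof -
      obtain l p where l: "l \<in> ?L" "p permutes {1..n}" "g = l \<otimes>\<^bsub>VT n\<^esub> sym_emb n p" using g by blast
      have t: "perm_of [i] permutes {1..n}" using i by (intro perm_of_permutes) auto
      have r: "sym_emb n (perm_of [i]) = rho n [i]" using i by (intro sym_emb_rho) auto
      have c: "l \<in> carrier (VT n)" "rho n [i] \<in> carrier (VT n)" "sym_emb n p \<in> carrier (VT n)"
        using Lc[OF l(1)] rho1_closed[OF n5 i] sym_emb_closed[OF l(2)] by auto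
      have "rho n [i] \<otimes>\<^bsub>VT n\<^esub> g = rho n [i] \<otimes>\<^bsub>VT n\<^esub> l \<otimes>\<^bsub>VT n\<^esub> inv\<^bsub>VT n\<^esub> rho n [i] \<otimes>\<^bsub>VT n\<^esub> sym_emb n (perm_of [i] \<circ> p)"
        unfolding sym_emb_mult[OF t l(2)] r l(3) using c by (simp add: VT.m_assoc)
      then show ?thesis using conj[OF t l(1)] permutes_compose[OF l(2) t] unfolding r by blast
    qed
    \<comment> \<open>\<open>S i\<close> is \<open>lam n i\<close> times \<open>Rho i\<close>, which
      reduces this to the preceding step and to \<open>lam n i\<close> lying in
      \<open>?L\<close>.\<close>
    have S_step: "?P (vt_elem n [S i] \<otimes>\<^bsub>VT n\<^esub> g)" if i: "i \<in> {1..<n}" and g: "?P g" for i g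
    proof -
      obtain l p where l: "l \<in> ?L" "p permutes {1..n}" "rho n [i] \<otimes>\<^bsub>VT n\<^esub> g = l \<otimes>\<^bsub>VT n\<^esub> sym_emb n p"
        using rho_step[OF i g] by blast
      have gc: "g \<in> carrier (VT n)" using g Lc sym_emb_closed by blast
      have c: "l \<in> carrier (VT n)" "rho n [i] \<in> carrier (VT n)" "vt_elem n [S i] \<in> carrier (VT n)"
          "lam n i \<in> carrier (VT n)" "sym_emb n p \<in> carrier (VT n)"
        using Lc[OF l(1)] rho1_closed[OF n5 i] S_closed[OF n5 i] lam_closed[OF i] sym_emb_closed[OF l(2)] by auto
      have "rho n [i] \<otimes>\<^bsub>VT n\<^esub> (rho n [i] \<otimes>\<^bsub>VT n\<^esub> g) = g"
        using rho_involution[OF n5 i] VT.inv_mult_cancel(1)[OF c(2) gc] by simp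
      then have "vt_elem n [S i] \<otimes>\<^bsub>VT n\<^esub> g = lam n i \<otimes>\<^bsub>VT n\<^esub> (rho n [i] \<otimes>\<^bsub>VT n\<^esub> g)"
        unfolding lam_S_rho[OF n5 i] using c gc by (simp add: VT.m_assoc)
      also have "\<dots> = (lam n i \<otimes>\<^bsub>VT n\<^esub> l) \<otimes>\<^bsub>VT n\<^esub> sym_emb n p"
        unfolding l(3) using c by (simp add: VT.m_assoc)
      finally have eq: "vt_elem n [S i] \<otimes>\<^bsub>VT n\<^esub> g = (lam n i \<otimes>\<^bsub>VT n\<^esub> l) \<otimes>\<^bsub>VT n\<^esub> sym_emb n p" .
      have "lam n i \<in> ?L" unfolding lam_Lam[OF n5 i] using i by (intro Lam_L) auto
      then have "lam n i \<otimes>\<^bsub>VT n\<^esub> l \<in> ?L" using l(1) by (rule subgroup.m_closed[OF L])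
      then show ?thesis using eq l(2) by blast
    qed
    \<comment> \<open>The generators are involutions, so an inverse letter of a word acts as the
      letter itself.\<close>
    have gen_step: "?P (word_class (vt_gens n) (vt_word_rels n) [(x, True)] \<otimes>\<^bsub>VT n\<^esub> g)"
      "inv\<^bsub>VT n\<^esub> (word_class (vt_gens n) (vt_word_rels n) [(x, True)]) = word_class (vt_gens n) (vt_word_rels n) [(x, True)]"
      if x: "x \<in> vt_gens n" and g: "?P g" for x g
    proof -
      have e: "word_class (vt_gens n) (vt_word_rels n) [(x, True)] = vt_elem n [x]"
        by (simp add: vt_elem_def pos_word_def)
      show "?P (word_class (vt_gens n) (vt_word_rels n) [(x, True)] \<otimes>\<^bsub>VT n\<^esub> g)"
        unfolding e using x S_step[OF _ g] rho_step[OF _ g] by (cases x) (auto simp: rho_def)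
      show "inv\<^bsub>VT n\<^esub> (word_class (vt_gens n) (vt_word_rels n) [(x, True)]) = word_class (vt_gens n) (vt_word_rels n) [(x, True)]"
        unfolding e using x S_involution[OF n5] rho_involution[OF n5] by (cases x) (auto simp: rho_def)
    qed
    obtain w where w: "w \<in> words (vt_gens n)" "g = word_class (vt_gens n) (vt_word_rels n) w"
      using g by (auto simp: VT_def presented_group_def)
    have "?P (word_eval (VT n) (\<lambda>x. word_class (vt_gens n) (vt_word_rels n) [(x, True)]) w)"
      using w(1)
    proof (induction w)
      case Nil
      have "\<one>\<^bsub>VT n\<^esub> = \<one>\<^bsub>VT n\<^esub> \<otimes>\<^bsub>VT n\<^esub> sym_emb n id" by (simp add: sym_emb_id)
      then show ?case using subgroup.one_closed[OF L] permutes_id unfolding word_eval_def by fastforce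
    next
      case (Cons p w)
      obtain x b where p: "p = (x, b)" by (cases p)
      then have "x \<in> vt_gens n" "w \<in> words (vt_gens n)" using Cons.prems by auto
      then show ?case using gen_step[OF _ Cons.IH] p by (auto simp: VT.word_eval_Cons)
    qed
    then show ?thesis
      unfolding w(2) using presented_group_word_eval[OF w(1), of "vt_word_rels n"] by (simp add: VT_def)
  qed
  show "carrier (PVT n) \<subseteq> ?L"
  proof
    fix g assume "g \<in> carrier (PVT n)"
    then have g: "g \<in> carrier (VT n)" "vt_to_sym n g = id" by (auto simp: PVT_carrier)
    obtain l p where l: "l \<in> ?L" "p permutes {1..n}" "g = l \<otimes>\<^bsub>VT n\<^esub> sym_emb n p" using decomp[OF g(1)] by blast
    have "l \<in> carrier (PVT n)" using l(1) h.hom_closed by blast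
    then have "vt_to_sym n l = id" by (simp add: PVT_carrier)
    then have "p = id"
      using g(2) hom_mult[OF vt_to_sym_hom Lc[OF l(1)] sym_emb_closed[OF l(2)]] vt_to_sym_emb[OF l(2)]
      by (simp add: l(3) sym_group_mult)
    then show "g \<in> ?L" using l Lc[OF l(1)] by (simp add: sym_emb_id)
  qed
qed

theorem raag_PVT: "raag (PVT n) (pairs n) disjnt (pair_gen n)"
proof -
  have "inj_on artin_to_PVT (carrier (artin n))"
    by (rule inj_onI) (metis artin_to_PVT_section fst_conv)
  then have "artin_to_PVT \<in> iso (artin n) (PVT n)"
    using artin_to_PVT_hom artin_to_PVT_surj by (simp add: iso_def bij_betw_def)
  then show ?thesis
    unfolding artin_to_PVT_def artin_def
    by unfold_locales
       (simp_all add: finite_pairs pair_gen_closed disjnt_sym pairs_not_disjnt pair_gen_commute del: disjnt_self_iff_empty)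
qed

end

section \<open>The Kneser graph of pairs\<close>

lemma ex_avoid:
  assumes "length xs < n" obtains x where "x \<in> {1..n}" "x \<notin> set xs"
proof -
  have "card (set xs) < card {1..n}" using card_length[of xs] assms by simp
  then have "\<not> {1..n} \<subseteq> set xs" using card_mono[OF finite_set, of "{1..n}" xs] by linarith
  then show thesis using that by blast
qed

lemma pair_through:
  assumes "e \<in> pairs n" "x \<in> e"
  obtains y where "y \<in> {1..n}" "y \<noteq> x" "e = {x, y}" "x \<in> {1..n}"
  using assms by (elim pairsE) (metis insertE insert_commute less_irrefl singletonD)

lemma pair_meet:
  assumes e: "e \<in> pairs n" and b: "b \<in> pairs n" "b \<noteq> e" "\<not> disjnt e b"
  obtains x k where "x \<in> e" "k \<in> {1..n}" "k \<notin> e" "b = {x, k}"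
proof -
  obtain x where x: "x \<in> e" "x \<in> b" using b(3) by (auto simp: disjnt_def)
  obtain k where k: "k \<in> {1..n}" "k \<noteq> x" "b = {x, k}" using pair_through[OF b(1) x(2)] by metis
  obtain y where y: "e = {x, y}" using pair_through[OF e x(1)] by metis
  have "k \<noteq> y" using k(3) y b(2) by auto
  then show thesis using that[OF x(1) k(1) _ k(3)] y k(2) by auto
qed

lemma card_pairs_avoiding:
  assumes "A \<subseteq> {1..n}"
  shows "card {u \<in> pairs n. disjnt A u} = (n - card A) choose 2"
proof -
  have "{u \<in> pairs n. disjnt A u} = {u. u \<subseteq> {1..n} - A \<and> card u = 2}"
    by (auto simp: pairs_def disjnt_def)
  moreover have "card ({1..n} - A) = n - card A"
    using assms finite_subset[OF assms] by (simp add: card_Diff_subset)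
  ultimately show ?thesis by (simp add: n_subsets)
qed

text \<open>Two distinct pairs cover at least three points, so their common link has at most
  \<open>(n - 3) choose 2\<close> elements. A single link has \<open>n - 3\<close> more than this
  bound, and \<open>n - 3\<close> is at least 2.\<close>

lemma Kneser_link_card:
  assumes n: "n \<ge> 5" and st: "s \<in> pairs n" "t \<in> pairs n" "s \<noteq> t" and v: "v \<in> pairs n"
  shows "card {u \<in> pairs n. disjnt s u \<and> disjnt t u} + 1 < card {u \<in> pairs n. disjnt v u}"
proof -
  have fin: "finite s" "finite t" "card s = 2" "card t = 2" "s \<subseteq> {1..n}" "t \<subseteq> {1..n}" "card v = 2" "v \<subseteq> {1..n}"
    using st v finite_subset by (auto simp: pairs_def)
  have "\<not> t \<subseteq> s" using card_subset_eq[OF fin(1), of t] fin st(3) by auto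
  then have "s \<subset> s \<union> t" by auto
  then have st3: "3 \<le> card (s \<union> t)" using psubset_card_mono[of "s \<union> t" s] fin by simp
  have "{u \<in> pairs n. disjnt s u \<and> disjnt t u} = {u \<in> pairs n. disjnt (s \<union> t) u}" by auto
  then have "card {u \<in> pairs n. disjnt s u \<and> disjnt t u} = (n - card (s \<union> t)) choose 2"
    using card_pairs_avoiding[of "s \<union> t" n] fin by simp
  also have "\<dots> \<le> (n - 3) choose 2" using st3 by (intro binomial_right_mono) simp
  finally have 1: "card {u \<in> pairs n. disjnt s u \<and> disjnt t u} \<le> (n - 3) choose 2" .
  have "n - 2 = Suc (n - 3)" using n by simp
  then have "card {u \<in> pairs n. disjnt v u} = ((n - 3) choose 2) + (n - 3)"
    using card_pairs_avoiding[OF fin(8)] fin(7) by (simp add: numeral_2_eq_2)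
  then show ?thesis using 1 n by simp
qed

text \<open>The vertices in question are \<open>{x, k}\<close> with \<open>x\<close> in
  \<open>a\<close> and \<open>k\<close> outside, adjacent iff both coordinates differ. There are two
  values of \<open>x\<close> but at least three of \<open>k\<close>, so two edges lead to any other
  \<open>k\<close> and three edges to the other \<open>x\<close>.\<close>

lemma Kneser_connected:
  assumes n: "n \<ge> 5" and a: "a \<in> pairs n" and b: "b \<in> pairs n - {a}" "\<not> disjnt a b"
    and c: "c \<in> pairs n - {a}" "\<not> disjnt a c"
  shows "(b, c) \<in> {(x, y). x \<in> pairs n - {a} \<and> y \<in> pairs n - {a} \<and>
    \<not> disjnt a x \<and> \<not> disjnt a y \<and> disjnt x y}\<^sup>*" (is "_ \<in> ?E\<^sup>*")
proof -
  obtain p q where pq: "p \<in> {1..n}" "q \<in> {1..n}" "p < q" "a = {p, q}" using pairsE[OF a] by metis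
  have edge: "({x, k}, {y, l}) \<in> ?E"
    if "x \<in> a" "y \<in> a" "x \<noteq> y" "k \<in> {1..n}" "l \<in> {1..n}" "k \<notin> a" "l \<notin> a" "k \<noteq> l" for x y k l
  proof -
    have "x \<in> {1..n}" "y \<in> {1..n}" "x \<noteq> k" "y \<noteq> l" using that pq by auto
    then have "{x, k} \<in> pairs n" "{y, l} \<in> pairs n" using that by (auto intro: pairsI)
    then show ?thesis using that by (auto simp: disjnt_def)
  qed
  obtain x k where x: "x \<in> a" "k \<in> {1..n}" "k \<notin> a" "b = {x, k}" using pair_meet[OF a] b by blast
  obtain y l where y: "y \<in> a" "l \<in> {1..n}" "l \<notin> a" "c = {y, l}" using pair_meet[OF a] c by blast
  obtain x' where x': "x' \<in> a" "x' \<noteq> x" using pq x(1) by auto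
  obtain m where m: "m \<in> {1..n}" "m \<notin> set [p, q, k, l]" by (rule ex_avoid[of "[p, q, k, l]" n]) (use n in auto)
  then have m': "m \<notin> a" "m \<noteq> k" "m \<noteq> l" using pq by auto
  have "({x, k}, {x', m}) \<in> ?E" by (rule edge) (use x x' m(1) m' in auto)
  moreover have "({x', m}, {x, l}) \<in> ?E" by (rule edge) (use x x' y m(1) m' in auto)
  ultimately have two: "({x, k}, {x, l}) \<in> ?E\<^sup>*" by (rule rtrancl_trans[OF r_into_rtrancl r_into_rtrancl])
  show ?thesis
  proof (cases "y = x")
    case True
    then show ?thesis using two x y by simp
  next
    case False
    \<comment> \<open>\<open>i\<close> has to differ from \<open>l\<close> for the last edge,
      \<open>j\<close> from \<open>k\<close> and \<open>i\<close> for the first two;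
      \<open>i = k\<close> is allowed.\<close>
    obtain i where i: "i \<in> {1..n}" "i \<notin> set [p, q, l]" by (rule ex_avoid[of "[p, q, l]" n]) (use n in auto)
    then have i': "i \<notin> a" "i \<noteq> l" using pq by auto
    obtain j where j: "j \<in> {1..n}" "j \<notin> set [p, q, k, i]" by (rule ex_avoid[of "[p, q, k, i]" n]) (use n in auto)
    then have j': "j \<notin> a" "j \<noteq> k" "j \<noteq> i" using pq by auto
    have "({x, k}, {y, j}) \<in> ?E" by (rule edge) (use x y False j(1) j' in auto)
    moreover have "({y, j}, {x, i}) \<in> ?E" by (rule edge) (use x y False i(1) i' j(1) j' in auto)
    ultimately have "({x, k}, {x, i}) \<in> ?E\<^sup>*" by (rule rtrancl_trans[OF r_into_rtrancl r_into_rtrancl])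
    moreover have "({x, i}, {y, l}) \<in> ?E" by (rule edge) (use x y False i(1) i' in auto)
    ultimately have "({x, k}, {y, l}) \<in> ?E\<^sup>*" by (rule rtrancl_into_rtrancl)
    then show ?thesis using x y by simp
  qed
qed

lemma Kneser_link_separates:
  assumes n: "n \<ge> 5" and vw: "v \<in> pairs n" "w \<in> pairs n" "v \<noteq> w"
  shows "\<exists>u\<in>pairs n. disjnt v u \<and> \<not> disjnt w u"
proof -
  obtain p q where pq: "p \<in> {1..n}" "q \<in> {1..n}" "p < q" "v = {p, q}" using pairsE[OF vw(1)] by metis
  have "\<not> w \<subseteq> v" using vw card_subset_eq[of v w] finite_subset by (auto simp: pairs_def)
  then obtain k where k: "k \<in> w" "k \<notin> v" by auto
  then have kn: "k \<in> {1..n}" using vw(2) by (auto simp: pairs_def)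
  obtain m where m: "m \<in> {1..n}" "m \<notin> set [p, q, k]" by (rule ex_avoid[of "[p, q, k]" n]) (use n in auto)
  then have "{k, m} \<in> pairs n" using kn by (intro pairsI) auto
  then show ?thesis using k m pq by (intro bexI[of _ "{k, m}"]) (auto simp: disjnt_def)
qed

text \<open>Join a point of \<open>a\<close> to a point outside \<open>a\<close> and
  \<open>u\<close>, which exists as \<open>n\<close> exceeds 4.\<close>

lemma Kneser_star_escape:
  assumes n: "n \<ge> 5" and au: "a \<in> pairs n" "u \<in> pairs n" "disjnt a u"
  shows "\<exists>w\<in>pairs n - {a}. \<not> disjnt a w \<and> disjnt u w"
proof -
  obtain p q where pq: "p \<in> {1..n}" "q \<in> {1..n}" "p < q" "a = {p, q}" using pairsE[OF au(1)] by metis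
  obtain x y where xy: "u = {x, y}" using pairsE[OF au(2)] by metis
  obtain m where m: "m \<in> {1..n}" "m \<notin> set [p, q, x, y]" by (rule ex_avoid[of "[p, q, x, y]" n]) (use n in auto)
  then have "{p, m} \<in> pairs n" using pq by (intro pairsI) auto
  then show ?thesis using m pq xy au(3) by (intro bexI[of _ "{p, m}"]) (auto simp: disjnt_def doubleton_eq_iff)
qed

text \<open>For disjoint \<open>a\<close> and \<open>b\<close> take one point of each, otherwise a
  common point and a new one.\<close>

lemma Kneser_stars_avoid:
  assumes n: "n \<ge> 5" and ab: "a \<in> pairs n" "b \<in> pairs n"
  shows "\<exists>c\<in>pairs n - {a, b}. \<not> disjnt a c \<and> \<not> disjnt b c"
proof -
  obtain p q where pq: "p \<in> {1..n}" "q \<in> {1..n}" "p < q" "a = {p, q}" using pairsE[OF ab(1)] by metis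
  show ?thesis
  proof (cases "disjnt a b")
    case True
    obtain x y where xy: "x \<in> {1..n}" "x < y" "b = {x, y}" using pairsE[OF ab(2)] by metis
    have "p \<noteq> x" "p \<noteq> y" "q \<noteq> x" using True pq xy by (auto simp: disjnt_def)
    then show ?thesis using pq xy
      by (intro bexI[of _ "{p, x}"]) (auto simp: disjnt_def doubleton_eq_iff intro!: pairsI)
  next
    case False
    then obtain x where x: "x \<in> a" "x \<in> b" by (auto simp: disjnt_def)
    obtain y where y: "a = {x, y}" "x \<in> {1..n}" using pair_through[OF ab(1) x(1)] by metis
    obtain z where z: "b = {x, z}" using pair_through[OF ab(2) x(2)] by metis
    obtain m where m: "m \<in> {1..n}" "m \<notin> set [x, y, z]" by (rule ex_avoid[of "[x, y, z]" n]) (use n in auto)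
    then show ?thesis using x y z
      by (intro bexI[of _ "{x, m}"]) (auto simp: disjnt_def doubleton_eq_iff intro!: pairsI)
  qed
qed

theorem rigid_raag_PVT:
  assumes n: "n \<ge> 5"
  shows "rigid_raag (PVT n) (pairs n) disjnt (pair_gen n)"
proof -
  interpret raag "PVT n" "pairs n" disjnt "pair_gen n" by (rule raag_PVT[OF n])
  show ?thesis
    by unfold_locales
      (assumption | rule Kneser_link_separates[OF n] Kneser_connected[OF n] Kneser_star_escape[OF n]
         Kneser_stars_avoid[OF n] Kneser_link_card[OF n])+
qed

section \<open>Automorphisms of the Kneser graph\<close>

definition star :: "nat \<Rightarrow> nat \<Rightarrow> nat set set" where
  "star n i = {e \<in> pairs n. i \<in> e}"

lemma card_star: "i \<in> {1..n} \<Longrightarrow> card (star n i) = n - 1"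
proof -
  assume i: "i \<in> {1..n}"
  have "star n i = (\<lambda>k. {i, k}) ` ({1..n} - {i})"
  proof
    show "star n i \<subseteq> (\<lambda>k. {i, k}) ` ({1..n} - {i})"
    proof
      fix e assume "e \<in> star n i"
      then have "e \<in> pairs n" "i \<in> e" by (auto simp: star_def)
      then obtain y where "y \<in> {1..n}" "y \<noteq> i" "e = {i, y}" by (rule pair_through)
      then show "e \<in> (\<lambda>k. {i, k}) ` ({1..n} - {i})" by auto
    qed
    show "(\<lambda>k. {i, k}) ` ({1..n} - {i}) \<subseteq> star n i" using i by (auto simp: star_def intro!: pairsI)
  qed
  moreover have "inj_on (\<lambda>k. {i, k}) ({1..n} - {i})" by (auto simp: inj_on_def doubleton_eq_iff)
  ultimately show ?thesis using i by (simp add: card_image)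
qed

text \<open>A pairwise intersecting family of pairs is a triangle or lies in a star.\<close>

lemma intersecting_star:
  assumes T: "T \<subseteq> pairs n" "card T \<ge> 4" and meet: "\<And>d e. d \<in> T \<Longrightarrow> e \<in> T \<Longrightarrow> \<not> disjnt d e"
  shows "\<exists>i\<in>{1..n}. T \<subseteq> star n i"
proof (rule ccontr)
  assume none: "\<not> ?thesis"
  have "\<not> T \<subseteq> {e}" for e using T(2) card_mono[of "{e}" T] by auto
  moreover have "T \<noteq> {}" using T(2) by auto
  ultimately obtain e f where ef: "e \<in> T" "f \<in> T" "e \<noteq> f" by blast
  then obtain a where a: "a \<in> e" "a \<in> f" using meet[of e f] by (auto simp: disjnt_def)
  obtain b where b: "e = {a, b}" "b \<noteq> a" "a \<in> {1..n}" using pair_through[of e n a] ef T(1) a by blast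
  obtain c where c: "f = {a, c}" "c \<noteq> a" using pair_through[of f n a] ef T(1) a by blast
  have bc: "b \<noteq> c" using ef(3) b c by auto
  \<comment> \<open>With \<open>e = {a, b}\<close> and \<open>f = {a, c}\<close>, a member that
    misses \<open>a\<close> can only be \<open>{b, c}\<close>, and then every member is a side of
    this triangle.\<close>
  have "\<not> T \<subseteq> star n a" using none b(3) by blast
  then obtain g where g: "g \<in> T" "a \<notin> g" using T(1) by (auto simp: star_def)
  have "b \<in> g" "c \<in> g" using meet[OF ef(1) g(1)] meet[OF ef(2) g(1)] g(2) b c by (auto simp: disjnt_def)
  then have gbc: "g = {b, c}" using pair_through[of g n b] g(1) T(1) bc by (metis insertE singletonD subsetD)
  have "T \<subseteq> {e, f, g}"
  proof
    fix h assume h: "h \<in> T"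
    note m = meet[OF h ef(1)] meet[OF h ef(2)] meet[OF h g(1)]
    have hp: "h \<in> pairs n" using h T(1) by blast
    show "h \<in> {e, f, g}"
    proof (cases "a \<in> h")
      case True
      obtain y where "h = {a, y}" using pair_through[OF hp True] by metis
      then show ?thesis using m(3) g(2) b c gbc by (auto simp: disjnt_def)
    next
      case False
      then have "b \<in> h" "c \<in> h" using m(1,2) b c by (auto simp: disjnt_def)
      then have "h = {b, c}" using pair_through[OF hp] bc by (metis insertE singletonD)
      then show ?thesis using gbc by simp
    qed
  qed
  then have "card T \<le> card {e, f, g}" by (intro card_mono) auto
  also have "\<dots> \<le> 3" by (simp add: card_insert_if)
  finally show False using T(2) by simp
qed

text \<open>The image of a star is a pairwise intersecting family of \<open>n - 1\<close> pairs, too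
  many for a triangle, so it lies in a star again; this defines \<sigma> on points.\<close>

theorem Kneser_automorphism:
  assumes n: "n \<ge> 5" and \<pi>: "bij_betw \<pi> (pairs n) (pairs n)"
    and adj: "\<And>d e. d \<in> pairs n \<Longrightarrow> e \<in> pairs n \<Longrightarrow> disjnt (\<pi> d) (\<pi> e) \<longleftrightarrow> disjnt d e"
  shows "\<exists>\<sigma>. \<sigma> permutes {1..n} \<and> (\<forall>e\<in>pairs n. \<pi> e = \<sigma> ` e)"
proof -
  have inj: "inj_on \<pi> (pairs n)" and \<pi>V: "\<pi> e \<in> pairs n" if "e \<in> pairs n" for e
    using \<pi> that by (auto simp: bij_betw_def)
  have "\<exists>j\<in>{1..n}. \<pi> ` star n i \<subseteq> star n j" if i: "i \<in> {1..n}" for i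
  proof (rule intersecting_star)
    show "\<pi> ` star n i \<subseteq> pairs n" using \<pi>V by (auto simp: star_def)
    have "inj_on \<pi> (star n i)" using \<pi> by (auto simp: bij_betw_def star_def inj_on_def)
    then show "4 \<le> card (\<pi> ` star n i)" using card_star[OF i] n by (simp add: card_image)
    show "\<not> disjnt d e" if "d \<in> \<pi> ` star n i" "e \<in> \<pi> ` star n i" for d e
      using that adj by (force simp: star_def disjnt_def)
  qed
  then obtain \<sigma> where \<sigma>: "\<And>i. i \<in> {1..n} \<Longrightarrow> \<sigma> i \<in> {1..n}" "\<And>i. i \<in> {1..n} \<Longrightarrow> \<pi> ` star n i \<subseteq> star n (\<sigma> i)"
    by metis
  have mem: "\<sigma> i \<in> \<pi> e" if "e \<in> pairs n" "i \<in> e" for i e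
  proof -
    have "i \<in> {1..n}" "e \<in> star n i" using that by (auto simp: pairs_def star_def)
    then show ?thesis using \<sigma>(2)[of i] by (auto simp: star_def)
  qed
  have inj\<sigma>: "inj_on \<sigma> {1..n}"
  proof (rule inj_onI, rule ccontr)
    fix i j assume ij: "i \<in> {1..n}" "j \<in> {1..n}" "\<sigma> i = \<sigma> j" "i \<noteq> j"
    obtain k where k: "k \<in> {1..n}" "k \<notin> set [i, j]" by (rule ex_avoid[of "[i, j]" n]) (use n in auto)
    obtain l where l: "l \<in> {1..n}" "l \<notin> set [i, j, k]" by (rule ex_avoid[of "[i, j, k]" n]) (use n in auto)
    have P: "{i, k} \<in> pairs n" "{j, l} \<in> pairs n" using ij k l by (auto intro!: pairsI)
    \<comment> \<open>If \<open>i\<close> and \<open>j\<close> had the same image, disjoint pairs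
      through them would have meeting images.\<close>
    have "disjnt {i, k} {j, l}" using ij k l by (auto simp: disjnt_def)
    then have "disjnt (\<pi> {i, k}) (\<pi> {j, l})" using adj[OF P] by simp
    moreover have "\<sigma> i \<in> \<pi> {i, k}" "\<sigma> i \<in> \<pi> {j, l}" using mem[OF P(1), of i] mem[OF P(2), of j] ij(3) by auto
    ultimately show False by (auto simp: disjnt_def)
  qed
  obtain p where p: "p permutes {1..n}" "\<And>i. i \<in> {1..n} \<Longrightarrow> p i = \<sigma> i"
    by (rule permutes_extend[of "{1..n}" "{1..n}" \<sigma>]) (use \<sigma>(1) inj\<sigma> in auto)
  have "\<pi> e = p ` e" if e: "e \<in> pairs n" for e
  proof -
    have en: "e \<subseteq> {1..n}" "card e = 2" using e by (auto simp: pairs_def)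
    have sub: "p ` e \<subseteq> \<pi> e" using mem[OF e] p(2) en(1) by auto
    have "card (p ` e) = 2" using en(2) permutes_inj[OF p(1)] by (simp add: card_image inj_on_subset)
    moreover have "card (\<pi> e) = 2" "finite (\<pi> e)" using \<pi>V[OF e] finite_subset by (auto simp: pairs_def)
    ultimately show ?thesis using card_subset_eq[OF _ sub] by simp
  qed
  then show ?thesis using p(1) by blast
qed

section \<open>Internal semidirect products\<close>

text \<open>\<open>P\<close> is a parameter with an equation, so that the locale fits both
  \<open>Aut_gr_inv n\<close> and the whole carrier.\<close>

locale internal_semidirect = group A for A :: "'a monoid" (structure) +
  fixes N Q P :: "'a set"
  assumes N: "subgroup N A" and Q: "subgroup Q A"
    and normalizes: "q \<in> Q \<Longrightarrow> x \<in> N \<Longrightarrow> q \<otimes> x \<otimes> inv q \<in> N"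
    and trivial_Int: "x \<in> N \<Longrightarrow> x \<in> Q \<Longrightarrow> x = \<one>"
    and P_eq: "P = generate A (Q \<union> N)"
begin

lemma NQ_carrier: "x \<in> N \<Longrightarrow> x \<in> carrier A" "q \<in> Q \<Longrightarrow> q \<in> carrier A"
  using subgroup.mem_carrier[OF N] subgroup.mem_carrier[OF Q] by auto

lemma N_rules: "x \<in> N \<Longrightarrow> y \<in> N \<Longrightarrow> x \<otimes> y \<in> N" "x \<in> N \<Longrightarrow> inv x \<in> N" "\<one> \<in> N"
  using subgroup.m_closed[OF N] subgroup.m_inv_closed[OF N] subgroup.one_closed[OF N] by auto

lemma Q_rules: "x \<in> Q \<Longrightarrow> y \<in> Q \<Longrightarrow> x \<otimes> y \<in> Q" "x \<in> Q \<Longrightarrow> inv x \<in> Q" "\<one> \<in> Q"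
  using subgroup.m_closed[OF Q] subgroup.m_inv_closed[OF Q] subgroup.one_closed[OF Q] by auto

lemma product_mult:
  assumes "x \<in> N" "q \<in> Q" "y \<in> N" "r \<in> Q"
  shows "(x \<otimes> q) \<otimes> (y \<otimes> r) = (x \<otimes> (q \<otimes> y \<otimes> inv q)) \<otimes> (q \<otimes> r)"
  using NQ_carrier assms by (simp add: m_assoc)

lemma P_subgroup: "subgroup P A"
  unfolding P_eq by (rule generate_is_subgroup) (use NQ_carrier in auto)

lemma P_iff: "z \<in> P \<longleftrightarrow> (\<exists>x\<in>N. \<exists>q\<in>Q. z = x \<otimes> q)"
proof
  assume "z \<in> P"
  then show "\<exists>x\<in>N. \<exists>q\<in>Q. z = x \<otimes> q" unfolding P_eq
  proof (induction rule: generate.induct)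
    case one
    then show ?case using N_rules(3) Q_rules(3) by (intro bexI[of _ \<one>]) auto
  next
    case (incl h)
    then show ?case
    proof
      assume "h \<in> Q"
      then show ?thesis using N_rules(3) NQ_carrier by (intro bexI[of _ \<one>] bexI[of _ h]) auto
    next
      assume "h \<in> N"
      then show ?thesis using Q_rules(3) NQ_carrier by (intro bexI[of _ \<one>] bexI[of _ h]) auto
    qed
  next
    case (inv h)
    then show ?case
    proof
      assume "h \<in> Q"
      then show ?thesis using N_rules(3) Q_rules(2) NQ_carrier by (intro bexI[of _ \<one>] bexI[of _ "inv h"]) auto
    next
      assume "h \<in> N"
      then show ?thesis using Q_rules(3) N_rules(2) NQ_carrier by (intro bexI[of _ \<one>] bexI[of _ "inv h"]) auto
    qed
  next
    case (eng g h)
    then obtain x q y r where *: "x \<in> N" "q \<in> Q" "y \<in> N" "r \<in> Q" "g = x \<otimes> q" "h = y \<otimes> r" by blast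
    then have "g \<otimes> h = (x \<otimes> (q \<otimes> y \<otimes> inv q)) \<otimes> (q \<otimes> r)" using product_mult by simp
    moreover have "x \<otimes> (q \<otimes> y \<otimes> inv q) \<in> N" "q \<otimes> r \<in> Q"
      using * normalizes N_rules(1) Q_rules(1) by auto
    ultimately show ?case by blast
  qed
next
  assume "\<exists>x\<in>N. \<exists>q\<in>Q. z = x \<otimes> q"
  then show "z \<in> P" unfolding P_eq by (auto intro: generate.eng generate.incl)
qed

text \<open>The equation puts \<open>inv y \<otimes> x = r \<otimes> inv q\<close> into both
  \<open>N\<close> and \<open>Q\<close>.\<close>

lemma product_unique:
  assumes "x \<in> N" "q \<in> Q" "y \<in> N" "r \<in> Q" "x \<otimes> q = y \<otimes> r"
  shows "x = y" "q = r"
proof -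
  note c = NQ_carrier(1)[OF assms(1)] NQ_carrier(2)[OF assms(2)] NQ_carrier(1)[OF assms(3)] NQ_carrier(2)[OF assms(4)]
  have "inv y \<otimes> x = inv y \<otimes> (x \<otimes> q) \<otimes> inv q" using c by (simp add: m_assoc)
  also have "\<dots> = r \<otimes> inv q" unfolding assms(5) using c by (simp add: m_assoc)
  finally have eq: "inv y \<otimes> x = r \<otimes> inv q" .
  have "inv y \<otimes> x \<in> N" "r \<otimes> inv q \<in> Q" using assms N_rules Q_rules by auto
  then have 1: "inv y \<otimes> x = \<one>" using trivial_Int eq by simp
  then show "x = y" using c inv_mult_cancel(2)[of y x] by simp
  then show "q = r" using assms(5) c by simp
qed

definition proj :: "'a \<Rightarrow> 'a" where
  "proj z = (THE q. q \<in> Q \<and> (\<exists>x\<in>N. z = x \<otimes> q))"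

lemma proj_eq: "x \<in> N \<Longrightarrow> q \<in> Q \<Longrightarrow> proj (x \<otimes> q) = q"
  unfolding proj_def by (rule the_equality) (use product_unique in blast)+

lemma proj_Q: "q \<in> Q \<Longrightarrow> proj q = q"
  using proj_eq[OF N_rules(3), of q] NQ_carrier by simp

lemma proj_hom: "proj \<in> hom (A\<lparr>carrier := P\<rparr>) (A\<lparr>carrier := Q\<rparr>)"
proof (rule homI)
  fix z assume "z \<in> carrier (A\<lparr>carrier := P\<rparr>)"
  then obtain x q where z: "x \<in> N" "q \<in> Q" "z = x \<otimes> q" using P_iff by auto
  then show "proj z \<in> carrier (A\<lparr>carrier := Q\<rparr>)" using proj_eq by simp
  fix w assume "w \<in> carrier (A\<lparr>carrier := P\<rparr>)"
  then obtain y r where w: "y \<in> N" "r \<in> Q" "w = y \<otimes> r" using P_iff by auto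
  have "x \<otimes> (q \<otimes> y \<otimes> inv q) \<in> N" "q \<otimes> r \<in> Q" using z w normalizes N_rules(1) Q_rules(1) by auto
  then have "proj (z \<otimes> w) = q \<otimes> r" using product_mult[of x q y r] z w proj_eq by simp
  then show "proj (z \<otimes>\<^bsub>A\<lparr>carrier := P\<rparr>\<^esub> w) = proj z \<otimes>\<^bsub>A\<lparr>carrier := Q\<rparr>\<^esub> proj w"
    using z w proj_eq by simp
qed

lemma subset_P: "N \<subseteq> P" "Q \<subseteq> P"
  unfolding P_eq by (auto intro: generate.incl)

text \<open>The argument order is quotient, middle group, kernel; \<open>proj_Q\<close> provides the
  splitting by inclusion.\<close>

lemma split_sequence:
  "short_exact_sequence (A\<lparr>carrier := Q\<rparr>) (A\<lparr>carrier := P\<rparr>) (A\<lparr>carrier := N\<rparr>) proj id"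
proof -
  have gr: "group (A\<lparr>carrier := Q\<rparr>)" "group (A\<lparr>carrier := P\<rparr>)" "group (A\<lparr>carrier := N\<rparr>)"
    using subgroup_imp_group Q P_subgroup N by auto
  have i: "id \<in> hom (A\<lparr>carrier := N\<rparr>) (A\<lparr>carrier := P\<rparr>)" using subset_P by (auto simp: hom_def)
  have "kernel (A\<lparr>carrier := P\<rparr>) (A\<lparr>carrier := Q\<rparr>) proj = N"
  proof
    show "kernel (A\<lparr>carrier := P\<rparr>) (A\<lparr>carrier := Q\<rparr>) proj \<subseteq> N"
    proof
      fix z assume "z \<in> kernel (A\<lparr>carrier := P\<rparr>) (A\<lparr>carrier := Q\<rparr>) proj"
      then have z: "z \<in> P" "proj z = \<one>" by (auto simp: kernel_def)
      then obtain x q where "x \<in> N" "q \<in> Q" "z = x \<otimes> q" using P_iff by auto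
      then show "z \<in> N" using z(2) proj_eq NQ_carrier by simp
    qed
    show "N \<subseteq> kernel (A\<lparr>carrier := P\<rparr>) (A\<lparr>carrier := Q\<rparr>) proj"
    proof
      fix x assume "x \<in> N"
      then show "x \<in> kernel (A\<lparr>carrier := P\<rparr>) (A\<lparr>carrier := Q\<rparr>) proj"
        using proj_eq[of x \<one>] Q_rules(3) NQ_carrier subset_P by (auto simp: kernel_def)
    qed
  qed
  moreover have "proj ` P = Q"
  proof
    show "proj ` P \<subseteq> Q" using proj_hom by (auto simp: hom_def)
    show "Q \<subseteq> proj ` P" using proj_Q subset_P(2) by (metis image_eqI subsetD subsetI)
  qed
  ultimately show ?thesis
    unfolding short_exact_sequence_iff
    using gr i proj_hom by (auto simp: group_hom_def group_hom_axioms_def epi_def mon_def)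
qed

text \<open>\<theta> is conjugation of \<open>N\<close> by \<open>Q\<close>, transported through
  \<alpha> and \<beta>. The image statements record that the two factors become the given subgroups
  and not just isomorphic copies of them.\<close>

lemma semidirect_iso:
  assumes N': "group N'" and \<alpha>: "\<alpha> \<in> iso N' (A\<lparr>carrier := N\<rparr>)"
    and Q': "group Q'" and \<beta>: "\<beta> \<in> iso Q' (A\<lparr>carrier := Q\<rparr>)"
  shows "\<exists>\<theta>\<in>hom Q' (AutoGroup N'). \<exists>\<Phi>\<in>iso (semidirect_product N' Q' \<theta>) (A\<lparr>carrier := P\<rparr>).
    \<Phi> ` (carrier N' \<times> {\<one>\<^bsub>Q'\<^esub>}) = N \<and> \<Phi> ` ({\<one>\<^bsub>N'\<^esub>} \<times> carrier Q') = Q"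
proof -
  interpret N': group N' by (rule N')
  interpret Q': group Q' by (rule Q')
  have \<alpha>h: "\<alpha> (a \<otimes>\<^bsub>N'\<^esub> b) = \<alpha> a \<otimes> \<alpha> b" if "a \<in> carrier N'" "b \<in> carrier N'" for a b
    using hom_mult[of \<alpha> N' "A\<lparr>carrier := N\<rparr>"] \<alpha> that by (simp add: iso_def)
  have \<beta>h: "\<beta> (g \<otimes>\<^bsub>Q'\<^esub> h) = \<beta> g \<otimes> \<beta> h" if "g \<in> carrier Q'" "h \<in> carrier Q'" for g h
    using hom_mult[of \<beta> Q' "A\<lparr>carrier := Q\<rparr>"] \<beta> that by (simp add: iso_def)
  have \<alpha>b: "bij_betw \<alpha> (carrier N') N" and \<beta>b: "bij_betw \<beta> (carrier Q') Q"
    using \<alpha> \<beta> by (auto simp: iso_def)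
  have \<alpha>N: "\<alpha> a \<in> N" if "a \<in> carrier N'" for a using \<alpha>b that by (auto simp: bij_betw_def)
  have \<beta>Q: "\<beta> g \<in> Q" if "g \<in> carrier Q'" for g using \<beta>b that by (auto simp: bij_betw_def)
  have \<alpha>1: "\<alpha> \<one>\<^bsub>N'\<^esub> = \<one>"
    using hom_one[of \<alpha> N' "A\<lparr>carrier := N\<rparr>"] \<alpha> N' subgroup_imp_group[OF N] by (simp add: iso_def)
  have \<beta>1: "\<beta> \<one>\<^bsub>Q'\<^esub> = \<one>"
    using hom_one[of \<beta> Q' "A\<lparr>carrier := Q\<rparr>"] \<beta> Q' subgroup_imp_group[OF Q] by (simp add: iso_def)
  let ?\<alpha>' = "inv_into (carrier N') \<alpha>"
  define \<theta> where "\<theta> g = (\<lambda>a\<in>carrier N'. ?\<alpha>' (\<beta> g \<otimes> \<alpha> a \<otimes> inv (\<beta> g)))" for g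
  have \<alpha>': "?\<alpha>' x \<in> carrier N'" "\<alpha> (?\<alpha>' x) = x" if "x \<in> N" for x
    using \<alpha>b that bij_betw_inv_into_right[OF \<alpha>b] bij_betw_apply[OF bij_betw_inv_into[OF \<alpha>b]] by auto
  have \<alpha>inj: "a = b" if "\<alpha> a = \<alpha> b" "a \<in> carrier N'" "b \<in> carrier N'" for a b
    using that \<alpha>b by (auto simp: bij_betw_def inj_on_def)
  have \<theta>: "\<theta> g a \<in> carrier N'" "\<alpha> (\<theta> g a) = \<beta> g \<otimes> \<alpha> a \<otimes> inv (\<beta> g)"
    if "g \<in> carrier Q'" "a \<in> carrier N'" for g a
    using that \<alpha>'[OF normalizes[OF \<beta>Q \<alpha>N]] by (auto simp: \<theta>_def)
  have \<theta>_mult: "\<theta> (g \<otimes>\<^bsub>Q'\<^esub> h) a = \<theta> g (\<theta> h a)"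
    if g: "g \<in> carrier Q'" and h: "h \<in> carrier Q'" and a: "a \<in> carrier N'" for g h a
  proof (rule \<alpha>inj)
    show "\<alpha> (\<theta> (g \<otimes>\<^bsub>Q'\<^esub> h) a) = \<alpha> (\<theta> g (\<theta> h a))"
      using g h a \<theta> \<beta>h NQ_carrier \<alpha>N \<beta>Q by (simp add: inv_mult_group m_assoc)
  qed (use g h a \<theta> in auto)
  have \<theta>_one: "\<theta> \<one>\<^bsub>Q'\<^esub> a = a" if a: "a \<in> carrier N'" for a
    by (rule \<alpha>inj) (use a \<theta> \<beta>1 NQ_carrier \<alpha>N in auto)
  have \<theta>_hom: "\<theta> g (a \<otimes>\<^bsub>N'\<^esub> b) = \<theta> g a \<otimes>\<^bsub>N'\<^esub> \<theta> g b"
    if g: "g \<in> carrier Q'" and a: "a \<in> carrier N'" and b: "b \<in> carrier N'" for g a b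
  proof (rule \<alpha>inj)
    show "\<alpha> (\<theta> g (a \<otimes>\<^bsub>N'\<^esub> b)) = \<alpha> (\<theta> g a \<otimes>\<^bsub>N'\<^esub> \<theta> g b)"
      using g a b \<theta> \<alpha>h NQ_carrier \<alpha>N \<beta>Q by (simp add: m_assoc)
  qed (use g a b \<theta> in auto)
  have \<theta>_auto: "\<theta> g \<in> auto N'" if g: "g \<in> carrier Q'" for g
  proof -
    have gi: "inv\<^bsub>Q'\<^esub> g \<in> carrier Q'" using g by simp
    have "bij_betw (\<theta> g) (carrier N') (carrier N')"
    proof (rule bij_betw_byWitness[where f'="\<theta> (inv\<^bsub>Q'\<^esub> g)"])
      show "\<forall>a\<in>carrier N'. \<theta> (inv\<^bsub>Q'\<^esub> g) (\<theta> g a) = a"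
        using \<theta>_mult[OF gi g] \<theta>_one g by simp
      show "\<forall>a\<in>carrier N'. \<theta> g (\<theta> (inv\<^bsub>Q'\<^esub> g) a) = a"
        using \<theta>_mult[OF g gi] \<theta>_one g by simp
    qed (use \<theta> g gi in auto)
    then show ?thesis using \<theta>(1)[OF g] \<theta>_hom[OF g] by (auto simp: auto_def Bij_def hom_def \<theta>_def)
  qed
  have \<theta>h: "\<theta> \<in> hom Q' (AutoGroup N')"
  proof (rule homI)
    fix g h assume g: "g \<in> carrier Q'" and h: "h \<in> carrier Q'"
    show "\<theta> g \<in> carrier (AutoGroup N')" using \<theta>_auto[OF g] by (simp add: AutoGroup_def)
    show "\<theta> (g \<otimes>\<^bsub>Q'\<^esub> h) = \<theta> g \<otimes>\<^bsub>AutoGroup N'\<^esub> \<theta> h"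
    proof (rule extensionalityI[of _ "carrier N'"])
      show "\<theta> (g \<otimes>\<^bsub>Q'\<^esub> h) \<in> extensional (carrier N')" by (simp add: \<theta>_def)
    qed (use N'.AutoGroup_mult[OF \<theta>_auto[OF g] \<theta>_auto[OF h]] \<theta>_mult[OF g h] in \<open>auto simp: compose_def\<close>)
  qed
  define \<Phi> where "\<Phi> = (\<lambda>(a, g). \<alpha> a \<otimes> \<beta> g)"
  have img: "\<Phi> ` (carrier N' \<times> carrier Q') = P"
  proof
    show "\<Phi> ` (carrier N' \<times> carrier Q') \<subseteq> P" using \<alpha>N \<beta>Q by (clarsimp simp: \<Phi>_def P_iff) blast
    show "P \<subseteq> \<Phi> ` (carrier N' \<times> carrier Q')"
    proof
      fix z assume "z \<in> P"
      then obtain x q where z: "x \<in> N" "q \<in> Q" "z = x \<otimes> q" using P_iff by auto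
      moreover obtain a where "a \<in> carrier N'" "x = \<alpha> a" using z(1) \<alpha>b by (auto simp: bij_betw_def)
      moreover obtain g where "g \<in> carrier Q'" "q = \<beta> g" using z(2) \<beta>b by (auto simp: bij_betw_def)
      ultimately show "z \<in> \<Phi> ` (carrier N' \<times> carrier Q')" by (force simp: \<Phi>_def)
    qed
  qed
  have inj: "inj_on \<Phi> (carrier N' \<times> carrier Q')"
  proof (rule inj_onI, clarify)
    fix a g b h assume *: "a \<in> carrier N'" "g \<in> carrier Q'" "b \<in> carrier N'" "h \<in> carrier Q'" "\<Phi> (a, g) = \<Phi> (b, h)"
    then have "\<alpha> a = \<alpha> b" "\<beta> g = \<beta> h"
      using product_unique[OF \<alpha>N[OF *(1)] \<beta>Q[OF *(2)] \<alpha>N[OF *(3)] \<beta>Q[OF *(4)]] by (auto simp: \<Phi>_def)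
    then show "a = b \<and> g = h" using * \<alpha>inj \<beta>b by (auto simp: bij_betw_def inj_on_def)
  qed
  have "\<Phi> \<in> hom (semidirect_product N' Q' \<theta>) (A\<lparr>carrier := P\<rparr>)"
  proof (rule homI)
    fix z assume "z \<in> carrier (semidirect_product N' Q' \<theta>)"
    then obtain a g where z: "z = (a, g)" "a \<in> carrier N'" "g \<in> carrier Q'"
      by (auto simp: semidirect_product_def)
    then show "\<Phi> z \<in> carrier (A\<lparr>carrier := P\<rparr>)" using img by auto
    fix w assume "w \<in> carrier (semidirect_product N' Q' \<theta>)"
    then obtain b h where w: "w = (b, h)" "b \<in> carrier N'" "h \<in> carrier Q'"
      by (auto simp: semidirect_product_def)
    show "\<Phi> (z \<otimes>\<^bsub>semidirect_product N' Q' \<theta>\<^esub> w) = \<Phi> z \<otimes>\<^bsub>A\<lparr>carrier := P\<rparr>\<^esub> \<Phi> w"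
      using z w \<theta> \<alpha>h \<beta>h product_mult[OF \<alpha>N \<beta>Q \<alpha>N \<beta>Q]
      by (simp add: semidirect_product_def \<Phi>_def)
  qed
  then have "\<Phi> \<in> iso (semidirect_product N' Q' \<theta>) (A\<lparr>carrier := P\<rparr>)"
    using img inj by (simp add: iso_def bij_betw_def semidirect_product_def)
  moreover have "\<Phi> ` (carrier N' \<times> {\<one>\<^bsub>Q'\<^esub>}) = \<alpha> ` carrier N'"
    using \<beta>1 \<alpha>N NQ_carrier by (force simp: \<Phi>_def)
  moreover have "\<Phi> ` ({\<one>\<^bsub>N'\<^esub>} \<times> carrier Q') = \<beta> ` carrier Q'"
    using \<alpha>1 \<beta>Q NQ_carrier by (force simp: \<Phi>_def)
  ultimately show ?thesis using \<theta>h \<alpha>b \<beta>b by (auto simp: bij_betw_def)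
qed

end

section \<open>The automorphism group of the pure virtual twin group\<close>

context raag
begin

lemma graph_aut_closed: "graph_aut \<pi> \<Longrightarrow> v \<in> V \<Longrightarrow> \<pi> v \<in> V"
  by (auto simp: graph_aut_def bij_betw_def)

lemma graph_aut_id: "graph_aut id"
  by (simp add: graph_aut_def)

lemma graph_aut_comp: "graph_aut \<pi> \<Longrightarrow> graph_aut \<pi>' \<Longrightarrow> graph_aut (\<pi> \<circ> \<pi>')"
  using graph_aut_closed[of \<pi>'] bij_betw_trans[of \<pi>' V V \<pi> V] by (simp add: graph_aut_def)

lemma signed_eqI:
  assumes "graph_aut \<pi>" "\<phi> \<in> auto G" "\<And>v. v \<in> V \<Longrightarrow> \<phi> (\<gamma> v) = spow (v \<in> E) (\<gamma> (\<pi> v))"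
  shows "\<phi> = signed \<pi> E"
  by (rule auto_eqI[OF assms(2) signed_auto_mem[OF assms(1)]]) (simp add: assms(3) signed_gen[OF assms(1)])

lemma compose_gen: "v \<in> V \<Longrightarrow> compose (carrier G) f g (\<gamma> v) = f (g (\<gamma> v))"
  by (simp add: compose_def gen_closed)

lemma signed_comp:
  assumes \<pi>: "graph_aut \<pi>" and \<pi>': "graph_aut \<pi>'"
  shows "compose (carrier G) (signed \<pi> E) (signed \<pi>' E') = signed (\<pi> \<circ> \<pi>') {v. (v \<in> E') \<noteq> (\<pi>' v \<in> E)}"
proof (rule signed_eqI[OF graph_aut_comp[OF \<pi> \<pi>'] auto_compose[OF signed_auto_mem[OF \<pi>] signed_auto_mem[OF \<pi>']]])
  fix v assume v: "v \<in> V"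
  have v': "\<pi>' v \<in> V" "\<pi> (\<pi>' v) \<in> V" using graph_aut_closed \<pi> \<pi>' v by auto
  have "compose (carrier G) (signed \<pi> E) (signed \<pi>' E') (\<gamma> v) = spow (v \<in> E') (spow (\<pi>' v \<in> E) (\<gamma> (\<pi> (\<pi>' v))))"
    using v v' signed_gen[OF \<pi>'] signed_gen[OF \<pi>] hom_spow[OF autoD(1)[OF signed_auto_mem[OF \<pi>]] gen_closed[OF v'(1)]]
    by (simp add: compose_gen)
  then show "compose (carrier G) (signed \<pi> E) (signed \<pi>' E') (\<gamma> v)
      = spow (v \<in> {v. (v \<in> E') \<noteq> (\<pi>' v \<in> E)}) (\<gamma> ((\<pi> \<circ> \<pi>') v))"
    using spow_spow[OF gen_closed[OF v'(2)]] by simp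
qed

text \<open>Only the values on \<open>V\<close> matter, so a vertex map can be exchanged for the
  image map of a permutation of points.\<close>

lemma signed_cong:
  assumes "graph_aut \<pi>" "\<And>v. v \<in> V \<Longrightarrow> \<pi> v = \<pi>' v" "\<And>v. v \<in> V \<Longrightarrow> v \<in> E \<longleftrightarrow> v \<in> E'"
  shows "signed \<pi> E = signed \<pi>' E'"
proof -
  have "bij_betw \<pi>' V V \<longleftrightarrow> bij_betw \<pi> V V" by (rule bij_betw_cong) (use assms(2) in simp)
  then have "graph_aut \<pi>'" using assms(1,2) by (simp add: graph_aut_def)
  then show ?thesis
    by (rule signed_eqI[OF _ signed_auto_mem[OF assms(1)]]) (use assms signed_gen[OF assms(1)] in simp)
qed

lemma spow_gen_inj:
  assumes "u \<in> V" "v \<in> V" "spow b (\<gamma> u) = spow c (\<gamma> v)"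
  shows "u = v \<and> b = c"
proof -
  have e: "expo t (spow b (\<gamma> u)) = expo t (spow c (\<gamma> v))" for t using assms(3) by simp
  show ?thesis using e[of u] assms(1,2) gen_closed by (auto simp: expo_spow expo_gen split: if_splits)
qed

definition inner :: "'a \<Rightarrow> 'a \<Rightarrow> 'a" where
  "inner g = (\<lambda>h\<in>carrier G. g \<otimes> h \<otimes> inv g)"

lemma inner_auto: "g \<in> carrier G \<Longrightarrow> inner g \<in> auto G"
proof -
  assume g: "g \<in> carrier G"
  have "bij_betw (inner g) (carrier G) (carrier G)"
    by (rule bij_betw_byWitness[where f'="inner (inv g)"]) (use g in \<open>auto simp: inner_def m_assoc\<close>)
  moreover have "inner g \<in> hom G G" using g by (auto simp: hom_def inner_def m_assoc)
  ultimately show ?thesis by (simp add: auto_def Bij_def inner_def)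
qed

lemma inner_auts_image: "inner_auts G = inner ` carrier G"
  by (simp add: inner_auts_def inner_def)

lemma inner_mult: "g \<in> carrier G \<Longrightarrow> h \<in> carrier G \<Longrightarrow> inner (g \<otimes> h) = compose (carrier G) (inner g) (inner h)"
  by (rule ext) (simp add: inner_def compose_def inv_mult_group m_assoc)

end

section \<open>Permutation automorphisms and inversions\<close>

context
  fixes n :: nat
  assumes n5: "n \<ge> 5"
begin

interpretation X: rigid_raag "PVT n" "pairs n" disjnt "pair_gen n"
  by (rule rigid_raag_PVT[OF n5])

interpretation A: group "AutoGroup (PVT n)"
  by (rule X.AutoGroup)

lemma auto_carrier: "carrier (AutoGroup (PVT n)) = auto (PVT n)"
  by (simp add: AutoGroup_def)

lemma auto_mult: "\<phi> \<in> auto (PVT n) \<Longrightarrow> \<psi> \<in> auto (PVT n) \<Longrightarrow>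
    \<phi> \<otimes>\<^bsub>AutoGroup (PVT n)\<^esub> \<psi> = compose (carrier (PVT n)) \<phi> \<psi>"
  by (rule X.AutoGroup_mult)

lemma auto_one: "\<one>\<^bsub>AutoGroup (PVT n)\<^esub> = (\<lambda>x\<in>carrier (PVT n). x)"
  by (simp add: AutoGroup_def BijGroup_def)

text \<open>Unlike \<open>theta\<close> this inverts nothing: the generators
  \<open>pair_gen n e\<close> themselves are permuted, as a graph automorphism demands.\<close>

definition perm_aut :: "(nat \<Rightarrow> nat) \<Rightarrow> vt_gen word set \<Rightarrow> vt_gen word set" where
  "perm_aut \<sigma> = X.signed ((`) \<sigma>) {}"

definition inv_aut :: "nat set set \<Rightarrow> vt_gen word set \<Rightarrow> vt_gen word set" where
  "inv_aut E = X.signed id E"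

lemma graph_aut_image: "\<sigma> permutes {1..n} \<Longrightarrow> X.graph_aut ((`) \<sigma>)"
  by (rule raag_graph_aut_image[OF X.raag_axioms])

lemma perm_aut_auto: "\<sigma> permutes {1..n} \<Longrightarrow> perm_aut \<sigma> \<in> auto (PVT n)"
  unfolding perm_aut_def by (rule X.signed_auto_mem[OF graph_aut_image])

lemma perm_aut_gen: "\<sigma> permutes {1..n} \<Longrightarrow> e \<in> pairs n \<Longrightarrow> perm_aut \<sigma> (pair_gen n e) = pair_gen n (\<sigma> ` e)"
  unfolding perm_aut_def using X.signed_gen[OF graph_aut_image] by simp

lemma inv_aut_auto: "inv_aut E \<in> auto (PVT n)"
  unfolding inv_aut_def by (rule X.signed_auto_mem[OF X.graph_aut_id])

lemma inv_aut_gen: "e \<in> pairs n \<Longrightarrow> inv_aut E (pair_gen n e) = X.spow (e \<in> E) (pair_gen n e)"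
  unfolding inv_aut_def using X.signed_gen[OF X.graph_aut_id] by simp

lemma perm_aut_comp:
  assumes "\<sigma> permutes {1..n}" "\<tau> permutes {1..n}"
  shows "perm_aut \<sigma> \<otimes>\<^bsub>AutoGroup (PVT n)\<^esub> perm_aut \<tau> = perm_aut (\<sigma> \<circ> \<tau>)"
proof -
  have "(`) \<sigma> \<circ> (`) \<tau> = (`) (\<sigma> \<circ> \<tau>)" by (auto simp: fun_eq_iff)
  then show ?thesis
    using auto_mult[OF perm_aut_auto perm_aut_auto] assms X.signed_comp[OF graph_aut_image graph_aut_image]
    by (simp add: perm_aut_def)
qed

lemma inv_aut_comp: "inv_aut E \<otimes>\<^bsub>AutoGroup (PVT n)\<^esub> inv_aut E' = inv_aut {v. (v \<in> E') \<noteq> (v \<in> E)}"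
  using auto_mult[OF inv_aut_auto inv_aut_auto] X.signed_comp[OF X.graph_aut_id X.graph_aut_id]
  by (simp add: inv_aut_def)

lemma inv_perm_aut_comp:
  assumes "\<sigma> permutes {1..n}"
  shows "inv_aut E \<otimes>\<^bsub>AutoGroup (PVT n)\<^esub> perm_aut \<sigma> = X.signed ((`) \<sigma>) {e. \<sigma> ` e \<in> E}"
    "perm_aut \<sigma> \<otimes>\<^bsub>AutoGroup (PVT n)\<^esub> inv_aut E = X.signed ((`) \<sigma>) E"
  using auto_mult[OF inv_aut_auto perm_aut_auto[OF assms]] auto_mult[OF perm_aut_auto[OF assms] inv_aut_auto]
    X.signed_comp[OF X.graph_aut_id graph_aut_image[OF assms]] X.signed_comp[OF graph_aut_image[OF assms] X.graph_aut_id]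
  by (simp_all add: inv_aut_def perm_aut_def)

lemma perm_aut_hom: "perm_aut \<in> hom (sym_group n) (AutoGroup (PVT n))"
  by (rule homI) (auto simp: sym_group_carrier sym_group_mult auto_carrier perm_aut_auto perm_aut_comp)

text \<open>A point is the intersection of two pairs through it, so its image is determined by
  theirs.\<close>

lemma image_pairs_inj:
  assumes "\<sigma> permutes {1..n}" "\<tau> permutes {1..n}" "\<And>e. e \<in> pairs n \<Longrightarrow> \<sigma> ` e = \<tau> ` e"
  shows "\<sigma> = \<tau>"
proof
  fix i show "\<sigma> i = \<tau> i"
  proof (cases "i \<in> {1..n}")
    case True
    obtain j where j: "j \<in> {1..n}" "j \<notin> set [i]" by (rule ex_avoid[of "[i]" n]) (use n5 in auto)
    obtain k where k: "k \<in> {1..n}" "k \<notin> set [i, j]" by (rule ex_avoid[of "[i, j]" n]) (use n5 in auto)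
    have "{i, j} \<in> pairs n" "{i, k} \<in> pairs n" using True j k by (auto intro!: pairsI)
    from assms(3)[OF this(1)] assms(3)[OF this(2)]
    have "{\<sigma> i, \<sigma> j} = {\<tau> i, \<tau> j}" "{\<sigma> i, \<sigma> k} = {\<tau> i, \<tau> k}" by simp_all
    moreover have "\<tau> j \<noteq> \<tau> k" using permutes_inj[OF assms(2)] k by (auto simp: inj_eq)
    ultimately show ?thesis by (auto simp: doubleton_eq_iff)
  next
    case False
    then show ?thesis using assms(1,2) permutes_not_in by metis
  qed
qed

lemma perm_aut_inj: "inj_on perm_aut {\<sigma>. \<sigma> permutes {1..n}}"
proof (rule inj_onI, clarify)
  fix \<sigma> \<tau> assume *: "\<sigma> permutes {1..n}" "\<tau> permutes {1..n}" "perm_aut \<sigma> = perm_aut \<tau>"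
  show "\<sigma> = \<tau>"
  proof (rule image_pairs_inj[OF *(1,2)])
    fix e assume e: "e \<in> pairs n"
    have "pair_gen n (\<sigma> ` e) = pair_gen n (\<tau> ` e)" using perm_aut_gen[OF *(1) e] perm_aut_gen[OF *(2) e] *(3) by simp
    then show "\<sigma> ` e = \<tau> ` e"
      using X.inj_gen image_in_pairs[OF *(1)] image_in_pairs[OF *(2)] e by (auto simp: inj_on_def)
  qed
qed

lemma pvt_gens_image: "pvt_gens n = pair_gen n ` pairs n"
proof
  show "pvt_gens n \<subseteq> pair_gen n ` pairs n"
  proof
    fix x assume "x \<in> pvt_gens n"
    then obtain i j where ij: "1 \<le> i" "i < j" "j \<le> n" "x = pvt_gen n i j" by (auto simp: pvt_gens_def)
    then have "{i, j} \<in> pairs n" "x = pair_gen n {i, j}" by (auto simp: pair_gen_def intro!: pairsI)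
    then show "x \<in> pair_gen n ` pairs n" by blast
  qed
  show "pair_gen n ` pairs n \<subseteq> pvt_gens n"
  proof
    fix x assume "x \<in> pair_gen n ` pairs n"
    then obtain e where "e \<in> pairs n" "x = pair_gen n e" by blast
    then obtain i j where "i \<in> {1..n}" "j \<in> {1..n}" "i < j" "x = pvt_gen n i j"
      by (elim pairsE) (auto simp: pair_gen_def)
    then show "x \<in> pvt_gens n" unfolding pvt_gens_def by auto
  qed
qed

lemma commuting_adj_pairs:
  assumes "d \<in> pairs n" "e \<in> pairs n"
  shows "commuting_adj (PVT n) (pair_gen n d) (pair_gen n e) \<longleftrightarrow> disjnt d e"
proof (cases "d = e")
  case True
  then show ?thesis using pairs_not_disjnt[OF assms(1)] by (simp add: commuting_adj_def del: disjnt_self_iff_empty)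
next
  case False
  then show ?thesis using X.inj_gen X.commute_iff_adj assms by (auto simp: commuting_adj_def inj_on_def)
qed

text \<open>Through \<open>pair_gen n\<close> a graph automorphism becomes a bijection of
  \<open>pairs n\<close> that respects disjointness, which \<open>Kneser_automorphism\<close> turns
  into a permutation of the points.\<close>

lemma Aut_gr_generators:
  "{\<phi> \<in> auto (PVT n). \<exists>\<pi> \<in> graph_auts (pvt_gens n) (commuting_adj (PVT n)). \<forall>x\<in>pvt_gens n. \<phi> x = \<pi> x}
    = perm_aut ` {\<sigma>. \<sigma> permutes {1..n}}" (is "?L = ?R")
proof
  show "?L \<subseteq> ?R"
  proof
    fix \<phi> assume "\<phi> \<in> ?L"
    then obtain \<pi> where \<phi>: "\<phi> \<in> auto (PVT n)" and \<pi>: "bij_betw \<pi> (pvt_gens n) (pvt_gens n)"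
      "\<And>x y. x \<in> pvt_gens n \<Longrightarrow> y \<in> pvt_gens n \<Longrightarrow>
         commuting_adj (PVT n) (\<pi> x) (\<pi> y) \<longleftrightarrow> commuting_adj (PVT n) x y"
      and eq: "\<And>x. x \<in> pvt_gens n \<Longrightarrow> \<phi> x = \<pi> x"
      unfolding graph_auts_def by blast
    have g: "bij_betw (pair_gen n) (pairs n) (pvt_gens n)"
      using X.inj_gen by (simp add: bij_betw_def pvt_gens_image)
    let ?k = "inv_into (pairs n) (pair_gen n)"
    let ?p = "?k \<circ> (\<pi> \<circ> pair_gen n)"
    have b: "bij_betw ?p (pairs n) (pairs n)"
      by (intro bij_betw_trans[OF bij_betw_trans[OF g \<pi>(1)] bij_betw_inv_into[OF g]])
    have V: "pair_gen n e \<in> pvt_gens n" "\<pi> (pair_gen n e) \<in> pvt_gens n" "pair_gen n (?p e) = \<pi> (pair_gen n e)"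
      if "e \<in> pairs n" for e
    proof -
      show 1: "pair_gen n e \<in> pvt_gens n" using that by (simp add: pvt_gens_image)
      show 2: "\<pi> (pair_gen n e) \<in> pvt_gens n" by (rule bij_betw_apply[OF \<pi>(1) 1])
      show "pair_gen n (?p e) = \<pi> (pair_gen n e)" using bij_betw_inv_into_right[OF g 2] by simp
    qed
    have a: "disjnt (?p d) (?p e) \<longleftrightarrow> disjnt d e" if de: "d \<in> pairs n" "e \<in> pairs n" for d e
    proof -
      have "disjnt (?p d) (?p e) \<longleftrightarrow> commuting_adj (PVT n) (pair_gen n (?p d)) (pair_gen n (?p e))"
        by (rule commuting_adj_pairs[OF bij_betw_apply[OF b de(1)] bij_betw_apply[OF b de(2)], symmetric])
      also have "\<dots> \<longleftrightarrow> disjnt d e"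
        unfolding V(3)[OF de(1)] V(3)[OF de(2)]
        using \<pi>(2)[OF V(1)[OF de(1)] V(1)[OF de(2)]] commuting_adj_pairs[OF de] by (simp only:)
      finally show ?thesis .
    qed
    obtain \<sigma> where \<sigma>: "\<sigma> permutes {1..n}" "\<And>e. e \<in> pairs n \<Longrightarrow> ?p e = \<sigma> ` e"
      using Kneser_automorphism[OF n5 b a] by blast
    have "\<phi> = perm_aut \<sigma>"
    proof (rule X.auto_eqI[OF \<phi> perm_aut_auto[OF \<sigma>(1)]])
      fix e assume e: "e \<in> pairs n"
      have "\<phi> (pair_gen n e) = pair_gen n (?p e)" using eq[OF V(1)[OF e]] V(3)[OF e] by simp
      then show "\<phi> (pair_gen n e) = perm_aut \<sigma> (pair_gen n e)"
        unfolding \<sigma>(2)[OF e] perm_aut_gen[OF \<sigma>(1) e] .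
    qed
    then show "\<phi> \<in> ?R" using \<sigma>(1) by blast
  qed
  show "?R \<subseteq> ?L"
  proof
    fix \<phi> assume "\<phi> \<in> ?R"
    then obtain \<sigma> where \<sigma>: "\<sigma> permutes {1..n}" "\<phi> = perm_aut \<sigma>" by blast
    have im: "\<sigma> ` e \<in> pairs n" if "e \<in> pairs n" for e using image_in_pairs[OF \<sigma>(1)] that by simp
    have "bij_betw \<phi> (pvt_gens n) (pvt_gens n)"
    proof (rule bij_betwI')
      show "\<phi> x = \<phi> y \<longleftrightarrow> x = y" if "x \<in> pvt_gens n" "y \<in> pvt_gens n" for x y
        unfolding \<sigma>(2)
        by (rule inj_on_eq_iff[OF bij_betw_imp_inj_on[OF X.autoD(2)[OF perm_aut_auto[OF \<sigma>(1)]]]])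
          (use that pvt_gens_subset[of n] in blast)+
      show "\<phi> x \<in> pvt_gens n" if "x \<in> pvt_gens n" for x
        using that perm_aut_gen[OF \<sigma>(1)] im \<sigma>(2) by (auto simp: pvt_gens_image)
      show "\<exists>x\<in>pvt_gens n. y = \<phi> x" if y: "y \<in> pvt_gens n" for y
      proof -
        obtain e where e: "e \<in> pairs n" "y = pair_gen n e" using y by (auto simp: pvt_gens_image)
        have "inv' \<sigma> ` e \<in> pairs n" using image_in_pairs[OF permutes_inv[OF \<sigma>(1)]] e(1) by simp
        moreover have "\<sigma> ` (inv' \<sigma> ` e) = e" by (simp add: image_comp permutes_inv_o[OF \<sigma>(1)])
        ultimately show ?thesis
          using perm_aut_gen[OF \<sigma>(1), of "inv' \<sigma> ` e"] e(2) \<sigma>(2) by (auto simp: pvt_gens_image)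
      qed
    qed
    moreover have "commuting_adj (PVT n) (\<phi> x) (\<phi> y) \<longleftrightarrow> commuting_adj (PVT n) x y"
      if xy: "x \<in> pvt_gens n" "y \<in> pvt_gens n" for x y
    proof -
      obtain d e where de: "d \<in> pairs n" "x = pair_gen n d" "e \<in> pairs n" "y = pair_gen n e"
        using xy unfolding pvt_gens_image by blast
      have "disjnt (\<sigma> ` d) (\<sigma> ` e) \<longleftrightarrow> disjnt d e"
        using permutes_inj[OF \<sigma>(1)] by (auto simp: disjnt_def inj_def)
      then show ?thesis
        using de \<sigma>(2) perm_aut_gen[OF \<sigma>(1)] commuting_adj_pairs[OF im[OF de(1)] im[OF de(3)]]
          commuting_adj_pairs[OF de(1,3)] by simp
    qed
    ultimately have "\<phi> \<in> graph_auts (pvt_gens n) (commuting_adj (PVT n))" by (simp add: graph_auts_def)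
    then show "\<phi> \<in> ?L" using perm_aut_auto[OF \<sigma>(1)] \<sigma>(2) by blast
  qed
qed

lemma Aut_gr_eq: "Aut_gr n = perm_aut ` {\<sigma>. \<sigma> permutes {1..n}}"
  and Aut_gr_subgroup: "subgroup (Aut_gr n) (AutoGroup (PVT n))"
proof -
  interpret h: group_hom "sym_group n" "AutoGroup (PVT n)" perm_aut
    by (simp add: group_hom_def group_hom_axioms_def sym_group_is_group A.is_group perm_aut_hom)
  have "carrier (sym_group n) = {\<sigma>. \<sigma> permutes {1..n}}" by (simp add: sym_group_def)
  then have s: "subgroup (perm_aut ` {\<sigma>. \<sigma> permutes {1..n}}) (AutoGroup (PVT n))"
    using h.img_is_subgroup by simp
  have "generate (AutoGroup (PVT n)) (perm_aut ` {\<sigma>. \<sigma> permutes {1..n}}) = perm_aut ` {\<sigma>. \<sigma> permutes {1..n}}"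
    using A.generate_subgroup_incl[OF order_refl s] by (auto intro: generate.incl)
  then show "Aut_gr n = perm_aut ` {\<sigma>. \<sigma> permutes {1..n}}" by (simp add: Aut_gr_def Aut_gr_generators)
  then show "subgroup (Aut_gr n) (AutoGroup (PVT n))" using s by simp
qed

lemma inv_aut_cong: "E \<inter> pairs n = E' \<inter> pairs n \<Longrightarrow> inv_aut E = inv_aut E'"
  unfolding inv_aut_def by (rule X.signed_cong[OF X.graph_aut_id]) auto

lemma inv_aut_empty: "inv_aut {} = \<one>\<^bsub>AutoGroup (PVT n)\<^esub>"
proof -
  have "\<one>\<^bsub>AutoGroup (PVT n)\<^esub> = inv_aut {}"
    unfolding inv_aut_def
  proof (rule X.signed_eqI[OF X.graph_aut_id])
    show "\<one>\<^bsub>AutoGroup (PVT n)\<^esub> \<in> auto (PVT n)" using A.one_closed by (simp add: auto_carrier)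
  qed (simp add: auto_one X.gen_closed)
  then show ?thesis by simp
qed

lemma inv_aut_subgroup: "subgroup (inv_aut ` Pow (pairs n)) (AutoGroup (PVT n))"
proof (rule A.subgroupI)
  show "inv_aut ` Pow (pairs n) \<subseteq> carrier (AutoGroup (PVT n))" using inv_aut_auto by (auto simp: auto_carrier)
  fix a assume "a \<in> inv_aut ` Pow (pairs n)"
  then obtain E where E: "E \<subseteq> pairs n" "a = inv_aut E" by blast
  have "inv_aut E \<otimes>\<^bsub>AutoGroup (PVT n)\<^esub> inv_aut E = \<one>\<^bsub>AutoGroup (PVT n)\<^esub>"
    using inv_aut_comp[of E E] by (simp add: inv_aut_empty)
  then have "inv\<^bsub>AutoGroup (PVT n)\<^esub> a = a"
    using inv_aut_auto E(2) by (intro A.inv_equality) (auto simp: auto_carrier)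
  then show "inv\<^bsub>AutoGroup (PVT n)\<^esub> a \<in> inv_aut ` Pow (pairs n)" using E by auto
  fix b assume "b \<in> inv_aut ` Pow (pairs n)"
  then obtain E' where E': "E' \<subseteq> pairs n" "b = inv_aut E'" by blast
  have "{v. (v \<in> E') \<noteq> (v \<in> E)} \<subseteq> pairs n" using E E' by auto
  then show "a \<otimes>\<^bsub>AutoGroup (PVT n)\<^esub> b \<in> inv_aut ` Pow (pairs n)"
    unfolding E(2) E'(2) inv_aut_comp by blast
qed auto

text \<open>An inversion is \<open>inv_aut\<close> of a singleton. Products are symmetric
  differences, so singletons build up every set of pairs.\<close>

lemma Aut_inv_eq: "Aut_inv n = inv_aut ` Pow (pairs n)"
proof -
  let ?G = "{\<phi> \<in> auto (PVT n). \<exists>x\<in>pvt_gens n.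
        \<phi> x = inv\<^bsub>PVT n\<^esub> x \<and> (\<forall>y\<in>pvt_gens n - {x}. \<phi> y = y)}"
  have single: "inv_aut {e} \<in> ?G" if e: "e \<in> pairs n" for e
  proof -
    have "inv_aut {e} y = y" if y: "y \<in> pvt_gens n - {pair_gen n e}" for y
    proof -
      obtain d where "d \<in> pairs n" "y = pair_gen n d" "d \<noteq> e" using y unfolding pvt_gens_image by blast
      then show ?thesis using inv_aut_gen[of d "{e}"] by simp
    qed
    then show ?thesis
      using e inv_aut_auto inv_aut_gen[OF e, of "{e}"] by (auto simp: pvt_gens_image X.spow_def)
  qed
  have "?G \<subseteq> inv_aut ` Pow (pairs n)"
  proof
    fix \<phi> assume "\<phi> \<in> ?G"
    then obtain e where \<phi>: "\<phi> \<in> auto (PVT n)" and e: "e \<in> pairs n" "\<phi> (pair_gen n e) = inv\<^bsub>PVT n\<^esub> pair_gen n e"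
      and others: "\<And>y. y \<in> pvt_gens n - {pair_gen n e} \<Longrightarrow> \<phi> y = y" unfolding pvt_gens_image by blast
    have "\<phi> = inv_aut {e}" unfolding inv_aut_def
    proof (rule X.signed_eqI[OF X.graph_aut_id \<phi>])
      fix d assume d: "d \<in> pairs n"
      show "\<phi> (pair_gen n d) = X.spow (d \<in> {e}) (pair_gen n (id d))"
      proof (cases "d = e")
        case False
        then have "pair_gen n d \<in> pvt_gens n - {pair_gen n e}"
          using d e(1) X.inj_gen by (auto simp: pvt_gens_image inj_on_def)
        then show ?thesis using others False by simp
      qed (use e in \<open>simp add: X.spow_def\<close>)
    qed
    then show "\<phi> \<in> inv_aut ` Pow (pairs n)" using e(1) by blast
  qed
  then have "Aut_inv n \<subseteq> inv_aut ` Pow (pairs n)"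
    unfolding Aut_inv_def by (rule A.generate_subgroup_incl[OF _ inv_aut_subgroup])
  moreover have "inv_aut E \<in> Aut_inv n" if E: "E \<subseteq> pairs n" for E
  proof -
    have "inv_aut E \<in> generate (AutoGroup (PVT n)) ?G"
      using finite_subset[OF E finite_pairs] E
    proof (induction rule: finite_subset_induct)
      case empty
      then show ?case by (simp add: inv_aut_empty generate.one)
    next
      case (insert e U)
      have "{v. (v \<in> U) \<noteq> (v \<in> {e})} = Set.insert e U" using insert.hyps by auto
      then have "inv_aut (Set.insert e U) = inv_aut {e} \<otimes>\<^bsub>AutoGroup (PVT n)\<^esub> inv_aut U"
        using inv_aut_comp[of "{e}" U] by simp
      moreover have "inv_aut {e} \<in> generate (AutoGroup (PVT n)) ?G"
        by (rule generate.incl[OF single]) (rule insert.hyps)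
      ultimately show ?case using insert.IH by (auto intro: generate.eng)
    qed
    then show ?thesis by (simp add: Aut_inv_def)
  qed
  ultimately show ?thesis by blast
qed

text \<open>Conjugation by a permutation moves the set of inverted pairs to its image. The
  intersection is trivial because a permutation automorphism takes generators to generators, without
  signs.\<close>

lemma Aut_gr_inv_semidirect:
  "internal_semidirect (AutoGroup (PVT n)) (Aut_inv n) (Aut_gr n) (Aut_gr_inv n)"
proof (intro internal_semidirect.intro internal_semidirect_axioms.intro)
  show "group (AutoGroup (PVT n))" by (rule A.is_group)
  show "subgroup (Aut_inv n) (AutoGroup (PVT n))" unfolding Aut_inv_eq by (rule inv_aut_subgroup)
  show "subgroup (Aut_gr n) (AutoGroup (PVT n))" by (rule Aut_gr_subgroup)
  show "Aut_gr_inv n = generate (AutoGroup (PVT n)) (Aut_gr n \<union> Aut_inv n)" by (simp add: Aut_gr_inv_def)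
next
  fix q x assume "q \<in> Aut_gr n" "x \<in> Aut_inv n"
  then obtain \<sigma> E where \<sigma>: "\<sigma> permutes {1..n}" "q = perm_aut \<sigma>" and E: "E \<subseteq> pairs n" "x = inv_aut E"
    by (auto simp: Aut_gr_eq Aut_inv_eq)
  have c: "q \<in> carrier (AutoGroup (PVT n))" "inv_aut D \<in> carrier (AutoGroup (PVT n))" for D
    using perm_aut_auto inv_aut_auto \<sigma> by (auto simp: auto_carrier)
  let ?D = "(`) \<sigma> ` E"
  have D: "?D \<subseteq> pairs n" using E(1) image_in_pairs[OF \<sigma>(1)] by auto
  have "{e. \<sigma> ` e \<in> ?D} = E"
    using inj_image_eq_iff[OF permutes_inj[OF \<sigma>(1)]] by auto
  then have "q \<otimes>\<^bsub>AutoGroup (PVT n)\<^esub> x = inv_aut ?D \<otimes>\<^bsub>AutoGroup (PVT n)\<^esub> q"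
    using inv_perm_aut_comp[OF \<sigma>(1), of ?D] inv_perm_aut_comp[OF \<sigma>(1), of E] \<sigma>(2) E(2) by simp
  then have "q \<otimes>\<^bsub>AutoGroup (PVT n)\<^esub> x \<otimes>\<^bsub>AutoGroup (PVT n)\<^esub> inv\<^bsub>AutoGroup (PVT n)\<^esub> q = inv_aut ?D"
    using c by (simp add: A.m_assoc)
  then show "q \<otimes>\<^bsub>AutoGroup (PVT n)\<^esub> x \<otimes>\<^bsub>AutoGroup (PVT n)\<^esub> inv\<^bsub>AutoGroup (PVT n)\<^esub> q \<in> Aut_inv n"
    using D unfolding Aut_inv_eq by simp
next
  fix x assume "x \<in> Aut_inv n" "x \<in> Aut_gr n"
  then obtain \<sigma> E where \<sigma>: "\<sigma> permutes {1..n}" "x = perm_aut \<sigma>" and E: "E \<subseteq> pairs n" "x = inv_aut E"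
    by (auto simp: Aut_gr_eq Aut_inv_eq)
  have "e \<notin> E" if e: "e \<in> pairs n" for e
  proof -
    have "X.spow (e \<in> E) (pair_gen n e) = X.spow False (pair_gen n (\<sigma> ` e))"
      unfolding X.spow_False inv_aut_gen[OF e, symmetric] perm_aut_gen[OF \<sigma>(1) e, symmetric]
      using \<sigma>(2) E(2) by simp
    then show ?thesis using X.spow_gen_inj[of e "\<sigma> ` e"] e image_in_pairs[OF \<sigma>(1), of e] by blast
  qed
  then have "E = {}" using E(1) by blast
  then show "x = \<one>\<^bsub>AutoGroup (PVT n)\<^esub>" using E(2) inv_aut_empty by simp
qed

interpretation S: internal_semidirect "AutoGroup (PVT n)" "Aut_inv n" "Aut_gr n" "Aut_gr_inv n"
  by (rule Aut_gr_inv_semidirect)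

lemma Aut_gr_inv_signed: "z \<in> Aut_gr_inv n \<longleftrightarrow> (\<exists>\<sigma> E. \<sigma> permutes {1..n} \<and> z = X.signed ((`) \<sigma>) E)"
proof
  assume "z \<in> Aut_gr_inv n"
  then obtain x q where "x \<in> Aut_inv n" "q \<in> Aut_gr n" "z = x \<otimes>\<^bsub>AutoGroup (PVT n)\<^esub> q" using S.P_iff by blast
  then show "\<exists>\<sigma> E. \<sigma> permutes {1..n} \<and> z = X.signed ((`) \<sigma>) E"
    using inv_perm_aut_comp(1) by (auto simp: Aut_gr_eq Aut_inv_eq)
next
  assume "\<exists>\<sigma> E. \<sigma> permutes {1..n} \<and> z = X.signed ((`) \<sigma>) E"
  then obtain \<sigma> E where \<sigma>: "\<sigma> permutes {1..n}" "z = X.signed ((`) \<sigma>) E" by blast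
  have "inv_aut E = inv_aut (E \<inter> pairs n)" by (rule inv_aut_cong) auto
  then have "perm_aut \<sigma> \<in> Aut_gr n" "inv_aut E \<in> Aut_inv n" using \<sigma>(1) by (auto simp: Aut_gr_eq Aut_inv_eq)
  then have "perm_aut \<sigma> \<otimes>\<^bsub>AutoGroup (PVT n)\<^esub> inv_aut E \<in> Aut_gr_inv n"
    using S.subset_P subgroup.m_closed[OF S.P_subgroup] by blast
  then show "z \<in> Aut_gr_inv n" using inv_perm_aut_comp(2)[OF \<sigma>(1)] \<sigma>(2) by simp
qed

section \<open>Inner automorphisms and their complement\<close>

lemma inner_hom: "X.inner \<in> hom (PVT n) (AutoGroup (PVT n))"
  by (rule homI) (simp_all add: auto_carrier X.inner_auto X.inner_mult auto_mult)

lemma inner_auts_subgroup: "subgroup (inner_auts (PVT n)) (AutoGroup (PVT n))"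
proof -
  interpret h: group_hom "PVT n" "AutoGroup (PVT n)" X.inner
    by (simp add: group_hom_def group_hom_axioms_def X.is_group A.is_group inner_hom)
  show ?thesis unfolding X.inner_auts_image by (rule h.img_is_subgroup)
qed

lemma inner_one: "X.inner \<one>\<^bsub>PVT n\<^esub> = \<one>\<^bsub>AutoGroup (PVT n)\<^esub>"
  using hom_one[OF inner_hom X.is_group A.is_group] .

lemma auto_inner:
  assumes "\<phi> \<in> auto (PVT n)"
  shows "\<exists>g\<in>carrier (PVT n). \<exists>\<omega>\<in>Aut_gr_inv n. \<phi> = X.inner g \<otimes>\<^bsub>AutoGroup (PVT n)\<^esub> \<omega>"
proof -
  obtain g \<pi> E where g: "g \<in> carrier (PVT n)" and \<pi>: "X.graph_aut \<pi>"
    and eq: "\<And>x. x \<in> carrier (PVT n) \<Longrightarrow> \<phi> x = g \<otimes>\<^bsub>PVT n\<^esub> X.signed \<pi> E x \<otimes>\<^bsub>PVT n\<^esub> inv\<^bsub>PVT n\<^esub> g"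
    using X.auto_decomposition[OF assms] by blast
  obtain \<sigma> where \<sigma>: "\<sigma> permutes {1..n}" "\<And>e. e \<in> pairs n \<Longrightarrow> \<pi> e = \<sigma> ` e"
  proof -
    have b: "bij_betw \<pi> (pairs n) (pairs n)"
      and a: "\<And>d e. d \<in> pairs n \<Longrightarrow> e \<in> pairs n \<Longrightarrow> disjnt (\<pi> d) (\<pi> e) \<longleftrightarrow> disjnt d e"
      using \<pi> by (simp_all add: X.graph_aut_def)
    show thesis using Kneser_automorphism[OF n5 b a] that by blast
  qed
  have "X.signed \<pi> E = X.signed ((`) \<sigma>) E" by (rule X.signed_cong[OF \<pi>]) (simp_all add: \<sigma>(2))
  then have s: "X.signed \<pi> E \<in> Aut_gr_inv n" using Aut_gr_inv_signed \<sigma>(1) by blast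
  have sa: "X.signed \<pi> E \<in> auto (PVT n)" by (rule X.signed_auto_mem[OF \<pi>])
  have "\<phi> = compose (carrier (PVT n)) (X.inner g) (X.signed \<pi> E)"
  proof (rule extensionalityI[OF X.autoD(3)[OF assms] compose_extensional])
    fix x assume x: "x \<in> carrier (PVT n)"
    then show "\<phi> x = compose (carrier (PVT n)) (X.inner g) (X.signed \<pi> E) x"
      using eq hom_in_carrier[OF X.autoD(1)[OF sa] x] by (simp add: compose_def X.inner_def)
  qed
  then have "\<phi> = X.inner g \<otimes>\<^bsub>AutoGroup (PVT n)\<^esub> X.signed \<pi> E"
    using auto_mult[OF X.inner_auto[OF g] sa] by simp
  then show ?thesis using g s by blast
qed

text \<open>An automorphism \<phi> turns conjugation by \<open>g\<close> into conjugation by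
  \<open>\<phi> g\<close>. The intersection is trivial since by \<open>signed_eq_conj\<close> a
  signed automorphism that is a conjugation comes from \<one>.\<close>

lemma Aut_semidirect:
  "internal_semidirect (AutoGroup (PVT n)) (inner_auts (PVT n)) (Aut_gr_inv n) (carrier (AutoGroup (PVT n)))"
proof (intro internal_semidirect.intro internal_semidirect_axioms.intro)
  show "group (AutoGroup (PVT n))" by (rule A.is_group)
  show "subgroup (inner_auts (PVT n)) (AutoGroup (PVT n))" by (rule inner_auts_subgroup)
  show "subgroup (Aut_gr_inv n) (AutoGroup (PVT n))" by (rule S.P_subgroup)
  show "carrier (AutoGroup (PVT n)) = generate (AutoGroup (PVT n)) (Aut_gr_inv n \<union> inner_auts (PVT n))"
  proof
    show "carrier (AutoGroup (PVT n)) \<subseteq> generate (AutoGroup (PVT n)) (Aut_gr_inv n \<union> inner_auts (PVT n))"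
    proof
      fix \<phi> assume "\<phi> \<in> carrier (AutoGroup (PVT n))"
      then obtain g \<omega> where "g \<in> carrier (PVT n)" "\<omega> \<in> Aut_gr_inv n" "\<phi> = X.inner g \<otimes>\<^bsub>AutoGroup (PVT n)\<^esub> \<omega>"
        using auto_inner[of \<phi>] unfolding auto_carrier by blast
      then show "\<phi> \<in> generate (AutoGroup (PVT n)) (Aut_gr_inv n \<union> inner_auts (PVT n))"
        unfolding X.inner_auts_image by (auto intro!: generate.eng intro: generate.incl)
    qed
    show "generate (AutoGroup (PVT n)) (Aut_gr_inv n \<union> inner_auts (PVT n)) \<subseteq> carrier (AutoGroup (PVT n))"
      by (rule A.generate_incl)
         (use subgroup.subset[OF S.P_subgroup] subgroup.subset[OF inner_auts_subgroup] in blast)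
  qed
next
  fix \<phi> x assume "\<phi> \<in> Aut_gr_inv n" "x \<in> inner_auts (PVT n)"
  then obtain g where g: "g \<in> carrier (PVT n)" "x = X.inner g" and \<phi>: "\<phi> \<in> auto (PVT n)"
    using subgroup.subset[OF S.P_subgroup] by (auto simp: X.inner_auts_image auto_carrier)
  interpret h: group_hom "PVT n" "PVT n" \<phi>
    by (simp add: group_hom_def group_hom_axioms_def X.is_group X.autoD(1)[OF \<phi>])
  have "compose (carrier (PVT n)) \<phi> (X.inner g) = compose (carrier (PVT n)) (X.inner (\<phi> g)) \<phi>"
    by (rule ext) (use g(1) in \<open>simp add: compose_def X.inner_def\<close>)
  then have *: "\<phi> \<otimes>\<^bsub>AutoGroup (PVT n)\<^esub> x = X.inner (\<phi> g) \<otimes>\<^bsub>AutoGroup (PVT n)\<^esub> \<phi>"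
    using auto_mult \<phi> X.inner_auto g by simp
  then have "\<phi> \<otimes>\<^bsub>AutoGroup (PVT n)\<^esub> x \<otimes>\<^bsub>AutoGroup (PVT n)\<^esub> inv\<^bsub>AutoGroup (PVT n)\<^esub> \<phi> = X.inner (\<phi> g)"
  proof -
    have "\<phi> \<in> carrier (AutoGroup (PVT n))" "X.inner (\<phi> g) \<in> carrier (AutoGroup (PVT n))"
      using \<phi> X.inner_auto g(1) by (simp_all add: auto_carrier)
    then show ?thesis using * by (simp add: A.m_assoc)
  qed
  then show "\<phi> \<otimes>\<^bsub>AutoGroup (PVT n)\<^esub> x \<otimes>\<^bsub>AutoGroup (PVT n)\<^esub> inv\<^bsub>AutoGroup (PVT n)\<^esub> \<phi> \<in> inner_auts (PVT n)"
    using g(1) by (simp add: X.inner_auts_image)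
next
  fix x assume "x \<in> inner_auts (PVT n)" "x \<in> Aut_gr_inv n"
  then obtain g \<sigma> E where g: "g \<in> carrier (PVT n)" "x = X.inner g" and \<sigma>: "\<sigma> permutes {1..n}" "x = X.signed ((`) \<sigma>) E"
    by (auto simp: X.inner_auts_image Aut_gr_inv_signed)
  have "g = \<one>\<^bsub>PVT n\<^esub>"
  proof (rule X.signed_eq_conj[OF graph_aut_image[OF \<sigma>(1)] g(1)])
    fix y assume y: "y \<in> carrier (PVT n)"
    have "X.signed ((`) \<sigma>) E = X.inner g" using g(2) \<sigma>(2) by simp
    then show "X.signed ((`) \<sigma>) E y = g \<otimes>\<^bsub>PVT n\<^esub> y \<otimes>\<^bsub>PVT n\<^esub> inv\<^bsub>PVT n\<^esub> g"
      using y by (simp add: X.inner_def)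
  qed
  then show "x = \<one>\<^bsub>AutoGroup (PVT n)\<^esub>" using g(2) inner_one by simp
qed

interpretation I: internal_semidirect "AutoGroup (PVT n)" "inner_auts (PVT n)" "Aut_gr_inv n" "carrier (AutoGroup (PVT n))"
  by (rule Aut_semidirect)

text \<open>The kernel of \<open>inner\<close> is the center, which is trivial.\<close>

lemma inner_iso: "X.inner \<in> iso (PVT n) (aut_subgroup n (inner_auts (PVT n)))"
proof -
  interpret h: group_hom "PVT n" "AutoGroup (PVT n)" X.inner
    by (simp add: group_hom_def group_hom_axioms_def X.is_group A.is_group inner_hom)
  have "inj_on X.inner (carrier (PVT n))"
  proof (rule h.trivial_ker_imp_inj)
    show "kernel (PVT n) (AutoGroup (PVT n)) X.inner = {\<one>\<^bsub>PVT n\<^esub>}"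
    proof
      show "kernel (PVT n) (AutoGroup (PVT n)) X.inner \<subseteq> {\<one>\<^bsub>PVT n\<^esub>}"
      proof
        fix g assume "g \<in> kernel (PVT n) (AutoGroup (PVT n)) X.inner"
        then have g: "g \<in> carrier (PVT n)" "X.inner g = (\<lambda>x\<in>carrier (PVT n). x)" by (auto simp: kernel_def auto_one)
        have "g = \<one>\<^bsub>PVT n\<^esub>"
        proof (rule X.trivial_center[OF g(1)])
          fix e assume e: "e \<in> pairs n"
          note c = X.gen_closed[OF e]
          have "g \<otimes>\<^bsub>PVT n\<^esub> pair_gen n e \<otimes>\<^bsub>PVT n\<^esub> inv\<^bsub>PVT n\<^esub> g = pair_gen n e"
            using fun_cong[OF g(2), of "pair_gen n e"] c by (simp add: X.inner_def)
          then have "pair_gen n e \<otimes>\<^bsub>PVT n\<^esub> g = g \<otimes>\<^bsub>PVT n\<^esub> pair_gen n e \<otimes>\<^bsub>PVT n\<^esub> inv\<^bsub>PVT n\<^esub> g \<otimes>\<^bsub>PVT n\<^esub> g" by simp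
          then show "g \<otimes>\<^bsub>PVT n\<^esub> pair_gen n e = pair_gen n e \<otimes>\<^bsub>PVT n\<^esub> g" using g(1) c by (simp add: X.m_assoc)
        qed
        then show "g \<in> {\<one>\<^bsub>PVT n\<^esub>}" by simp
      qed
    qed (simp add: kernel_def)
  qed
  moreover have "X.inner \<in> hom (PVT n) (aut_subgroup n (inner_auts (PVT n)))"
    using inner_hom by (auto simp: hom_def X.inner_auts_image)
  ultimately show ?thesis by (simp add: iso_def bij_betw_def X.inner_auts_image)
qed

lemma perm_aut_iso: "perm_aut \<in> iso (sym_group n) (aut_subgroup n (Aut_gr n))"
proof -
  have c: "carrier (sym_group n) = {\<sigma>. \<sigma> permutes {1..n}}" by (simp add: sym_group_def)
  have "perm_aut \<in> hom (sym_group n) (aut_subgroup n (Aut_gr n))"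
    using perm_aut_hom by (auto simp: hom_def Aut_gr_eq c)
  then show ?thesis using perm_aut_inj by (simp add: iso_def bij_betw_def Aut_gr_eq c)
qed

lemma card_pairs: "card (pairs n) = n * (n - 1) div 2"
  unfolding pairs_def by (simp add: n_subsets choose_two)

text \<open>Through an enumeration \<open>b\<close> of the pairs a vector becomes the set of pairs
  with coordinate 1, and addition modulo 2 becomes symmetric difference, which is how
  \<open>inv_aut\<close> composes.\<close>

lemma Z2_iso: "\<exists>\<alpha>. \<alpha> \<in> iso (Z2_pairs n) (aut_subgroup n (Aut_inv n))"
proof -
  let ?m = "n * (n - 1) div 2"
  obtain b where b: "bij_betw b {..<?m} (pairs n)"
    using finite_same_card_bij[of "{..<?m}" "pairs n"] finite_pairs card_pairs by auto
  define D where "D f = b ` {i \<in> {..<?m}. f i = (1::int)}" for f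
  have c: "carrier (Z2_pairs n) = {..<?m} \<rightarrow>\<^sub>E {0..<2}"
    by (simp add: Z2_power_def carrier_integer_mod_group)
  have memD: "b i \<in> D f \<longleftrightarrow> f i = 1" if "i < ?m" for i f
    using that b by (auto simp: D_def bij_betw_def inj_on_def)
  have D_sub: "D f \<subseteq> pairs n" for f using b by (auto simp: D_def bij_betw_def)
  have vals: "f i = 0 \<or> f i = 1" if "f \<in> carrier (Z2_pairs n)" "i < ?m" for f i
  proof -
    have "f i \<in> {0..<2}" by (rule PiE_mem[OF that(1)[unfolded c]]) (use that(2) in simp)
    then show ?thesis by auto
  qed
  have ex_i: "\<exists>i<?m. e = b i" if "e \<in> pairs n" for e using that b by (auto simp: bij_betw_def)
  have "(\<lambda>f. inv_aut (D f)) \<in> hom (Z2_pairs n) (aut_subgroup n (Aut_inv n))"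
  proof (rule homI)
    fix f assume f: "f \<in> carrier (Z2_pairs n)"
    show "inv_aut (D f) \<in> carrier (aut_subgroup n (Aut_inv n))" using D_sub by (simp add: Aut_inv_eq)
    fix g assume g: "g \<in> carrier (Z2_pairs n)"
    have "D (f \<otimes>\<^bsub>Z2_pairs n\<^esub> g) \<inter> pairs n = {v. (v \<in> D g) \<noteq> (v \<in> D f)} \<inter> pairs n"
    proof (rule Set.set_eqI)
      fix e show "e \<in> D (f \<otimes>\<^bsub>Z2_pairs n\<^esub> g) \<inter> pairs n \<longleftrightarrow> e \<in> {v. (v \<in> D g) \<noteq> (v \<in> D f)} \<inter> pairs n"
      proof (cases "e \<in> pairs n")
        case True
        then obtain i where i: "i < ?m" "e = b i" using ex_i by blast
        have "(f \<otimes>\<^bsub>Z2_pairs n\<^esub> g) i = (f i + g i) mod 2" using i by (simp add: Z2_power_def)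
        moreover have "e \<in> D h \<longleftrightarrow> h i = 1" for h unfolding i(2) by (rule memD[OF i(1)])
        ultimately have "e \<in> D (f \<otimes>\<^bsub>Z2_pairs n\<^esub> g) \<longleftrightarrow> (e \<in> D g) \<noteq> (e \<in> D f)"
          using vals[OF f i(1)] vals[OF g i(1)] by (elim disjE) simp_all
        then show ?thesis using True by simp
      qed simp
    qed
    then have "inv_aut (D (f \<otimes>\<^bsub>Z2_pairs n\<^esub> g)) = inv_aut {v. (v \<in> D g) \<noteq> (v \<in> D f)}"
      by (rule inv_aut_cong)
    then show "inv_aut (D (f \<otimes>\<^bsub>Z2_pairs n\<^esub> g)) = inv_aut (D f) \<otimes>\<^bsub>aut_subgroup n (Aut_inv n)\<^esub> inv_aut (D g)"
      using inv_aut_comp by simp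
  qed
  moreover have "inj_on (\<lambda>f. inv_aut (D f)) (carrier (Z2_pairs n))"
  proof (rule inj_onI)
    fix f g assume f: "f \<in> carrier (Z2_pairs n)" and g: "g \<in> carrier (Z2_pairs n)" and eq: "inv_aut (D f) = inv_aut (D g)"
    have "f i = g i" if i: "i < ?m" for i
    proof -
      have e: "b i \<in> pairs n" using b i by (auto simp: bij_betw_def)
      have "(b i \<in> D f) = (b i \<in> D g)"
        using X.spow_gen_inj[OF e e] inv_aut_gen[OF e] eq by metis
      then have "f i = 1 \<longleftrightarrow> g i = 1" using memD[OF i] by simp
      then show ?thesis using vals[OF f i] vals[OF g i] by (elim disjE) simp_all
    qed
    then show "f = g" by (intro PiE_ext[OF f[unfolded c] g[unfolded c]]) simp
  qed
  moreover have "(\<lambda>f. inv_aut (D f)) ` carrier (Z2_pairs n) = Aut_inv n"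
  proof
    show "(\<lambda>f. inv_aut (D f)) ` carrier (Z2_pairs n) \<subseteq> Aut_inv n" using D_sub by (auto simp: Aut_inv_eq)
    show "Aut_inv n \<subseteq> (\<lambda>f. inv_aut (D f)) ` carrier (Z2_pairs n)"
    proof
      fix x assume "x \<in> Aut_inv n"
      then obtain E where E: "E \<subseteq> pairs n" "x = inv_aut E" by (auto simp: Aut_inv_eq)
      let ?f = "\<lambda>i\<in>{..<?m}. if b i \<in> E then 1 else 0"
      have "D ?f = E"
      proof (rule Set.set_eqI)
        fix e show "e \<in> D ?f \<longleftrightarrow> e \<in> E"
        proof (cases "e \<in> pairs n")
          case True
          then obtain i where "i < ?m" "e = b i" using ex_i by blast
          then show ?thesis using memD[of i ?f] by simp
        qed (use D_sub E(1) in blast)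
      qed
      moreover have "?f \<in> carrier (Z2_pairs n)" unfolding c by auto
      ultimately show "x \<in> (\<lambda>f. inv_aut (D f)) ` carrier (Z2_pairs n)"
        unfolding E(2) by (intro image_eqI[of _ _ ?f]) simp_all
    qed
  qed
  ultimately show ?thesis by (auto simp: iso_def bij_betw_def)
qed

lemma Z2_pairs_group: "group (Z2_pairs n)"
  unfolding Z2_power_def by (rule product_group) simp


text \<open>The isomorphism \<Phi> of the first decomposition parametrizes the complement in the
  second, so that both refer to the same \<theta>.\<close>

lemma aut_semidirects:
  "\<exists>\<theta> \<in> hom (sym_group n) (AutoGroup (Z2_pairs n)).
      \<exists>\<Phi> \<in> iso (Z2_pairs_sym n \<theta>) (aut_subgroup n (Aut_gr_inv n)).
        \<Phi> ` (carrier (Z2_pairs n) \<times> {\<one>\<^bsub>sym_group n\<^esub>}) = Aut_inv n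
      \<and> \<Phi> ` ({\<one>\<^bsub>Z2_pairs n\<^esub>} \<times> carrier (sym_group n)) = Aut_gr n
      \<and> (\<exists>\<eta> \<in> hom (Z2_pairs_sym n \<theta>) (AutoGroup (PVT n)).
         \<exists>\<Psi> \<in> iso (semidirect_product (PVT n) (Z2_pairs_sym n \<theta>) \<eta>) (AutoGroup (PVT n)).
           \<Psi> ` (carrier (PVT n) \<times> {\<one>\<^bsub>Z2_pairs_sym n \<theta>\<^esub>}) = inner_auts (PVT n)
         \<and> \<Psi> ` ({\<one>\<^bsub>PVT n\<^esub>} \<times> carrier (Z2_pairs_sym n \<theta>)) = Aut_gr_inv n)"
proof -
  obtain \<alpha> where \<alpha>: "\<alpha> \<in> iso (Z2_pairs n) (aut_subgroup n (Aut_inv n))" using Z2_iso by blast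
  obtain \<theta> \<Phi> where \<theta>: "\<theta> \<in> hom (sym_group n) (AutoGroup (Z2_pairs n))"
    and \<Phi>: "\<Phi> \<in> iso (Z2_pairs_sym n \<theta>) (aut_subgroup n (Aut_gr_inv n))"
      "\<Phi> ` (carrier (Z2_pairs n) \<times> {\<one>\<^bsub>sym_group n\<^esub>}) = Aut_inv n"
      "\<Phi> ` ({\<one>\<^bsub>Z2_pairs n\<^esub>} \<times> carrier (sym_group n)) = Aut_gr n"
    using S.semidirect_iso[OF Z2_pairs_group \<alpha> sym_group_is_group perm_aut_iso] by blast
  have g: "group (Z2_pairs_sym n \<theta>)"
    by (rule semidirect_product_group[OF Z2_pairs_group sym_group_is_group \<theta>])
  have "aut_subgroup n (carrier (AutoGroup (PVT n))) = AutoGroup (PVT n)" by simp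
  then show ?thesis
    using \<theta> \<Phi> I.semidirect_iso[OF X.is_group inner_iso g \<Phi>(1)] by (simp only:) blast
qed

end

theorem theorem5p7:
  fixes n :: nat
  assumes "n \<ge> 5"
  shows
    "(\<exists>p. short_exact_sequence
            (aut_subgroup n (Aut_gr n)) (aut_subgroup n (Aut_gr_inv n)) (aut_subgroup n (Aut_inv n)) p id
          \<and> (\<forall>\<phi>\<in>Aut_gr n. p \<phi> = \<phi>))
   \<and> (\<exists>q. short_exact_sequence
            (aut_subgroup n (Aut_gr_inv n)) (AutoGroup (PVT n)) (aut_subgroup n (inner_auts (PVT n))) q id
          \<and> (\<forall>\<phi>\<in>Aut_gr_inv n. q \<phi> = \<phi>))
   \<and> (\<exists>\<theta> \<in> hom (sym_group n) (AutoGroup (Z2_pairs n)).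
      \<exists>\<Phi> \<in> iso (Z2_pairs_sym n \<theta>) (aut_subgroup n (Aut_gr_inv n)).
        \<Phi> ` (carrier (Z2_pairs n) \<times> {\<one>\<^bsub>sym_group n\<^esub>}) = Aut_inv n
      \<and> \<Phi> ` ({\<one>\<^bsub>Z2_pairs n\<^esub>} \<times> carrier (sym_group n)) = Aut_gr n
      \<and> (\<exists>\<eta> \<in> hom (Z2_pairs_sym n \<theta>) (AutoGroup (PVT n)).
         \<exists>\<Psi> \<in> iso (semidirect_product (PVT n) (Z2_pairs_sym n \<theta>) \<eta>) (AutoGroup (PVT n)).
           \<Psi> ` (carrier (PVT n) \<times> {\<one>\<^bsub>Z2_pairs_sym n \<theta>\<^esub>}) = inner_auts (PVT n)
         \<and> \<Psi> ` ({\<one>\<^bsub>PVT n\<^esub>} \<times> carrier (Z2_pairs_sym n \<theta>)) = Aut_gr_inv n))"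
proof (intro conjI)
  interpret S: internal_semidirect "AutoGroup (PVT n)" "Aut_inv n" "Aut_gr n" "Aut_gr_inv n"
    by (rule Aut_gr_inv_semidirect[OF assms])
  interpret I: internal_semidirect "AutoGroup (PVT n)" "inner_auts (PVT n)" "Aut_gr_inv n" "carrier (AutoGroup (PVT n))"
    by (rule Aut_semidirect[OF assms])
  have "aut_subgroup n (carrier (AutoGroup (PVT n))) = AutoGroup (PVT n)" by simp
  then show "\<exists>q. short_exact_sequence
            (aut_subgroup n (Aut_gr_inv n)) (AutoGroup (PVT n)) (aut_subgroup n (inner_auts (PVT n))) q id
          \<and> (\<forall>\<phi>\<in>Aut_gr_inv n. q \<phi> = \<phi>)"
    using I.split_sequence I.proj_Q by (intro exI[of _ I.proj]) simp
  show "\<exists>p. short_exact_sequence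
            (aut_subgroup n (Aut_gr n)) (aut_subgroup n (Aut_gr_inv n)) (aut_subgroup n (Aut_inv n)) p id
          \<and> (\<forall>\<phi>\<in>Aut_gr n. p \<phi> = \<phi>)"
    using S.split_sequence S.proj_Q by (intro exI[of _ S.proj]) simp
qed (rule aut_semidirects[OF assms])

end
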